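(* Suppose $\mathcal{H}$ is a hereditary $3$-graph property. Then $\mathcal{H}$ is $\mathrm{disc}_{2,3}$-homogeneous if and only if $\mathcal{H}$ has bounded $\mathrm{VC}_2$-dimension, i.e. there is $k\geq1$ such that $\mathrm{VC}_2(H)\leq k$ for all $H\in\mathcal{H}$.
   Context: For distinct $x,y,z$ write $xy=\{x,y\}$, $xyz=\{x,y,z\}$; $[n]=\{1,\dots,n\}$. $K_2[X,Y]=\{xy: x\in X,y\in Y,x\neq y\}$. A $3$-graph is a pair $H=(V,F)$ with $F\subseteq\binom{V}{3}$. A hereditary $3$-graph property is a class of finite $3$-graphs closed under isomorphism and induced sub-$3$-graphs. $\mathrm{VC}_2(H)$ is the largest $k$ for which there are $b_1,\dots,b_k,c_1,\dots,c_k\in V$ and, for each $S\subseteq[k]^2$, $a_S\in V$, such that $\{a_S,b_i,c_j\}\in F$ if and only if $(i,j)\in S$. A bipartite graph $(U\cup W,E)$ with $|E|=d|U||W|$ has $\mathrm{disc}_2(\epsilon)$ if for all $U'\subseteq U$, $W'\subseteq W$, $\big||E\cap K_2[U',W']|-d|U'||W'|\big|\leq\epsilon|U||W|$; it has $\mathrm{disc}_2(\epsilon;d')$ if moreover $\big||E|-d'|U||W|\big|\leq\epsilon|U||W|$. For a graph $G$, $K_3^{(2)}(G)$ is the set of vertex sets of triangles of $G$. If $G=(V_1\cup V_2\cup V_3,E)$ is a $3$-partite graph and $H'=(V_1\cup V_2\cup V_3,F')$ is a $3$-graph with $F'\subseteq K_3^{(2)}(G)$ and $|F'|=d_3|K_3^{(2)}(G)|$,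 then $(H',G)$ has $\mathrm{disc}_{2,3}(\epsilon_1,\epsilon_2)$ if there is $d_2\in(0,1]$ such that each bipartite graph $G[V_i,V_j]$ ($1\leq i<j\leq3$) has $\mathrm{disc}_2(\epsilon_2;d_2)$ and for every (not necessarily induced) subgraph $G'\subseteq G$, $\big||F'\cap K_3^{(2)}(G')|-d_3|K_3^{(2)}(G')|\big|\leq\epsilon_1d_2^3|V_1||V_2||V_3|$. A $(t,\ell,\epsilon_1,\epsilon_2)$-decomposition $\mathcal{P}$ of a set $V$ consists of a partition $V=V_1\cup\dots\cup V_t$ with $|V_1|\leq\dots\leq|V_t|\leq|V_1|+1$ and for each $ij\in\binom{[t]}{2}$ a partition $K_2[V_i,V_j]=\bigcup_{\alpha\leq\ell}P_{ij}^\alpha$, such that for all but at most $\epsilon_1|V|^3$ triples $xyz\in\binom V3$ there are $ijk\in\binom{[t]}{3}$ and $\alpha,\beta,\gamma\in[\ell]$ with $xy\in P^\alpha_{ij}$, $xz\in P^\beta_{ik}$, $yz\in P^\gamma_{jk}$, and each of $P^\alpha_{ij},P^\beta_{ik},P^\gamma_{jk}$ (as bipartite graphs) has $\mathrm{disc}_2(\epsilon_2;1/\ell)$. A triad of $\mathcal{P}$ is a $3$-partite graph $G_{ijk}^{\alpha,\beta,\gamma}=(V_i\cup V_j\cup V_k,P_{ij}^\alpha\cup P_{ik}^\beta\cup P_{jk}^\gamma)$ with $ijk\in\binom{[t]}{3}$, $\alpha,\beta,\gamma\in[\ell]$. For $H=(V,F)$, a triad $G$ of $\mathcal{P}$ has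 $\mathrm{disc}_{2,3}(\epsilon_1,\epsilon_2)$ with respect to $H$ if $(H',G)$ does, where $H'=(V_i\cup V_j\cup V_k,F\cap K_3^{(2)}(G))$. $\mathcal{P}$ is $(\epsilon_1,\epsilon_2)$-regular with respect to $H$ if all but at most $\epsilon_1|V|^3$ triples $xyz\in\binom V3$ lie in $K_3^{(2)}(G)$ for some triad $G$ of $\mathcal{P}$ that has $\mathrm{disc}_{2,3}(\epsilon_1,\epsilon_2)$ with respect to $H$. $\mathcal{P}$ is $\mu$-homogeneous with respect to $H$ if at least $(1-\mu)\binom{|V|}{3}$ triples $xyz\in\binom V3$ lie in $K_3^{(2)}(G)$ for some triad $G$ of $\mathcal{P}$ with $|F\cap K_3^{(2)}(G)|/|K_3^{(2)}(G)|\in[0,\mu)\cup(1-\mu,1]$. $\mathcal{H}$ is $\mathrm{disc}_{2,3}$-homogeneous if for all $t_0,\ell_0\geq1$, $\epsilon_1>0$ and $\epsilon_2:\mathbb{N}\to(0,1]$ there are $T,L,N$ such that for every $H=(V,F)\in\mathcal{H}$ with $|V|\geq N$ there are $t_0\leq t\leq T$, $\ell_0\leq\ell\leq L$ and a $(t,\ell,\epsilon_1,\epsilon_2(\ell))$-decomposition of $V$ which is $(\epsilon_1,\epsilon_2(\ell))$-regular and $\epsilon_1$-homogeneous with respect to $H$. *)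

theory Defs
  imports Complex_Main "HOL-Library.Ramsey" "HOL-Library.Disjoint_Sets"
begin

text \<open>Graphs and 3-graphs are pairs (vertex set, edge set), with edges given as sets of vertices.
  \<open>nsets V k\<close> is the set of \<open>k\<close>-element subsets of \<open>V\<close>.\<close>

type_synonym 'a hgraph = "'a set \<times> 'a set set"

definition graph :: "'a hgraph \<Rightarrow> bool" where
  "graph G \<longleftrightarrow> snd G \<subseteq> nsets (fst G) 2"

definition graph3 :: "'a hgraph \<Rightarrow> bool" where
  "graph3 H \<longleftrightarrow> snd H \<subseteq> nsets (fst H) 3"

definition subgraph :: "'a hgraph \<Rightarrow> 'a hgraph \<Rightarrow> bool" where
  "subgraph G' G \<longleftrightarrow> graph G' \<and> fst G' \<subseteq> fst G \<and> snd G' \<subseteq> snd G"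

definition induced :: "'a hgraph \<Rightarrow> 'a set \<Rightarrow> 'a hgraph" where
  "induced H U = (U, {e \<in> snd H. e \<subseteq> U})"

definition isomorphic :: "'a hgraph \<Rightarrow> 'a hgraph \<Rightarrow> bool" where
  "isomorphic H H' \<longleftrightarrow>
     (\<exists>f. bij_betw f (fst H) (fst H') \<and> snd H' = (\<lambda>e. f ` e) ` snd H)"

text \<open>A class of finite 3-graphs is represented by its members with vertices in an arbitrary
  type \<open>'a\<close>. For infinite \<open>'a\<close>, each finite 3-graph has an isomorphic copy there.\<close>

definition hereditary :: "'a hgraph set \<Rightarrow> bool" where
  "hereditary \<H> \<longleftrightarrow>
     (\<forall>H\<in>\<H>. graph3 H \<and> finite (fst H)) \<and>
     (\<forall>H\<in>\<H>. \<forall>H'. graph3 H' \<and> isomorphic H H' \<longrightarrow> H' \<in> \<H>) \<and>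
     (\<forall>H\<in>\<H>. \<forall>U\<subseteq>fst H. induced H U \<in> \<H>)"


definition VC2_shattered :: "'a hgraph \<Rightarrow> nat \<Rightarrow> bool" where
  "VC2_shattered H k \<longleftrightarrow>
     (\<exists>b c a. (\<forall>i\<in>{1..k}. b i \<in> fst H \<and> c i \<in> fst H) \<and>
        (\<forall>S \<subseteq> {1..k} \<times> {1..k}. a S \<in> fst H \<and>
           (\<forall>i\<in>{1..k}. \<forall>j\<in>{1..k}. {a S, b i, c j} \<in> snd H \<longleftrightarrow> (i, j) \<in> S)))"

text \<open>For a 3-graph with finite nonempty vertex set the supremum is a maximum, by the lemma below
  and since 0 qualifies. For the empty vertex set no \<open>k\<close> qualifies and the value is
  \<open>Sup {} = 0\<close>.\<close>

definition VC2 :: "'a hgraph \<Rightarrow> nat" where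
  "VC2 H = Sup {k. VC2_shattered H k}"

lemma VC2_shattered_le_card:
  assumes "finite (fst H)" "VC2_shattered H k"
  shows "k \<le> card (fst H)"
proof -
  obtain b c a where b: "\<forall>i\<in>{1..k}. b i \<in> fst H"
    and a: "\<And>S i j. \<lbrakk>S \<subseteq> {1..k} \<times> {1..k}; i \<in> {1..k}; j \<in> {1..k}\<rbrakk>
              \<Longrightarrow> {a S, b i, c j} \<in> snd H \<longleftrightarrow> (i, j) \<in> S"
    using assms(2) unfolding VC2_shattered_def by metis
  have "inj_on b {1..k}"
  proof (rule inj_onI)
    fix i i' assume i: "i \<in> {1..k}" "i' \<in> {1..k}" "b i = b i'"
    then show "i = i'"
      using a[of "{(i, 1)}" i 1] a[of "{(i, 1)}" i' 1] by auto
  qed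
  then have "card {1..k} \<le> card (fst H)"
    using b assms(1) by (intro card_inj_on_le[of b]) auto
  then show ?thesis by simp
qed


definition K2 :: "'a set \<Rightarrow> 'a set \<Rightarrow> 'a set set" where
  "K2 X Y = {{x, y} | x y. x \<in> X \<and> y \<in> Y \<and> x \<noteq> y}"

definition K3 :: "'a hgraph \<Rightarrow> 'a set set" where
  "K3 G = {{x, y, z} | x y z. x \<noteq> y \<and> x \<noteq> z \<and> y \<noteq> z \<and>
             {x, y} \<in> snd G \<and> {x, z} \<in> snd G \<and> {y, z} \<in> snd G}"

text \<open>In the next definitions the densities \<open>d\<close> and \<open>d3\<close> are quotients. If the denominator
  is 0, then all cardinalities they are compared with vanish, so the value is irrelevant.\<close>

definition bipartite :: "'a set \<Rightarrow> 'a set \<Rightarrow> 'a set set \<Rightarrow> bool" where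
  "bipartite U W E \<longleftrightarrow> U \<inter> W = {} \<and> E \<subseteq> K2 U W"

definition disc2 :: "real \<Rightarrow> 'a set \<Rightarrow> 'a set \<Rightarrow> 'a set set \<Rightarrow> bool" where
  "disc2 \<epsilon> U W E \<longleftrightarrow> bipartite U W E \<and>
     (let d = real (card E) / (real (card U) * real (card W)) in
      \<forall>U' W'. U' \<subseteq> U \<and> W' \<subseteq> W \<longrightarrow>
        \<bar>real (card (E \<inter> K2 U' W')) - d * real (card U') * real (card W')\<bar>
          \<le> \<epsilon> * real (card U) * real (card W))"

definition disc2_density :: "real \<Rightarrow> real \<Rightarrow> 'a set \<Rightarrow> 'a set \<Rightarrow> 'a set set \<Rightarrow> bool" where
  "disc2_density \<epsilon> d' U W E \<longleftrightarrow> disc2 \<epsilon> U W E \<and>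
     \<bar>real (card E) - d' * real (card U) * real (card W)\<bar> \<le> \<epsilon> * real (card U) * real (card W)"

definition tripartite :: "'a set \<Rightarrow> 'a set \<Rightarrow> 'a set \<Rightarrow> 'a hgraph \<Rightarrow> bool" where
  "tripartite V1 V2 V3 G \<longleftrightarrow>
     V1 \<inter> V2 = {} \<and> V1 \<inter> V3 = {} \<and> V2 \<inter> V3 = {} \<and>
     fst G = V1 \<union> V2 \<union> V3 \<and> snd G \<subseteq> K2 V1 V2 \<union> K2 V1 V3 \<union> K2 V2 V3"

definition disc23 ::
  "real \<Rightarrow> real \<Rightarrow> 'a set \<Rightarrow> 'a set \<Rightarrow> 'a set \<Rightarrow> 'a hgraph \<Rightarrow> 'a hgraph \<Rightarrow> bool" where
  "disc23 \<epsilon>1 \<epsilon>2 V1 V2 V3 H' G \<longleftrightarrow>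
     tripartite V1 V2 V3 G \<and> fst H' = V1 \<union> V2 \<union> V3 \<and> snd H' \<subseteq> K3 G \<and>
     (let d3 = real (card (snd H')) / real (card (K3 G)) in
      \<exists>d2. 0 < d2 \<and> d2 \<le> 1 \<and>
        disc2_density \<epsilon>2 d2 V1 V2 (snd G \<inter> K2 V1 V2) \<and>
        disc2_density \<epsilon>2 d2 V1 V3 (snd G \<inter> K2 V1 V3) \<and>
        disc2_density \<epsilon>2 d2 V2 V3 (snd G \<inter> K2 V2 V3) \<and>
        (\<forall>G'. subgraph G' G \<longrightarrow>
           \<bar>real (card (snd H' \<inter> K3 G')) - d3 * real (card (K3 G'))\<bar>
             \<le> \<epsilon>1 * d2 ^ 3 * real (card V1) * real (card V2) * real (card V3)))"


text \<open>A decomposition is given by its vertex parts \<open>A i\<close> for \<open>i \<in> {1..t}\<close> and its edge parts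
  \<open>P {i, j} \<alpha>\<close> for \<open>\<alpha> \<in> {1..l}\<close>, where the first index of \<open>P\<close> is an unordered pair. Parts may be
  empty.\<close>

definition decomposition ::
  "nat \<Rightarrow> nat \<Rightarrow> real \<Rightarrow> real \<Rightarrow> 'a set \<Rightarrow> (nat \<Rightarrow> 'a set) \<Rightarrow> (nat set \<Rightarrow> nat \<Rightarrow> 'a set set) \<Rightarrow> bool"
where
  "decomposition t l \<epsilon>1 \<epsilon>2 V A P \<longleftrightarrow>
     (\<Union>i\<in>{1..t}. A i) = V \<and> disjoint_family_on A {1..t} \<and>
     (\<forall>i\<in>{1..t}. \<forall>j\<in>{1..t}. i \<le> j \<longrightarrow> card (A i) \<le> card (A j)) \<and>
     card (A t) \<le> card (A 1) + 1 \<and>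
     (\<forall>i\<in>{1..t}. \<forall>j\<in>{1..t}. i \<noteq> j \<longrightarrow>
        (\<Union>\<alpha>\<in>{1..l}. P {i, j} \<alpha>) = K2 (A i) (A j) \<and> disjoint_family_on (P {i, j}) {1..l}) \<and>
     real (card {T \<in> nsets V 3. \<not> (\<exists>x y z i j k \<alpha> \<beta> \<gamma>. T = {x, y, z} \<and>
        {i, j, k} \<in> nsets {1..t} 3 \<and> \<alpha> \<in> {1..l} \<and> \<beta> \<in> {1..l} \<and> \<gamma> \<in> {1..l} \<and>
        {x, y} \<in> P {i, j} \<alpha> \<and> {x, z} \<in> P {i, k} \<beta> \<and> {y, z} \<in> P {j, k} \<gamma> \<and>
        disc2_density \<epsilon>2 (1 / real l) (A i) (A j) (P {i, j} \<alpha>) \<and>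
        disc2_density \<epsilon>2 (1 / real l) (A i) (A k) (P {i, k} \<beta>) \<and>
        disc2_density \<epsilon>2 (1 / real l) (A j) (A k) (P {j, k} \<gamma>))})
       \<le> \<epsilon>1 * real (card V) ^ 3"

definition triad ::
  "(nat \<Rightarrow> 'a set) \<Rightarrow> (nat set \<Rightarrow> nat \<Rightarrow> 'a set set) \<Rightarrow>
     nat \<Rightarrow> nat \<Rightarrow> nat \<Rightarrow> nat \<Rightarrow> nat \<Rightarrow> nat \<Rightarrow> 'a hgraph" where
  "triad A P i j k \<alpha> \<beta> \<gamma> = (A i \<union> A j \<union> A k, P {i, j} \<alpha> \<union> P {i, k} \<beta> \<union> P {j, k} \<gamma>)"

definition regular_decomp ::
  "nat \<Rightarrow> nat \<Rightarrow> (nat \<Rightarrow> 'a set) \<Rightarrow> (nat set \<Rightarrow> nat \<Rightarrow> 'a set set) \<Rightarrow> real \<Rightarrow> real \<Rightarrow> 'a hgraph \<Rightarrow> bool"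
where
  "regular_decomp t l A P \<epsilon>1 \<epsilon>2 H \<longleftrightarrow>
     real (card {T \<in> nsets (fst H) 3. \<not> (\<exists>i j k \<alpha> \<beta> \<gamma>.
        {i, j, k} \<in> nsets {1..t} 3 \<and> \<alpha> \<in> {1..l} \<and> \<beta> \<in> {1..l} \<and> \<gamma> \<in> {1..l} \<and>
        (let G = triad A P i j k \<alpha> \<beta> \<gamma> in
          T \<in> K3 G \<and>
          disc23 \<epsilon>1 \<epsilon>2 (A i) (A j) (A k) (A i \<union> A j \<union> A k, snd H \<inter> K3 G) G))})
       \<le> \<epsilon>1 * real (card (fst H)) ^ 3"

definition homogeneous_decomp ::
  "nat \<Rightarrow> nat \<Rightarrow> (nat \<Rightarrow> 'a set) \<Rightarrow> (nat set \<Rightarrow> nat \<Rightarrow> 'a set set) \<Rightarrow> real \<Rightarrow> 'a hgraph \<Rightarrow> bool"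
where
  "homogeneous_decomp t l A P \<mu> H \<longleftrightarrow>
     real (card {T \<in> nsets (fst H) 3. \<exists>i j k \<alpha> \<beta> \<gamma>.
        {i, j, k} \<in> nsets {1..t} 3 \<and> \<alpha> \<in> {1..l} \<and> \<beta> \<in> {1..l} \<and> \<gamma> \<in> {1..l} \<and>
        (let G = triad A P i j k \<alpha> \<beta> \<gamma> in
          T \<in> K3 G \<and>
          real (card (snd H \<inter> K3 G)) / real (card (K3 G)) \<in> {0..<\<mu>} \<union> {1 - \<mu><..1})})
       \<ge> (1 - \<mu>) * real (card (fst H) choose 3)"

definition disc23_homogeneous :: "'a hgraph set \<Rightarrow> bool" where
  "disc23_homogeneous \<H> \<longleftrightarrow>
     (\<forall>(t0::nat) (l0::nat) (\<epsilon>1::real) (\<epsilon>2 :: nat \<Rightarrow> real).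
        1 \<le> t0 \<and> 1 \<le> l0 \<and> 0 < \<epsilon>1 \<and> (\<forall>n. 0 < \<epsilon>2 n \<and> \<epsilon>2 n \<le> 1) \<longrightarrow>
        (\<exists>T L N. \<forall>H\<in>\<H>. N \<le> card (fst H) \<longrightarrow>
           (\<exists>t l A P. t0 \<le> t \<and> t \<le> T \<and> l0 \<le> l \<and> l \<le> L \<and>
              decomposition t l \<epsilon>1 (\<epsilon>2 l) (fst H) A P \<and>
              regular_decomp t l A P \<epsilon>1 (\<epsilon>2 l) H \<and>
              homogeneous_decomp t l A P \<epsilon>1 H)))"

end

theory Submission
  imports Defs "HOL-Analysis.Analysis"
begin

text \<open>If the \<open>VC\<^sub>2\<close>-dimension is bounded, a Frieze--Kannan argument approximates the edge indicator \<open>f\<close>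
  on ordered triples by its average \<open>h\<close> over boundedly many cells given by pair colourings, up to an
  error that is small against all products \<open>u(x,y) v(x,z) w(y,z)\<close>. In a count of shattered patterns
  \<open>f\<close> can therefore be replaced by \<open>h\<close> factor by factor. Since no pattern occurs, and since the count for
  \<open>h\<close> is at least a power of the mean of \<open>h (1 - h)\<close> that depends only on the dimension, \<open>h\<close> is close to 0 or 1
  almost everywhere. Szemeredi's lemma makes the pair colouring quasirandom between most vertex
  parts, and a random subdivision of its classes yields classes of density \<open>1/l\<close>; almost all triads lie in one
  cell, hence are homogeneous on average. A homogeneous triad with quasirandom pairs satisfies the
  \<open>disc\<^sub>2\<^sub>,\<^sub>3\<close> condition trivially, because it has at most \<open>2/l\<^sup>3\<close> times as many triangles as there are
  transversal triples; so no regularity lemma for 3-graphs is needed.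

  Conversely, a hereditary class of unbounded \<open>VC\<^sub>2\<close>-dimension contains 3-graphs whose transversal
  triples are random with density 1/2 on three vertex classes of equal size; then a homogeneous triad
  contains few transversal triples.\<close>

section \<open>Conditional averages and energy increments\<close>

text \<open>The obstacle is the order of choices: the discrepancy \<open>\<epsilon>2 l\<close>
  demanded of the edge classes depends on their number \<open>l\<close>, so \<open>l\<close> has to
  be fixed before the vertices are partitioned. This is possible because the cylinder approximation
  bounds the number \<open>M\<close> of pair colours in terms of \<open>\<mu>\<close> and the
  dimension alone. Transporting the colour densities onto \<open>l\<close> classes of weight
  \<open>1 / l\<close> leaves at most \<open>M\<close> classes with several colours, so
  \<open>l\<close> of order \<open>M / \<mu>\<close> makes them negligible; only then are
  \<open>\<epsilon>\<close>, \<open>\<eta>\<close> and the bound on the number of parts chosen. In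
  particular, one value of \<open>l\<close> serves all large 3-graphs.

  Homogeneity of triads is read off from an L1 bound: smallness of the mean of
  \<open>h * (1 - h)\<close> says that \<open>f\<close> and \<open>h\<close> are close in L1, and a
  triad of intermediate density on which \<open>h\<close> is constant contributes a fixed share to
  their distance.

  Both random constructions rest on a comparison of exponents: products of part sizes against their
  sums when labels are drawn, and \<open>n ^ 3\<close> against \<open>n\<^sup>2\<close> for the
  quasirandom 3-graphs.\<close>

definition cell :: "'w set \<Rightarrow> ('w \<Rightarrow> 'b) \<Rightarrow> 'w \<Rightarrow> 'w set" where
  "cell \<Omega> \<pi> w = {w' \<in> \<Omega>. \<pi> w' = \<pi> w}"

text \<open>Conditional expectation of \<open>f\<close> given \<open>\<pi>\<close> under the uniform
  measure. An empty cell gives the value 0 because \<open>x / 0 = 0\<close>, so bounds by 0 and 1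
  hold at every \<open>w\<close>, also outside \<open>\<Omega>\<close>.\<close>

definition cond_avg :: "'w set \<Rightarrow> ('w \<Rightarrow> 'b) \<Rightarrow> ('w \<Rightarrow> real) \<Rightarrow> 'w \<Rightarrow> real" where
  "cond_avg \<Omega> \<pi> f w = (\<Sum>w'\<in>cell \<Omega> \<pi> w. f w') / real (card (cell \<Omega> \<pi> w))"

text \<open>A squared L2 norm, left unnormalised: for \<open>f\<close> with values in
  \<open>[0, 1]\<close> it is at most \<open>card \<Omega>\<close>, and increments are stated as
  multiples of \<open>card \<Omega>\<close>.\<close>

definition energy :: "'w set \<Rightarrow> ('w \<Rightarrow> 'b) \<Rightarrow> ('w \<Rightarrow> real) \<Rightarrow> real" where
  "energy \<Omega> \<pi> f = (\<Sum>w\<in>\<Omega>. (cond_avg \<Omega> \<pi> f w)\<^sup>2)"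

lemma cond_avg_cong: "\<pi> w = \<pi> w' \<Longrightarrow> cond_avg \<Omega> \<pi> f w = cond_avg \<Omega> \<pi> f w'"
  by (simp add: cond_avg_def cell_def)

lemma cond_avg_bounds:
  assumes "finite \<Omega>" "\<And>w. w \<in> \<Omega> \<Longrightarrow> 0 \<le> f w \<and> f w \<le> 1"
  shows "0 \<le> cond_avg \<Omega> \<pi> f w" "cond_avg \<Omega> \<pi> f w \<le> 1"
proof -
  have "0 \<le> (\<Sum>w'\<in>cell \<Omega> \<pi> w. f w')"
    using assms by (intro sum_nonneg) (auto simp: cell_def)
  moreover have "(\<Sum>w'\<in>cell \<Omega> \<pi> w. f w') \<le> (\<Sum>w'\<in>cell \<Omega> \<pi> w. 1)"
    using assms by (intro sum_mono) (auto simp: cell_def)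
  ultimately show "0 \<le> cond_avg \<Omega> \<pi> f w" "cond_avg \<Omega> \<pi> f w \<le> 1"
    unfolding cond_avg_def by (auto simp: divide_le_eq_1)
qed

text \<open>Averaging over cells is the orthogonal projection onto the functions that are constant
  on cells, and \<open>g\<close> is such a function. After exchanging the two sums, each
  \<open>f w'\<close> is collected once from every element of its cell, divided by the size of the
  cell.\<close>

lemma sum_cond_avg_mult:
  assumes fin: "finite \<Omega>"
    and g: "\<And>w w'. w \<in> \<Omega> \<Longrightarrow> w' \<in> \<Omega> \<Longrightarrow> \<pi> w = \<pi> w' \<Longrightarrow> g w = g w'"
  shows "(\<Sum>w\<in>\<Omega>. cond_avg \<Omega> \<pi> f w * g w) = (\<Sum>w\<in>\<Omega>. f w * g w)"
proof -
  let ?c = "\<lambda>w. real (card (cell \<Omega> \<pi> w))"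
  have "(\<Sum>w\<in>\<Omega>. cond_avg \<Omega> \<pi> f w * g w) = (\<Sum>w\<in>\<Omega>. \<Sum>w'\<in>cell \<Omega> \<pi> w. f w' * g w / ?c w)"
    by (simp add: cond_avg_def sum_distrib_right sum_divide_distrib)
  also have "\<dots> = (\<Sum>w\<in>\<Omega>. \<Sum>w'\<in>\<Omega>. if \<pi> w' = \<pi> w then f w' * g w / ?c w else 0)"
    unfolding cell_def by (rule sum.cong[OF refl]) (rule sum.inter_filter[OF fin])
  also have "\<dots> = (\<Sum>w'\<in>\<Omega>. \<Sum>w\<in>\<Omega>. if \<pi> w' = \<pi> w then f w' * g w / ?c w else 0)"
    by (rule sum.swap)
  also have "\<dots> = (\<Sum>w'\<in>\<Omega>. f w' * g w')"
  proof (rule sum.cong[OF refl])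
    fix w' assume w': "w' \<in> \<Omega>"
    have "(if \<pi> w' = \<pi> w then f w' * g w / ?c w else 0)
        = (if \<pi> w = \<pi> w' then f w' * g w' / ?c w' else 0)" if "w \<in> \<Omega>" for w
    proof (cases "\<pi> w = \<pi> w'")
      case True
      then show ?thesis using g[OF that w'] by (simp add: cell_def)
    qed auto
    then have "(\<Sum>w\<in>\<Omega>. if \<pi> w' = \<pi> w then f w' * g w / ?c w else 0)
        = (\<Sum>w\<in>\<Omega>. if \<pi> w = \<pi> w' then f w' * g w' / ?c w' else 0)"
      by (rule sum.cong[OF refl])
    also have "\<dots> = (\<Sum>w\<in>cell \<Omega> \<pi> w'. f w' * g w' / ?c w')"
      unfolding cell_def by (rule sum.inter_filter[OF fin, symmetric])
    also have "\<dots> = f w' * g w'"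
    proof -
      have "w' \<in> cell \<Omega> \<pi> w'" using w' by (simp add: cell_def)
      then have "card (cell \<Omega> \<pi> w') \<noteq> 0" using fin by (auto simp: cell_def)
      then show ?thesis by simp
    qed
    finally show "(\<Sum>w\<in>\<Omega>. if \<pi> w' = \<pi> w then f w' * g w / ?c w else 0) = f w' * g w'" .
  qed
  finally show ?thesis .
qed

lemma energy_le:
  assumes "finite \<Omega>" "\<And>w. w \<in> \<Omega> \<Longrightarrow> 0 \<le> f w \<and> f w \<le> 1"
  shows "energy \<Omega> \<pi> f \<le> real (card \<Omega>)"
proof -
  have "energy \<Omega> \<pi> f \<le> (\<Sum>w\<in>\<Omega>. 1)"
    unfolding energy_def by (intro sum_mono) (simp add: assms cond_avg_bounds power_le_one)
  then show ?thesis by simp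
qed

lemma energy_nonneg: "0 \<le> energy \<Omega> \<pi> f"
  unfolding energy_def by (intro sum_nonneg) simp

text \<open>Since \<open>\<pi>'\<close> refines \<open>\<pi>\<close>, Pythagoras gives
  \<open>D\<close>, the squared distance of the two averages, as the difference of the energies. As
  \<open>g\<close> is constant on the cells of \<open>\<pi>'\<close>, its correlation with
  \<open>f - ?h\<close> equals that with \<open>?h' - ?h\<close>, which Cauchy-Schwarz bounds by
  means of \<open>D\<close>.\<close>

lemma energy_increment:
  assumes fin: "finite \<Omega>"
    and ref: "\<And>w w'. w \<in> \<Omega> \<Longrightarrow> w' \<in> \<Omega> \<Longrightarrow> \<pi>' w = \<pi>' w' \<Longrightarrow> \<pi> w = \<pi> w'"
    and g: "\<And>w w'. w \<in> \<Omega> \<Longrightarrow> w' \<in> \<Omega> \<Longrightarrow> \<pi>' w = \<pi>' w' \<Longrightarrow> g w = g w'"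
    and g1: "\<And>w. w \<in> \<Omega> \<Longrightarrow> \<bar>g w\<bar> \<le> 1"
    and gap: "\<delta> * real (card \<Omega>) \<le> \<bar>\<Sum>w\<in>\<Omega>. (f w - cond_avg \<Omega> \<pi> f w) * g w\<bar>"
    and "0 \<le> \<delta>"
  shows "energy \<Omega> \<pi> f + \<delta>\<^sup>2 * real (card \<Omega>) \<le> energy \<Omega> \<pi>' f"
proof (cases "\<Omega> = {}")
  case True then show ?thesis by (simp add: energy_def)
next
  case False
  let ?h = "cond_avg \<Omega> \<pi> f" and ?h' = "cond_avg \<Omega> \<pi>' f"
  define n where "n = real (card \<Omega>)"
  have n: "n > 0" using False fin by (simp add: n_def card_gt_0_iff)
  define D where "D = (\<Sum>w\<in>\<Omega>. (?h' w - ?h w)\<^sup>2)"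
  have hc: "\<pi> w = \<pi> w'" if "w \<in> \<Omega>" "w' \<in> \<Omega>" "\<pi>' w = \<pi>' w'" for w w' using ref that by blast
  have 1: "(\<Sum>w\<in>\<Omega>. ?h' w * ?h w) = (\<Sum>w\<in>\<Omega>. f w * ?h w)"
    using hc by (intro sum_cond_avg_mult fin) (metis cond_avg_cong)
  have 2: "(\<Sum>w\<in>\<Omega>. ?h w * ?h w) = (\<Sum>w\<in>\<Omega>. f w * ?h w)"
    by (intro sum_cond_avg_mult fin) (metis cond_avg_cong)
  have "D = energy \<Omega> \<pi>' f - 2 * (\<Sum>w\<in>\<Omega>. ?h' w * ?h w) + energy \<Omega> \<pi> f"
    by (simp add: D_def energy_def power2_diff sum.distrib sum_subtractf sum_distrib_left mult.assoc)
  also have "(\<Sum>w\<in>\<Omega>. ?h' w * ?h w) = energy \<Omega> \<pi> f"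
    using 1 2 by (simp add: energy_def power2_eq_square)
  finally have D: "D = energy \<Omega> \<pi>' f - energy \<Omega> \<pi> f" by simp
  have "(\<Sum>w\<in>\<Omega>. (f w - ?h w) * g w) = (\<Sum>w\<in>\<Omega>. f w * g w) - (\<Sum>w\<in>\<Omega>. ?h w * g w)"
    by (simp add: left_diff_distrib sum_subtractf)
  also have "(\<Sum>w\<in>\<Omega>. f w * g w) = (\<Sum>w\<in>\<Omega>. ?h' w * g w)"
    using g by (intro sum_cond_avg_mult[symmetric] fin) blast
  also have "(\<Sum>w\<in>\<Omega>. ?h' w * g w) - (\<Sum>w\<in>\<Omega>. ?h w * g w) = (\<Sum>w\<in>\<Omega>. (?h' w - ?h w) * g w)"
    by (simp add: left_diff_distrib sum_subtractf)
  finally have eq: "(\<Sum>w\<in>\<Omega>. (f w - ?h w) * g w) = (\<Sum>w\<in>\<Omega>. (?h' w - ?h w) * g w)" .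
  have "(\<delta> * n)\<^sup>2 \<le> (\<Sum>w\<in>\<Omega>. (?h' w - ?h w) * g w)\<^sup>2"
    using gap \<open>0 \<le> \<delta>\<close> n unfolding eq n_def[symmetric]
    by (metis abs_le_square_iff abs_of_nonneg less_imp_le mult_nonneg_nonneg)
  also have "\<dots> \<le> D * (\<Sum>w\<in>\<Omega>. (g w)\<^sup>2)"
    unfolding D_def by (rule Cauchy_Schwarz_ineq_sum)
  also have "\<dots> \<le> D * n"
  proof -
    have "(\<Sum>w\<in>\<Omega>. (g w)\<^sup>2) \<le> (\<Sum>w\<in>\<Omega>. 1)"
      using g1 by (intro sum_mono) (simp add: abs_square_le_1)
    moreover have "0 \<le> D" unfolding D_def by (intro sum_nonneg) simp
    ultimately show ?thesis by (intro mult_left_mono) (auto simp: n_def)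
  qed
  finally have "\<delta>\<^sup>2 * n \<le> D"
    using n by (simp add: power_mult_distrib power2_eq_square[of n] mult.assoc[symmetric])
  then show ?thesis using D by (simp add: n_def)
qed

section \<open>Iterating increments of a bounded quantity\<close>

primrec iterated_size_bound :: "(nat \<Rightarrow> nat) \<Rightarrow> nat \<Rightarrow> nat \<Rightarrow> nat" where
  "iterated_size_bound \<Phi> 0 r = r"
| "iterated_size_bound \<Phi> (Suc m) r = max r (iterated_size_bound \<Phi> m (\<Phi> r))"

lemma iterated_size_bound_ge: "r \<le> iterated_size_bound \<Phi> m r"
  by (cases m) auto

text \<open>Every failure of \<open>good\<close> raises \<open>e\<close> by \<open>\<delta>\<close>
  while \<open>e\<close> never exceeds \<open>B\<close>, so fewer than \<open>m\<close> increments
  occur. The size \<open>r\<close> is carried along because \<open>good\<close> may refer to it: in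
  graph regularity the admissible refinements depend on the current number of classes. The bound is
  a maximum over the iterates of \<open>\<Phi>\<close>, since the process may stop at any of them
  and \<open>\<Phi>\<close> need not be increasing.\<close>

lemma increment_terminates:
  fixes e :: "'p \<Rightarrow> real" and bnd good :: "'p \<Rightarrow> nat \<Rightarrow> bool"
  assumes step: "\<And>p r. bnd p r \<Longrightarrow> \<not> good p r \<Longrightarrow> \<exists>p'. bnd p' (\<Phi> r) \<and> e p + \<delta> \<le> e p'"
    and bound: "\<And>p. e p \<le> B"
    and "B - real m * \<delta> < e p" "bnd p r"
  shows "\<exists>p' r'. good p' r' \<and> bnd p' r' \<and> r' \<le> iterated_size_bound \<Phi> m r"
  using assms(3,4)
proof (induction m arbitrary: p r)
  case 0
  then show ?case using bound[of p] by simp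
next
  case (Suc m)
  show ?case
  proof (cases "good p r")
    case True
    then show ?thesis using Suc.prems by (intro exI[of _ p] exI[of _ r]) auto
  next
    case False
    then obtain p' where p': "bnd p' (\<Phi> r)" "e p + \<delta> \<le> e p'" using step Suc.prems by blast
    then have "B - real m * \<delta> < e p'" using Suc.prems(1) by (simp add: algebra_simps)
    from Suc.IH[OF this p'(1)] show ?thesis by (metis iterated_size_bound.simps(2) le_max_iff_disj)
  qed
qed

section \<open>Weak regularity with respect to cylinder sets\<close>

text \<open>The sum is linear in each single value \<open>u b\<close>, so it does not decrease when
  \<open>u b\<close> becomes 1 where its coefficient is positive and 0 elsewhere.\<close>

lemma sum_mult_le_sum_indicator:
  fixes \<phi> :: "'w \<Rightarrow> real" and p :: "'w \<Rightarrow> 'b"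
  assumes fin: "finite \<Omega>" and u: "\<And>b. 0 \<le> u b \<and> u b \<le> 1"
  shows "\<exists>E. (\<Sum>w\<in>\<Omega>. \<phi> w * u (p w)) \<le> (\<Sum>w\<in>\<Omega>. \<phi> w * indicator E (p w))"
proof
  let ?s = "\<lambda>b. \<Sum>w\<in>{w\<in>\<Omega>. p w = b}. \<phi> w"
  let ?E = "{b. ?s b > 0}"
  have gen: "(\<Sum>w\<in>\<Omega>. \<phi> w * v (p w)) = (\<Sum>b\<in>p ` \<Omega>. ?s b * v b)" for v :: "'b \<Rightarrow> real"
    unfolding sum.image_gen[OF fin, of _ p] sum_distrib_right by (rule sum.cong[OF refl]) auto
  have "?s b * u b \<le> ?s b * indicator ?E b" for b
    using u[of b] mult_left_le[of "u b" "?s b"] 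
    by (cases "?s b > 0") (auto simp: mult_nonpos_nonneg)
  then show "(\<Sum>w\<in>\<Omega>. \<phi> w * u (p w)) \<le> (\<Sum>w\<in>\<Omega>. \<phi> w * indicator ?E (p w))"
    unfolding gen by (intro sum_mono)
qed

definition cyl :: "('a \<times> 'a \<Rightarrow> real) \<Rightarrow> ('a \<times> 'a \<Rightarrow> real) \<Rightarrow> ('a \<times> 'a \<Rightarrow> real) \<Rightarrow> 'a \<times> 'a \<times> 'a \<Rightarrow> real" where
  "cyl u v w = (\<lambda>(x, y, z). u (x, y) * v (x, z) * w (y, z))"

text \<open>The three weights are rounded one at a time, the other two being absorbed into the
  coefficient, which may have any sign.\<close>

lemma sum_cyl_le_sum_indicator:
  fixes g :: "'a \<times> 'a \<times> 'a \<Rightarrow> real"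
  assumes fin: "finite \<Omega>"
    and u: "\<And>b. 0 \<le> u b \<and> u b \<le> 1" and v: "\<And>b. 0 \<le> v b \<and> v b \<le> 1" and w: "\<And>b. 0 \<le> w b \<and> w b \<le> 1"
  shows "\<exists>E1 E2 E3. (\<Sum>q\<in>\<Omega>. g q * cyl u v w q)
    \<le> (\<Sum>q\<in>\<Omega>. g q * cyl (indicator E1) (indicator E2) (indicator E3) q)"
proof -
  define p1 p2 p3 :: "'a \<times> 'a \<times> 'a \<Rightarrow> 'a \<times> 'a"
    where p: "p1 = (\<lambda>(x, y, z). (x, y))" "p2 = (\<lambda>(x, y, z). (x, z))" "p3 = (\<lambda>(x, y, z). (y, z))"
  have c: "cyl u v w q = u (p1 q) * v (p2 q) * w (p3 q)" for u v w and q :: "'a \<times> 'a \<times> 'a"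
    by (simp add: cyl_def p split: prod.splits)
  obtain E1 where E1: "(\<Sum>q\<in>\<Omega>. g q * v (p2 q) * w (p3 q) * u (p1 q))
      \<le> (\<Sum>q\<in>\<Omega>. g q * v (p2 q) * w (p3 q) * indicator E1 (p1 q))"
    using sum_mult_le_sum_indicator[where p=p1 and u=u and \<phi>="\<lambda>q. g q * v (p2 q) * w (p3 q)", OF fin u] by blast
  obtain E2 where E2: "(\<Sum>q\<in>\<Omega>. g q * indicator E1 (p1 q) * w (p3 q) * v (p2 q))
      \<le> (\<Sum>q\<in>\<Omega>. g q * indicator E1 (p1 q) * w (p3 q) * indicator E2 (p2 q))"
    using sum_mult_le_sum_indicator[where p=p2 and u=v and \<phi>="\<lambda>q. g q * indicator E1 (p1 q) * w (p3 q)", OF fin v] by blast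
  obtain E3 where E3: "(\<Sum>q\<in>\<Omega>. g q * indicator E1 (p1 q) * indicator E2 (p2 q) * w (p3 q))
      \<le> (\<Sum>q\<in>\<Omega>. g q * indicator E1 (p1 q) * indicator E2 (p2 q) * indicator E3 (p3 q))"
    using sum_mult_le_sum_indicator[where p=p3 and u=w and \<phi>="\<lambda>q. g q * indicator E1 (p1 q) * indicator E2 (p2 q)", OF fin w] by blast
  show ?thesis
    using E1 E2 E3 unfolding c by (intro exI[of _ E1] exI[of _ E2] exI[of _ E3]) (simp add: mult_ac)
qed

text \<open>Each pair of coordinates has its own colouring, so that a cylinder of three sets becomes
  constant on the cells as soon as each colouring is refined by one set.\<close>

definition cyl_map :: "('a \<times> 'a \<Rightarrow> nat) \<Rightarrow> ('a \<times> 'a \<Rightarrow> nat) \<Rightarrow> ('a \<times> 'a \<Rightarrow> nat) \<Rightarrow> 'a \<times> 'a \<times> 'a \<Rightarrow> nat \<times> nat \<times> nat" where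
  "cyl_map \<kappa>1 \<kappa>2 \<kappa>3 = (\<lambda>(x, y, z). (\<kappa>1 (x, y), \<kappa>2 (x, z), \<kappa>3 (y, z)))"

text \<open>A bound in a cut norm for functions of three variables. Real weights appear instead of
  sets because in the pattern counts the remaining factors are products of averages.\<close>

definition cyl_uniform :: "'a set \<Rightarrow> real \<Rightarrow> ('a \<times> 'a \<times> 'a \<Rightarrow> real) \<Rightarrow> bool" where
  "cyl_uniform V \<delta> g \<longleftrightarrow>
     (\<forall>u v w. (\<forall>b. 0 \<le> u b \<and> u b \<le> 1) \<and> (\<forall>b. 0 \<le> v b \<and> v b \<le> 1) \<and> (\<forall>b. 0 \<le> w b \<and> w b \<le> 1) \<longrightarrow>
        \<bar>\<Sum>q\<in>V \<times> V \<times> V. g q * cyl u v w q\<bar> \<le> \<delta> * real (card V) ^ 3)"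

text \<open>Rounding weights to sets controls the sum from one side only. It is applied to
  \<open>g\<close> and to \<open>- g\<close>, and one of the two keeps the deviation.\<close>

lemma not_cyl_uniformE:
  assumes fin: "finite V" and "\<not> cyl_uniform V \<delta> g"
  obtains E1 E2 E3 where
    "\<delta> * real (card V) ^ 3 < \<bar>\<Sum>q\<in>V \<times> V \<times> V. g q * cyl (indicator E1) (indicator E2) (indicator E3) q\<bar>"
proof -
  have fin': "finite (V \<times> V \<times> V)" using fin by simp
  obtain u v w where u: "\<forall>b. 0 \<le> u b \<and> u b \<le> 1" and v: "\<forall>b. 0 \<le> v b \<and> v b \<le> 1"
    and w: "\<forall>b. 0 \<le> w b \<and> w b \<le> 1"
    and gap: "\<not> \<bar>\<Sum>q\<in>V \<times> V \<times> V. g q * cyl u v w q\<bar> \<le> \<delta> * real (card V) ^ 3"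
    using assms(2) unfolding cyl_uniform_def by blast
  obtain E1 E2 E3 where E: "(\<Sum>q\<in>V\<times>V\<times>V. g q * cyl u v w q)
    \<le> (\<Sum>q\<in>V\<times>V\<times>V. g q * cyl (indicator E1) (indicator E2) (indicator E3) q)"
    using sum_cyl_le_sum_indicator[of "V\<times>V\<times>V" u v w g] fin' u v w by blast
  obtain E1' E2' E3' where E': "(\<Sum>q\<in>V\<times>V\<times>V. - g q * cyl u v w q)
    \<le> (\<Sum>q\<in>V\<times>V\<times>V. - g q * cyl (indicator E1') (indicator E2') (indicator E3') q)"
    using sum_cyl_le_sum_indicator[of "V\<times>V\<times>V" u v w "\<lambda>q. - g q"] fin' u v w by blast
  show ?thesis
    using gap E E' that[of E1 E2 E3] that[of E1' E2' E3'] unfolding mult_minus_left sum_negf by linarith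
qed

text \<open>Energy increment in the manner of Frieze and Kannan: a violating cylinder of sets
  refines each colouring by one set, which doubles the number of colours and raises the energy by
  \<open>\<delta>\<^sup>2 * card \<Omega>\<close>. More than \<open>1 / \<delta>\<^sup>2\<close>
  such steps are impossible, whatever \<open>V\<close> and \<open>f\<close> are.\<close>

lemma weak_cylinder_regularity:
  fixes \<delta> :: real
  assumes "\<delta> > 0"
  shows "\<exists>M. \<forall>V f. finite (V :: 'a set) \<longrightarrow> (\<forall>q. 0 \<le> f q \<and> f q \<le> 1) \<longrightarrow>
    (\<exists>\<kappa>1 \<kappa>2 \<kappa>3. (\<forall>b. \<kappa>1 b < M \<and> \<kappa>2 b < M \<and> \<kappa>3 b < M) \<and>
       cyl_uniform V \<delta> (\<lambda>q. f q - cond_avg (V \<times> V \<times> V) (cyl_map \<kappa>1 \<kappa>2 \<kappa>3) f q))"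
proof -
  obtain m :: nat where m: "1 / \<delta>\<^sup>2 < real m" using reals_Archimedean2 by blast
  have m1: "real m * \<delta>\<^sup>2 > 1" using m assms by (simp add: field_simps)
  show ?thesis
  proof (intro exI[of _ "iterated_size_bound (\<lambda>r. 2 * r) m 1"] allI impI)
    fix V :: "'a set" and f :: "'a \<times> 'a \<times> 'a \<Rightarrow> real"
    assume fin: "finite V" and f: "\<forall>q. 0 \<le> f q \<and> f q \<le> 1"
    define \<Omega> where "\<Omega> = V \<times> V \<times> V"
    have fin\<Omega>: "finite \<Omega>" using fin by (simp add: \<Omega>_def)
    have card\<Omega>: "real (card \<Omega>) = real (card V) ^ 3"
      by (simp add: \<Omega>_def card_cartesian_product power3_eq_cube mult_ac)
    define ok where "ok = (\<lambda>(\<kappa>1, \<kappa>2, \<kappa>3). cyl_uniform V \<delta> (\<lambda>q. f q - cond_avg \<Omega> (cyl_map \<kappa>1 \<kappa>2 \<kappa>3) f q))"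
    define bnd where "bnd = (\<lambda>(\<kappa>1, \<kappa>2, \<kappa>3) (M::nat). \<forall>b::'a\<times>'a. (\<kappa>1 b::nat) < M \<and> (\<kappa>2 b::nat) < M \<and> (\<kappa>3 b::nat) < M)"
    define e where "e = (\<lambda>(\<kappa>1, \<kappa>2, \<kappa>3). energy \<Omega> (cyl_map \<kappa>1 \<kappa>2 \<kappa>3) f)"
    have step: "\<exists>p'. bnd p' (2 * r) \<and> e p + \<delta>\<^sup>2 * card \<Omega> \<le> e p'" if bp: "bnd p r" and nok: "\<not> ok p" for p r
    proof -
      obtain \<kappa>1 \<kappa>2 \<kappa>3 where p: "p = (\<kappa>1, \<kappa>2, \<kappa>3)" by (cases p)
      have nok': "\<not> cyl_uniform V \<delta> (\<lambda>q. f q - cond_avg \<Omega> (cyl_map \<kappa>1 \<kappa>2 \<kappa>3) f q)"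
        using nok by (simp add: ok_def p)
      obtain E1 E2 E3 where E: "\<delta> * real (card V) ^ 3 <
         \<bar>\<Sum>q\<in>V\<times>V\<times>V. (f q - cond_avg \<Omega> (cyl_map \<kappa>1 \<kappa>2 \<kappa>3) f q) * cyl (indicator E1) (indicator E2) (indicator E3) q\<bar>"
        using not_cyl_uniformE[OF fin nok'] by blast
      \<comment> \<open>The last binary digit records membership in \<open>E\<close>, so equal new
        colours mean equal old colours and equal membership.\<close>
      define r1 where "r1 = (\<lambda>(\<kappa>::'a\<times>'a\<Rightarrow>nat) E b. 2 * \<kappa> b + of_bool (b \<in> E))"
      have r1: "\<kappa> b = \<kappa> b'" "(b \<in> E) = (b' \<in> E)" if "r1 \<kappa> E b = r1 \<kappa> E b'" for \<kappa> E b b'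
      proof -
        have "(2 * \<kappa> b + of_bool (b \<in> E)) div 2 = (2 * \<kappa> b' + of_bool (b' \<in> E)) div 2"
          using that by (simp only: r1_def)
        then show "\<kappa> b = \<kappa> b'" by (auto split: if_splits simp: of_bool_def)
        then show "(b \<in> E) = (b' \<in> E)" using that by (auto simp: r1_def of_bool_def split: if_splits)
      qed
      have "energy \<Omega> (cyl_map \<kappa>1 \<kappa>2 \<kappa>3) f + \<delta>\<^sup>2 * real (card \<Omega>)
          \<le> energy \<Omega> (cyl_map (r1 \<kappa>1 E1) (r1 \<kappa>2 E2) (r1 \<kappa>3 E3)) f"
      proof (rule energy_increment[OF fin\<Omega>, where g="cyl (indicator E1) (indicator E2) (indicator E3)"])
        fix w w' assume "cyl_map (r1 \<kappa>1 E1) (r1 \<kappa>2 E2) (r1 \<kappa>3 E3) w = cyl_map (r1 \<kappa>1 E1) (r1 \<kappa>2 E2) (r1 \<kappa>3 E3) w'"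
        then show "cyl_map \<kappa>1 \<kappa>2 \<kappa>3 w = cyl_map \<kappa>1 \<kappa>2 \<kappa>3 w'"
          "cyl (indicator E1) (indicator E2) (indicator E3) w = cyl (indicator E1) (indicator E2) (indicator E3) w'"
          by (auto simp: cyl_map_def cyl_def indicator_def split: prod.splits dest: r1)
      next
        show "\<delta> * real (card \<Omega>) \<le> \<bar>\<Sum>q\<in>\<Omega>. (f q - cond_avg \<Omega> (cyl_map \<kappa>1 \<kappa>2 \<kappa>3) f q)
            * cyl (indicator E1) (indicator E2) (indicator E3) q\<bar>"
          using E unfolding \<Omega>_def[symmetric] card\<Omega> by simp
      qed (use assms in \<open>auto simp: cyl_def indicator_def\<close>)
      moreover have "r1 \<kappa> E b < 2 * r" if "\<kappa> b < r" for \<kappa> E b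
        using that by (auto simp: r1_def of_bool_def)
      ultimately show ?thesis
        using bp unfolding p bnd_def e_def
        by (intro exI[of _ "(r1 \<kappa>1 E1, r1 \<kappa>2 E2, r1 \<kappa>3 E3)"]) auto
    qed
    have "\<exists>p'. ok p' \<and> bnd p' (iterated_size_bound (\<lambda>r. 2 * r) m 1)"
    \<comment> \<open>For empty \<open>V\<close> the increment is 0 and the strict inequality that
      limits the iteration fails; constant colourings serve.\<close>
    proof (cases "V = {}")
      case True
      then show ?thesis
        by (intro exI[of _ "(\<lambda>_. 0, \<lambda>_. 0, \<lambda>_. 0)"])
          (use iterated_size_bound_ge[of 1 "\<lambda>r. 2 * r" m] in \<open>auto simp: ok_def cyl_uniform_def bnd_def\<close>)
    next
      case False
      then have pos: "real (card \<Omega>) > 0" using fin by (simp add: card\<Omega> card_gt_0_iff)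
      have "\<exists>p' r'. ok p' \<and> bnd p' r' \<and> r' \<le> iterated_size_bound (\<lambda>r. 2 * r) m 1"
      proof (rule increment_terminates[where good="\<lambda>p r. ok p" and e=e and B="real (card \<Omega>)"
            and \<delta>="\<delta>\<^sup>2 * card \<Omega>" and p="(\<lambda>_. 0, \<lambda>_. 0, \<lambda>_. 0)"])
        show "\<exists>p'. bnd p' (2 * r) \<and> e p + \<delta>\<^sup>2 * card \<Omega> \<le> e p'" if "bnd p r" "\<not> ok p" for p r
          using step that .
        show "e p \<le> real (card \<Omega>)" for p unfolding e_def using energy_le[OF fin\<Omega>, of f] f by (cases p) simp
        have "real (card \<Omega>) < real m * \<delta>\<^sup>2 * real (card \<Omega>)" using m1 pos by simp
        then show "real (card \<Omega>) - real m * (\<delta>\<^sup>2 * card \<Omega>) < e (\<lambda>_. 0, \<lambda>_. 0, \<lambda>_. 0)"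
          using energy_nonneg[of \<Omega> "cyl_map (\<lambda>_. 0) (\<lambda>_. 0) (\<lambda>_. 0)" f] by (simp add: e_def mult.assoc)
      qed (simp add: bnd_def)
      moreover have "bnd p r'" if "bnd p r" "r \<le> r'" for p r r'
        using that less_le_trans unfolding bnd_def by (cases p) fastforce
      ultimately show ?thesis by blast
    qed
    then show "\<exists>\<kappa>1 \<kappa>2 \<kappa>3. (\<forall>b. \<kappa>1 b < iterated_size_bound (\<lambda>r. 2 * r) m 1 \<and> \<kappa>2 b < iterated_size_bound (\<lambda>r. 2 * r) m 1
         \<and> \<kappa>3 b < iterated_size_bound (\<lambda>r. 2 * r) m 1) \<and>
       cyl_uniform V \<delta> (\<lambda>q. f q - cond_avg (V \<times> V \<times> V) (cyl_map \<kappa>1 \<kappa>2 \<kappa>3) f q)"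
      unfolding ok_def bnd_def \<Omega>_def by (auto split: prod.splits)
  qed
qed

section \<open>Counting shattered patterns\<close>

text \<open>Overwriting the value at \<open>s\<close> forgets it: each function is reached once for
  each of the \<open>card V\<close> values that it may have had there before.\<close>

lemma sum_PiE_resample:
  fixes \<phi> :: "('i \<Rightarrow> 'a) \<Rightarrow> real"
  assumes fin: "finite V" and s: "s \<in> A"
  shows "(\<Sum>a\<in>A \<rightarrow>\<^sub>E V. \<Sum>x\<in>V. \<phi> (a(s := x))) = real (card V) * (\<Sum>a\<in>A \<rightarrow>\<^sub>E V. \<phi> a)"
proof -
  define A' where "A' = A - {s}"
  have A: "A = insert s A'" "s \<notin> A'" using s by (auto simp: A'_def)
  have gen: "(\<Sum>a\<in>A \<rightarrow>\<^sub>E V. \<psi> a) = (\<Sum>x\<in>V. \<Sum>a\<in>A' \<rightarrow>\<^sub>E V. \<psi> (a(s := x)))" for \<psi> :: "('i \<Rightarrow> 'a) \<Rightarrow> real"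
    unfolding A(1) PiE_insert_eq
    by (subst sum.reindex[OF inj_combinator[OF A(2)]])
       (simp add: sum.cartesian_product case_prod_unfold)
  show ?thesis
    unfolding gen[of "\<lambda>a. \<Sum>x\<in>V. \<phi> (a(s := x))"] gen[of \<phi>]
    by (simp add: sum.swap[of _ V "A' \<rightarrow>\<^sub>E V"])
qed

text \<open>Resampling one entry in each family isolates, for fixed remaining entries, a sum over
  \<open>V \<times> V \<times> V\<close>, to which \<open>cyl_uniform\<close> can be
  applied.\<close>

lemma sum_PiE3_resample:
  fixes \<phi> :: "('i \<Rightarrow> 'a) \<Rightarrow> ('j \<Rightarrow> 'a) \<Rightarrow> ('k \<Rightarrow> 'a) \<Rightarrow> real"
  assumes fin: "finite V" and s: "s \<in> A" "i \<in> B" "j \<in> C"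
  shows "(\<Sum>a\<in>A \<rightarrow>\<^sub>E V. \<Sum>b\<in>B \<rightarrow>\<^sub>E V. \<Sum>c\<in>C \<rightarrow>\<^sub>E V. \<Sum>x\<in>V. \<Sum>y\<in>V. \<Sum>z\<in>V. \<phi> (a(s := x)) (b(i := y)) (c(j := z)))
    = real (card V) ^ 3 * (\<Sum>a\<in>A \<rightarrow>\<^sub>E V. \<Sum>b\<in>B \<rightarrow>\<^sub>E V. \<Sum>c\<in>C \<rightarrow>\<^sub>E V. \<phi> a b c)"
proof -
  let ?A = "A \<rightarrow>\<^sub>E V" and ?B = "B \<rightarrow>\<^sub>E V" and ?C = "C \<rightarrow>\<^sub>E V" and ?n = "real (card V)"
  have "(\<Sum>a\<in>?A. \<Sum>b\<in>?B. \<Sum>c\<in>?C. \<Sum>x\<in>V. \<Sum>y\<in>V. \<Sum>z\<in>V. \<phi> (a(s := x)) (b(i := y)) (c(j := z)))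
    = (\<Sum>a\<in>?A. \<Sum>b\<in>?B. \<Sum>x\<in>V. \<Sum>y\<in>V. \<Sum>c\<in>?C. \<Sum>z\<in>V. \<phi> (a(s := x)) (b(i := y)) (c(j := z)))"
    by (simp only: sum.swap[of _ V ?C])
  also have "\<dots> = (\<Sum>a\<in>?A. \<Sum>x\<in>V. \<Sum>b\<in>?B. \<Sum>y\<in>V. ?n * (\<Sum>c\<in>?C. \<phi> (a(s := x)) (b(i := y)) c))"
    unfolding sum_PiE_resample[OF fin s(3)] by (simp only: sum.swap[of _ V ?B])
  also have "\<dots> = ?n * (?n * (?n * (\<Sum>a\<in>?A. \<Sum>b\<in>?B. \<Sum>c\<in>?C. \<phi> a b c)))"
    unfolding sum_PiE_resample[OF fin s(2), of "\<lambda>b. ?n * (\<Sum>c\<in>?C. \<phi> _ b c)"]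
    unfolding sum_PiE_resample[OF fin s(1), of "\<lambda>a. ?n * (\<Sum>b\<in>?B. ?n * (\<Sum>c\<in>?C. \<phi> a b c))"]
    by (simp only: sum_distrib_left)
  finally show ?thesis by (simp add: power3_eq_cube mult.assoc)
qed

text \<open>All factors other than the one at \<open>(s, i, j)\<close> miss at least one of \<open>a s\<close>, \<open>b i\<close>, \<open>c j\<close>,
  so for fixed remaining coordinates their product has the form \<open>u(x,y) v(x,z) w(y,z)\<close>.\<close>

lemma sum_one_factor_le:
  fixes K :: "'i \<times> 'j \<times> 'k \<Rightarrow> 'a \<times> 'a \<times> 'a \<Rightarrow> real"
  assumes fin: "finite V" "finite Q" and g: "cyl_uniform V \<delta> g"
    and K: "\<And>q r. q \<in> Q \<Longrightarrow> 0 \<le> K q r \<and> K q r \<le> 1"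
    and q0: "s \<in> A" "i \<in> B" "j \<in> C" "(s, i, j) \<notin> Q"
    and V: "V \<noteq> {}"
  shows "\<bar>\<Sum>a\<in>A \<rightarrow>\<^sub>E V. \<Sum>b\<in>B \<rightarrow>\<^sub>E V. \<Sum>c\<in>C \<rightarrow>\<^sub>E V.
      g (a s, b i, c j) * (\<Prod>(s, i, j)\<in>Q. K (s, i, j) (a s, b i, c j))\<bar>
    \<le> \<delta> * real (card (A \<rightarrow>\<^sub>E V)) * real (card (B \<rightarrow>\<^sub>E V)) * real (card (C \<rightarrow>\<^sub>E V))"
    (is "\<bar>?S\<bar> \<le> _")
proof -
  let ?n = "real (card V)"
  have n: "?n > 0" using V fin by (simp add: card_gt_0_iff)
  let ?F = "\<lambda>a b c. g (a s, b i, c j) * (\<Prod>(s, i, j)\<in>Q. K (s, i, j) (a s, b i, c j))"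
  define P where "P a b c Q' = (\<Prod>(s, i, j)\<in>Q'. K (s, i, j) (a s, b i, c j))" for a b c Q'
  \<comment> \<open>Each factor is charged to one coordinate that it misses: \<open>z\<close> if its
    third index differs from \<open>j\<close>, otherwise \<open>y\<close> if its second index
    differs from \<open>i\<close>, otherwise \<open>x\<close>.\<close>
  define Q1 where "Q1 = {(s', i', j') \<in> Q. j' \<noteq> j}"
  define Q2 where "Q2 = {(s', i', j') \<in> Q. j' = j \<and> i' \<noteq> i}"
  define Q3 where "Q3 = {(s', i', j') \<in> Q. j' = j \<and> i' = i \<and> s' \<noteq> s}"
  have Q: "Q = Q1 \<union> (Q2 \<union> Q3)" "Q1 \<inter> (Q2 \<union> Q3) = {}" "Q2 \<inter> Q3 = {}"
    using q0 by (auto simp: Q1_def Q2_def Q3_def)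
  have Qfin: "finite Q1" "finite Q2" "finite Q3" using fin Q(1) by auto
  have P01: "0 \<le> P a b c Q' \<and> P a b c Q' \<le> 1" if "Q' \<subseteq> Q" for a b c Q'
    unfolding P_def using that K by (auto intro!: prod_nonneg prod_le_1 split: prod.splits)
  have inner: "\<bar>\<Sum>x\<in>V. \<Sum>y\<in>V. \<Sum>z\<in>V. ?F (a(s := x)) (b(i := y)) (c(j := z))\<bar> \<le> \<delta> * ?n ^ 3" for a b c
  proof -
    define u where "u = (\<lambda>(x, y). P (a(s := x)) (b(i := y)) c Q1)"
    define v where "v = (\<lambda>(x, z). P (a(s := x)) b (c(j := z)) Q2)"
    define w where "w = (\<lambda>(y, z). P a (b(i := y)) (c(j := z)) Q3)"
    have "?F (a(s := x)) (b(i := y)) (c(j := z)) = g (x, y, z) * cyl u v w (x, y, z)" for x y z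
    proof -
      have "P (a(s := x)) (b(i := y)) (c(j := z)) Q = P (a(s := x)) (b(i := y)) (c(j := z)) Q1
          * (P (a(s := x)) (b(i := y)) (c(j := z)) Q2 * P (a(s := x)) (b(i := y)) (c(j := z)) Q3)"
        unfolding P_def using Q Qfin by (metis (no_types, lifting) prod.union_disjoint finite_UnI)
      also have "P (a(s := x)) (b(i := y)) (c(j := z)) Q1 = u (x, y)"
        unfolding P_def u_def prod.case by (rule prod.cong) (auto simp: Q1_def)
      also have "P (a(s := x)) (b(i := y)) (c(j := z)) Q2 = v (x, z)"
        unfolding P_def v_def prod.case by (rule prod.cong) (auto simp: Q2_def)
      also have "P (a(s := x)) (b(i := y)) (c(j := z)) Q3 = w (y, z)"
        unfolding P_def w_def prod.case by (rule prod.cong) (auto simp: Q3_def)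
      finally show ?thesis by (simp add: P_def cyl_def)
    qed
    then have "(\<Sum>x\<in>V. \<Sum>y\<in>V. \<Sum>z\<in>V. ?F (a(s := x)) (b(i := y)) (c(j := z)))
        = (\<Sum>x\<in>V. \<Sum>y\<in>V. \<Sum>z\<in>V. g (x, y, z) * cyl u v w (x, y, z))"
      by (simp only:)
    also have "\<dots> = (\<Sum>q\<in>V\<times>V\<times>V. g q * cyl u v w q)"
      by (simp add: sum.cartesian_product case_prod_unfold)
    finally have "(\<Sum>x\<in>V. \<Sum>y\<in>V. \<Sum>z\<in>V. ?F (a(s := x)) (b(i := y)) (c(j := z)))
        = (\<Sum>q\<in>V\<times>V\<times>V. g q * cyl u v w q)" .
    moreover have "\<bar>\<Sum>q\<in>V\<times>V\<times>V. g q * cyl u v w q\<bar> \<le> \<delta> * ?n ^ 3"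
    proof (rule g[unfolded cyl_uniform_def, rule_format], intro conjI allI)
      fix p show "0 \<le> u p" "u p \<le> 1" "0 \<le> v p" "v p \<le> 1" "0 \<le> w p" "w p \<le> 1"
        unfolding u_def v_def w_def using P01 Q(1) by (auto split: prod.splits)
    qed
    ultimately show ?thesis by simp
  qed
  have "?n ^ 3 * \<bar>?S\<bar> = \<bar>?n ^ 3 * ?S\<bar>" by (simp add: abs_mult)
  also have "\<dots> \<le> (\<Sum>a\<in>A \<rightarrow>\<^sub>E V. \<Sum>b\<in>B \<rightarrow>\<^sub>E V. \<Sum>c\<in>C \<rightarrow>\<^sub>E V. \<delta> * ?n ^ 3)"
    unfolding sum_PiE3_resample[OF fin(1) q0(1-3), of ?F, symmetric]
    by (intro order_trans[OF sum_abs] sum_mono inner)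
  also have "\<dots> = ?n ^ 3 * (\<delta> * real (card (A \<rightarrow>\<^sub>E V)) * real (card (B \<rightarrow>\<^sub>E V)) * real (card (C \<rightarrow>\<^sub>E V)))"
    by (simp add: algebra_simps)
  finally show ?thesis using n by simp
qed

text \<open>Hybrid argument: the factors pass from \<open>F\<close> to \<open>H\<close> one at a
  time, and a single exchange changes the sum by a correlation of \<open>F q0 - H q0\<close> with
  factors in \<open>[0, 1]\<close>. The set \<open>P\<close> of exchanged factors is kept general
  for the induction; the application has \<open>P = Q\<close>.\<close>

lemma sum_prod_replace:
  fixes F H :: "'i \<times> 'j \<times> 'k \<Rightarrow> 'a \<times> 'a \<times> 'a \<Rightarrow> real"
  assumes fin: "finite V" "finite Q" "P \<subseteq> Q" and V: "V \<noteq> {}"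
    and QABC: "Q \<subseteq> A \<times> B \<times> C"
    and unif: "\<And>q. q \<in> Q \<Longrightarrow> cyl_uniform V \<delta> (\<lambda>r. F q r - H q r)"
    and F: "\<And>q r. q \<in> Q \<Longrightarrow> 0 \<le> F q r \<and> F q r \<le> 1" and H: "\<And>q r. q \<in> Q \<Longrightarrow> 0 \<le> H q r \<and> H q r \<le> 1"
  defines "T \<equiv> \<lambda>P. \<Sum>a\<in>A \<rightarrow>\<^sub>E V. \<Sum>b\<in>B \<rightarrow>\<^sub>E V. \<Sum>c\<in>C \<rightarrow>\<^sub>E V.
      (\<Prod>(s, i, j)\<in>Q. (if (s, i, j) \<in> P then H else F) (s, i, j) (a s, b i, c j))"
  shows "\<bar>T {} - T P\<bar> \<le> real (card P) * \<delta> * real (card (A \<rightarrow>\<^sub>E V)) * real (card (B \<rightarrow>\<^sub>E V)) * real (card (C \<rightarrow>\<^sub>E V))"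
proof -
  let ?N = "real (card (A \<rightarrow>\<^sub>E V)) * real (card (B \<rightarrow>\<^sub>E V)) * real (card (C \<rightarrow>\<^sub>E V))"
  have "finite P" using fin finite_subset by blast
  then have "\<bar>T {} - T P\<bar> \<le> real (card P) * \<delta> * ?N" using \<open>P \<subseteq> Q\<close>
  proof (induction P)
    case empty then show ?case by simp
  next
    case (insert q0 P)
    obtain s0 i0 j0 where q0: "q0 = (s0, i0, j0)" by (cases q0)
    have mem: "s0 \<in> A" "i0 \<in> B" "j0 \<in> C" using insert.prems QABC q0 by auto
    define K where "K q = (if q \<in> P then H q else F q)" for q
    let ?R = "\<lambda>a b c. \<Prod>(s, i, j)\<in>Q - {q0}. K (s, i, j) (a s, b i, c j)"
    have q0Q: "q0 \<in> Q" using insert.prems by simp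
    have "(\<Prod>(s, i, j)\<in>Q. (if (s, i, j) \<in> P then H else F) (s, i, j) (a s, b i, c j))
       - (\<Prod>(s, i, j)\<in>Q. (if (s, i, j) \<in> insert q0 P then H else F) (s, i, j) (a s, b i, c j))
       = (F q0 (a s0, b i0, c j0) - H q0 (a s0, b i0, c j0)) * ?R a b c" for a b c
    proof -
      have "(\<Prod>(s, i, j)\<in>Q. (if (s, i, j) \<in> P then H else F) (s, i, j) (a s, b i, c j)) = F q0 (a s0, b i0, c j0) * ?R a b c"
        unfolding prod.remove[OF fin(2) q0Q] using insert.hyps by (simp add: q0 K_def if_distribR)
      moreover have "(\<Prod>(s, i, j)\<in>Q. (if (s, i, j) \<in> insert q0 P then H else F) (s, i, j) (a s, b i, c j)) = H q0 (a s0, b i0, c j0) * ?R a b c"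
      proof -
        have "(\<Prod>(s, i, j)\<in>Q - {q0}. (if (s, i, j) \<in> insert q0 P then H else F) (s, i, j) (a s, b i, c j)) = ?R a b c"
          by (rule prod.cong) (auto simp: K_def)
        then show ?thesis unfolding prod.remove[OF fin(2) q0Q] by (simp add: q0)
      qed
      ultimately show ?thesis by (simp add: left_diff_distrib)
    qed
    then have "T P - T (insert q0 P) = (\<Sum>a\<in>A \<rightarrow>\<^sub>E V. \<Sum>b\<in>B \<rightarrow>\<^sub>E V. \<Sum>c\<in>C \<rightarrow>\<^sub>E V.
        (F q0 (a s0, b i0, c j0) - H q0 (a s0, b i0, c j0)) * ?R a b c)"
      unfolding T_def sum_subtractf[symmetric] by simp
    also have "\<bar>\<dots>\<bar> \<le> \<delta> * real (card (A \<rightarrow>\<^sub>E V)) * real (card (B \<rightarrow>\<^sub>E V)) * real (card (C \<rightarrow>\<^sub>E V))"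
      using unif[OF q0Q] F H mem fin V
      by (intro sum_one_factor_le[where g="\<lambda>r. F q0 r - H q0 r"]) (auto simp: q0 K_def)
    finally have "\<bar>T P - T (insert q0 P)\<bar> \<le> \<delta> * ?N" by (simp add: mult.assoc)
    moreover have "\<bar>T {} - T P\<bar> \<le> real (card P) * \<delta> * ?N" using insert by simp
    ultimately have "\<bar>T {} - T (insert q0 P)\<bar> \<le> real (card P) * \<delta> * ?N + \<delta> * ?N" by linarith
    then show ?case using insert.hyps by (simp add: algebra_simps)
  qed
  then show ?thesis by (simp add: mult.assoc)
qed

section \<open>Convexity bounds for products over repeated coordinates\<close>

lemma power_ge_tangent:
  fixes a x :: real
  assumes "0 \<le> a" "0 \<le> x"
  shows "a ^ m + real m * a ^ (m - 1) * (x - a) \<le> x ^ m"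
proof (induction m)
  case (Suc m)
  show ?case
  proof (cases m)
    case 0 then show ?thesis by simp
  next
    case (Suc k)
    have "a ^ Suc m + real (Suc m) * a ^ m * (x - a) + real m * a ^ k * (x - a)\<^sup>2
        = x * (a ^ m + real m * a ^ (m - 1) * (x - a))"
      by (simp add: Suc algebra_simps power2_eq_square)
    also have "\<dots> \<le> x * x ^ m" using Suc.IH assms(2) by (rule mult_left_mono)
    moreover have "0 \<le> real m * a ^ k * (x - a)\<^sup>2" using assms by simp
    ultimately show ?thesis by (simp add: Suc)
  qed
qed simp

text \<open>Jensen's inequality for powers: when the tangent inequality at the mean \<open>a\<close>
  is summed, the linear terms cancel.\<close>

lemma power_mean_le_mean_power:
  fixes x :: "'b \<Rightarrow> real"
  assumes "finite Y" "Y \<noteq> {}" "\<And>y. y \<in> Y \<Longrightarrow> 0 \<le> x y"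
  shows "((\<Sum>y\<in>Y. x y) / card Y) ^ m \<le> (\<Sum>y\<in>Y. x y ^ m) / card Y"
proof -
  define a where "a = (\<Sum>y\<in>Y. x y) / card Y"
  have c: "real (card Y) > 0" using assms by (simp add: card_gt_0_iff)
  have a: "0 \<le> a" unfolding a_def using assms by (intro divide_nonneg_nonneg sum_nonneg) auto
  have "(\<Sum>y\<in>Y. a ^ m + real m * a ^ (m - 1) * (x y - a)) \<le> (\<Sum>y\<in>Y. x y ^ m)"
    using assms a by (intro sum_mono power_ge_tangent) auto
  moreover have "(\<Sum>y\<in>Y. a ^ m + real m * a ^ (m - 1) * (x y - a)) = card Y * a ^ m"
  proof -
    have "(\<Sum>y\<in>Y. x y - a) = 0" using c by (simp add: a_def sum_subtractf)
    then show ?thesis by (simp add: sum.distrib sum_distrib_left[symmetric])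
  qed
  ultimately show ?thesis using c by (simp add: a_def[symmetric] field_simps)
qed

text \<open>For fixed \<open>y\<close> the sum over all \<open>a\<close> factorises into the power
  with exponent \<open>card I\<close> of the sum over \<open>x\<close>; convexity is then applied to
  the average over \<open>y\<close>.\<close>

lemma power_mean_le_mean_prod:
  fixes w :: "'a \<Rightarrow> 'b \<Rightarrow> real"
  assumes X: "finite X" "X \<noteq> {}" and Y: "finite Y" "Y \<noteq> {}" and I: "finite I"
    and w: "\<And>x y. 0 \<le> w x y"
  shows "((\<Sum>y\<in>Y. \<Sum>x\<in>X. w x y) / (card X * card Y)) ^ card I
    \<le> (\<Sum>y\<in>Y. \<Sum>a\<in>I \<rightarrow>\<^sub>E X. \<Prod>i\<in>I. w (a i) y) / (card (I \<rightarrow>\<^sub>E X) * card Y)"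
proof -
  have "(\<Sum>a\<in>I \<rightarrow>\<^sub>E X. \<Prod>i\<in>I. w (a i) y) = (\<Sum>x\<in>X. w x y) ^ card I" for y
    using prod_sum_PiE[of I "\<lambda>_. X" "\<lambda>i x. w x y"] I X by simp
  moreover have "((\<Sum>y\<in>Y. (\<Sum>x\<in>X. w x y) / card X) / card Y) ^ card I
      \<le> (\<Sum>y\<in>Y. ((\<Sum>x\<in>X. w x y) / card X) ^ card I) / card Y"
    using Y w by (intro power_mean_le_mean_power) (auto intro!: sum_nonneg divide_nonneg_nonneg)
  ultimately show ?thesis
    using I by (simp add: power_divide sum_divide_distrib[symmetric] card_PiE)
qed

text \<open>Sidorenko's inequality for complete tripartite patterns with weights. The coordinates
  are repeated one after the other, and each time everything chosen so far, together with the
  coordinates still to come, is the averaging variable; \<open>m1\<close> to \<open>m4\<close> are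
  the means after 0 to 3 repetitions.\<close>

lemma power_mean_le_mean_prod3:
  fixes w :: "'a \<times> 'a \<times> 'a \<Rightarrow> real"
  assumes V: "finite V" "V \<noteq> {}" and fin: "finite A" "finite B" "finite C"
    and w: "\<And>q. 0 \<le> w q"
  shows "((\<Sum>q\<in>V\<times>V\<times>V. w q) / real (card V) ^ 3) ^ (card A * card B * card C)
    \<le> (\<Sum>a\<in>A \<rightarrow>\<^sub>E V. \<Sum>b\<in>B \<rightarrow>\<^sub>E V. \<Sum>c\<in>C \<rightarrow>\<^sub>E V. \<Prod>(s, i, j)\<in>A\<times>B\<times>C. w (a s, b i, c j))
      / (card (A \<rightarrow>\<^sub>E V) * card (B \<rightarrow>\<^sub>E V) * card (C \<rightarrow>\<^sub>E V))"
proof -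
  let ?A = "A \<rightarrow>\<^sub>E V" and ?B = "B \<rightarrow>\<^sub>E V" and ?C = "C \<rightarrow>\<^sub>E V" and ?n = "real (card V)"
  have ne: "?A \<noteq> {}" "?B \<noteq> {}" "?C \<noteq> {}" using V by (auto simp: PiE_eq_empty_iff)
  have fp: "finite ?A" "finite ?B" "finite ?C" using V fin by (auto intro: finite_PiE)
  define m1 where "m1 = (\<Sum>q\<in>V\<times>V\<times>V. w q) / ?n ^ 3"
  define m2 where "m2 = (\<Sum>(y, z)\<in>V\<times>V. \<Sum>a\<in>?A. \<Prod>s\<in>A. w (a s, y, z)) / (card ?A * card (V\<times>V))"
  define m3 where "m3 = (\<Sum>(a, z)\<in>?A\<times>V. \<Sum>b\<in>?B. \<Prod>i\<in>B. \<Prod>s\<in>A. w (a s, b i, z)) / (card ?B * card (?A\<times>V))"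
  define m4 where "m4 = (\<Sum>(a, b)\<in>?A\<times>?B. \<Sum>c\<in>?C. \<Prod>j\<in>C. \<Prod>i\<in>B. \<Prod>s\<in>A. w (a s, b i, c j)) / (card ?C * card (?A\<times>?B))"
  have "m1 = (\<Sum>p\<in>V\<times>V. \<Sum>x\<in>V. w (x, p)) / (card V * card (V\<times>V))"
  proof -
    have "(\<Sum>q\<in>V\<times>V\<times>V. w q) = (\<Sum>x\<in>V. \<Sum>p\<in>V\<times>V. w (x, p))"
      unfolding sum.cartesian_product by (rule sum.cong) auto
    also have "\<dots> = (\<Sum>p\<in>V\<times>V. \<Sum>x\<in>V. w (x, p))" by (rule sum.swap)
    finally show ?thesis by (simp add: m1_def power3_eq_cube card_cartesian_product)
  qed
  then have 1: "m1 ^ card A \<le> m2"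
    using power_mean_le_mean_prod[of V "V\<times>V" A "\<lambda>x p. w (x, p)"] V fin w
    by (simp add: m2_def case_prod_unfold)
  have "m2 = (\<Sum>(a, z)\<in>?A\<times>V. \<Sum>y\<in>V. \<Prod>s\<in>A. w (a s, y, z)) / (card V * card (?A\<times>V))"
  proof -
    have "(\<Sum>y\<in>V. \<Sum>z\<in>V. \<Sum>a\<in>?A. \<Prod>s\<in>A. w (a s, y, z)) = (\<Sum>a\<in>?A. \<Sum>z\<in>V. \<Sum>y\<in>V. \<Prod>s\<in>A. w (a s, y, z))"
    proof -
      have "(\<Sum>y\<in>V. \<Sum>z\<in>V. \<Sum>a\<in>?A. \<Prod>s\<in>A. w (a s, y, z)) = (\<Sum>y\<in>V. \<Sum>a\<in>?A. \<Sum>z\<in>V. \<Prod>s\<in>A. w (a s, y, z))"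
        by (rule sum.cong[OF refl]) (rule sum.swap)
      also have "\<dots> = (\<Sum>a\<in>?A. \<Sum>y\<in>V. \<Sum>z\<in>V. \<Prod>s\<in>A. w (a s, y, z))" by (rule sum.swap)
      also have "\<dots> = (\<Sum>a\<in>?A. \<Sum>z\<in>V. \<Sum>y\<in>V. \<Prod>s\<in>A. w (a s, y, z))"
        by (rule sum.cong[OF refl]) (rule sum.swap)
      finally show ?thesis .
    qed
    then have "(\<Sum>(y, z)\<in>V\<times>V. \<Sum>a\<in>?A. \<Prod>s\<in>A. w (a s, y, z)) = (\<Sum>(a, z)\<in>?A\<times>V. \<Sum>y\<in>V. \<Prod>s\<in>A. w (a s, y, z))"
      by (subst (1 2) sum.cartesian_product[symmetric])
    then show ?thesis unfolding m2_def by (simp add: card_cartesian_product)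
  qed
  then have 2: "m2 ^ card B \<le> m3"
    using power_mean_le_mean_prod[of V "?A\<times>V" B "\<lambda>y p. \<Prod>s\<in>A. w (fst p s, y, snd p)"] V fin w ne fp
    by (simp add: m3_def case_prod_unfold prod_nonneg)
  have "m3 = (\<Sum>(a, b)\<in>?A\<times>?B. \<Sum>z\<in>V. \<Prod>i\<in>B. \<Prod>s\<in>A. w (a s, b i, z)) / (card V * card (?A\<times>?B))"
  proof -
    have "(\<Sum>a\<in>?A. \<Sum>z\<in>V. \<Sum>b\<in>?B. \<Prod>i\<in>B. \<Prod>s\<in>A. w (a s, b i, z)) = (\<Sum>a\<in>?A. \<Sum>b\<in>?B. \<Sum>z\<in>V. \<Prod>i\<in>B. \<Prod>s\<in>A. w (a s, b i, z))"
      by (rule sum.cong[OF refl]) (rule sum.swap)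
    then have "(\<Sum>(a, z)\<in>?A\<times>V. \<Sum>b\<in>?B. \<Prod>i\<in>B. \<Prod>s\<in>A. w (a s, b i, z)) = (\<Sum>(a, b)\<in>?A\<times>?B. \<Sum>z\<in>V. \<Prod>i\<in>B. \<Prod>s\<in>A. w (a s, b i, z))"
      by (subst (1 2) sum.cartesian_product[symmetric])
    then show ?thesis unfolding m3_def by (simp add: card_cartesian_product)
  qed
  then have 3: "m3 ^ card C \<le> m4"
    using power_mean_le_mean_prod[of V "?A\<times>?B" C "\<lambda>z p. \<Prod>i\<in>B. \<Prod>s\<in>A. w (fst p s, snd p i, z)"] V fin w ne fp
    by (simp add: m4_def case_prod_unfold prod_nonneg)
  have 4: "m4 = (\<Sum>a\<in>?A. \<Sum>b\<in>?B. \<Sum>c\<in>?C. \<Prod>(s, i, j)\<in>A\<times>B\<times>C. w (a s, b i, c j)) / (card ?A * card ?B * card ?C)"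
  proof -
    have "(\<Prod>j\<in>C. \<Prod>i\<in>B. \<Prod>s\<in>A. w (a s, b i, c j)) = (\<Prod>(s, i, j)\<in>A\<times>B\<times>C. w (a s, b i, c j))" for a b c
    proof -
      have "(\<Prod>j\<in>C. \<Prod>i\<in>B. \<Prod>s\<in>A. w (a s, b i, c j)) = (\<Prod>s\<in>A. \<Prod>i\<in>B. \<Prod>j\<in>C. w (a s, b i, c j))"
      proof -
        have "(\<Prod>j\<in>C. \<Prod>i\<in>B. \<Prod>s\<in>A. w (a s, b i, c j)) = (\<Prod>j\<in>C. \<Prod>s\<in>A. \<Prod>i\<in>B. w (a s, b i, c j))"
          by (rule prod.cong[OF refl]) (rule prod.swap)
        also have "\<dots> = (\<Prod>s\<in>A. \<Prod>j\<in>C. \<Prod>i\<in>B. w (a s, b i, c j))" by (rule prod.swap)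
        also have "\<dots> = (\<Prod>s\<in>A. \<Prod>i\<in>B. \<Prod>j\<in>C. w (a s, b i, c j))"
          by (rule prod.cong[OF refl]) (rule prod.swap)
        finally show ?thesis .
      qed
      then show ?thesis by (simp add: prod.cartesian_product[symmetric])
    qed
    then show ?thesis unfolding m4_def
      by (subst sum.cartesian_product[symmetric]) (simp add: card_cartesian_product mult_ac)
  qed
  have m0: "0 \<le> m1" "0 \<le> m2" unfolding m1_def m2_def using w
    by (auto intro!: divide_nonneg_nonneg sum_nonneg prod_nonneg)
  have "m1 ^ (card A * card B * card C) = ((m1 ^ card A) ^ card B) ^ card C" by (simp add: power_mult)
  also have "\<dots> \<le> (m2 ^ card B) ^ card C" using 1 m0 by (intro power_mono) auto
  also have "\<dots> \<le> m3 ^ card C" using 2 m0 by (intro power_mono) auto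
  finally show ?thesis using 3 4 by (simp add: m1_def)
qed

lemma cyl_uniform_uminus: "cyl_uniform V \<delta> (\<lambda>q. - g q) = cyl_uniform V \<delta> g"
  by (simp add: cyl_uniform_def sum_negf)

text \<open>Ordered triples with repeated entries are included. This matches
  \<open>VC2_shattered\<close>, where the vertices of a pattern may coincide.\<close>

definition edge_fun :: "'a set set \<Rightarrow> 'a \<times> 'a \<times> 'a \<Rightarrow> real" where
  "edge_fun F = (\<lambda>(x, y, z). of_bool ({x, y, z} \<in> F))"

text \<open>A pattern has \<open>m\<close> factors, one for each \<open>(S, i, j)\<close>, so
  replacing all of them costs at most \<open>m * \<delta>\<close> on average. The choice of
  \<open>\<delta>\<close> keeps this below \<open>\<epsilon> ^ m\<close>, which a mean of
  \<open>h * (1 - h)\<close> above \<open>\<epsilon>\<close> would contradict. Hence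
  \<open>M\<close> depends on \<open>\<epsilon>\<close> and \<open>k\<close> only.\<close>

lemma VC2_bounded_cylinder_approximation:
  fixes \<epsilon> :: real
  assumes \<epsilon>: "\<epsilon> > 0"
  shows "\<exists>M. \<forall>V F. finite (V :: 'a set) \<and> V \<noteq> {} \<and> \<not> VC2_shattered (V, F) k \<longrightarrow>
    (\<exists>\<kappa>1 \<kappa>2 \<kappa>3. (\<forall>b. \<kappa>1 b < M \<and> \<kappa>2 b < M \<and> \<kappa>3 b < M) \<and>
      (let h = cond_avg (V \<times> V \<times> V) (cyl_map \<kappa>1 \<kappa>2 \<kappa>3) (edge_fun F) in
        (\<Sum>q\<in>V\<times>V\<times>V. h q * (1 - h q)) \<le> \<epsilon> * real (card V) ^ 3))"
proof -
  define I where "I = {1..k}"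
  define A where "A = Pow (I \<times> I)"
  define Q where "Q = A \<times> I \<times> I"
  have fin: "finite A" "finite I" "finite Q" by (auto simp: A_def I_def Q_def)
  define m where "m = card Q"
  have m: "m = card A * card I * card I" by (simp add: m_def Q_def card_cartesian_product)
  define \<delta> where "\<delta> = \<epsilon> ^ m / (real m + 1)"
  have \<delta>: "\<delta> > 0" using \<epsilon> by (simp add: \<delta>_def)
  have m\<delta>: "real m * \<delta> < \<epsilon> ^ m" using \<epsilon> by (simp add: \<delta>_def field_simps)
  obtain M where M: "\<And>V f. finite (V :: 'a set) \<Longrightarrow> (\<forall>q. 0 \<le> f q \<and> f q \<le> 1) \<Longrightarrow>
    (\<exists>\<kappa>1 \<kappa>2 \<kappa>3. (\<forall>b. \<kappa>1 b < M \<and> \<kappa>2 b < M \<and> \<kappa>3 b < M) \<and>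
       cyl_uniform V \<delta> (\<lambda>q. f q - cond_avg (V \<times> V \<times> V) (cyl_map \<kappa>1 \<kappa>2 \<kappa>3) f q))"
    using weak_cylinder_regularity[OF \<delta>] by blast
  show ?thesis
  proof (intro exI[of _ M] allI impI, elim conjE)
    fix V :: "'a set" and F
    assume V: "finite V" "V \<noteq> {}" and nsh: "\<not> VC2_shattered (V, F) k"
    let ?f = "edge_fun F"
    have f01: "\<forall>q. 0 \<le> ?f q \<and> ?f q \<le> 1" by (auto simp: edge_fun_def)
    obtain \<kappa>1 \<kappa>2 \<kappa>3 where \<kappa>: "\<forall>b. \<kappa>1 b < M \<and> \<kappa>2 b < M \<and> \<kappa>3 b < M"
      and unif: "cyl_uniform V \<delta> (\<lambda>q. ?f q - cond_avg (V \<times> V \<times> V) (cyl_map \<kappa>1 \<kappa>2 \<kappa>3) ?f q)"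
      using M[OF V(1) f01] by blast
    define h where "h = cond_avg (V \<times> V \<times> V) (cyl_map \<kappa>1 \<kappa>2 \<kappa>3) ?f"
    have h01: "0 \<le> h q" "h q \<le> 1" for q
      unfolding h_def using V f01 by (auto intro!: cond_avg_bounds)
    define K :: "('a \<times> 'a \<times> 'a \<Rightarrow> real) \<Rightarrow> (nat \<times> nat) set \<times> nat \<times> nat \<Rightarrow> 'a \<times> 'a \<times> 'a \<Rightarrow> real"
      where "K g = (\<lambda>(S, i, j) r. if (i, j) \<in> S then g r else 1 - g r)" for g
    define \<mu> where "\<mu> = (\<Sum>q\<in>V\<times>V\<times>V. h q * (1 - h q)) / real (card V) ^ 3"
    let ?A = "A \<rightarrow>\<^sub>E V" and ?I = "I \<rightarrow>\<^sub>E V"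
    let ?N = "real (card ?A) * real (card ?I) * real (card ?I)"
    have N: "?N > 0" using V fin by (simp add: card_gt_0_iff PiE_eq_empty_iff finite_PiE)
    define T where "T g = (\<Sum>a\<in>?A. \<Sum>b\<in>?I. \<Sum>c\<in>?I. \<Prod>(S, i, j)\<in>Q. K g (S, i, j) (a S, b i, c j))" for g
    have "T ?f = 0"
    proof -
      have "(\<Prod>(S, i, j)\<in>Q. K ?f (S, i, j) (a S, b i, c j)) = 0"
        if a: "a \<in> ?A" and b: "b \<in> ?I" and c: "c \<in> ?I" for a b c
      proof (rule ccontr)
        assume "(\<Prod>(S, i, j)\<in>Q. K ?f (S, i, j) (a S, b i, c j)) \<noteq> 0"
        then have "K ?f (S, i, j) (a S, b i, c j) \<noteq> 0" if "(S, i, j) \<in> Q" for S i j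
          using that fin by auto
        then have e: "{a S, b i, c j} \<in> F \<longleftrightarrow> (i, j) \<in> S" if "S \<in> A" "i \<in> I" "j \<in> I" for S i j
          using that by (force simp: Q_def K_def edge_fun_def split: if_splits)
        have "VC2_shattered (V, F) k"
          unfolding VC2_shattered_def fst_conv snd_conv
        proof (intro exI conjI ballI allI impI)
          fix i assume "i \<in> {1..k}"
          then show "b i \<in> V" "c i \<in> V" using b c by (auto simp: I_def)
        next
          fix S assume "S \<subseteq> {1..k} \<times> {1..k}"
          then have S: "S \<in> A" by (simp add: A_def I_def)
          then show "a S \<in> V" using a by auto
          show "({a S, b i, c j} \<in> F) = ((i, j) \<in> S)" if "i \<in> {1..k}" "j \<in> {1..k}" for i j
            using e[OF S] that by (simp add: I_def)
        qed
        then show False using nsh by simp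
      qed
      then show ?thesis unfolding T_def by (auto intro!: sum.neutral)
    qed
    moreover have "\<bar>T ?f - T h\<bar> \<le> real m * \<delta> * ?N"
    proof -
      have "\<bar>(\<Sum>a\<in>?A. \<Sum>b\<in>?I. \<Sum>c\<in>?I. \<Prod>(s, i, j)\<in>Q. (if (s, i, j) \<in> {} then K h else K ?f) (s, i, j) (a s, b i, c j))
        - (\<Sum>a\<in>?A. \<Sum>b\<in>?I. \<Sum>c\<in>?I. \<Prod>(s, i, j)\<in>Q. (if (s, i, j) \<in> Q then K h else K ?f) (s, i, j) (a s, b i, c j))\<bar>
        \<le> real (card Q) * \<delta> * real (card ?A) * real (card ?I) * real (card ?I)"
      proof (rule sum_prod_replace)
        fix q assume "q \<in> Q"
        obtain S i j where q: "q = (S, i, j)" by (cases q)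
        have 1: "cyl_uniform V \<delta> (\<lambda>r. ?f r - h r)" using unif by (simp add: h_def)
        then have 2: "cyl_uniform V \<delta> (\<lambda>r. h r - ?f r)"
          using cyl_uniform_uminus[of V \<delta> "\<lambda>r. ?f r - h r"] by simp
        show "cyl_uniform V \<delta> (\<lambda>r. K ?f q r - K h q r)"
          using 1 2 by (cases "(i, j) \<in> S") (simp_all add: K_def q)
        show "0 \<le> K ?f q r \<and> K ?f q r \<le> 1" "0 \<le> K h q r \<and> K h q r \<le> 1" for r
          using f01[rule_format, of r] h01[of r] by (auto simp: K_def q simp del: split_paired_All)
      qed (use V fin in \<open>auto simp: Q_def\<close>)
      moreover have "(\<Prod>(s, i, j)\<in>Q. (if (s, i, j) \<in> Q then K h else K ?f) (s, i, j) (a s, b i, c j))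
        = (\<Prod>(s, i, j)\<in>Q. K h (s, i, j) (a s, b i, c j))" for a b c
        by (rule prod.cong) auto
      ultimately show ?thesis by (simp add: T_def m_def mult.assoc)
    qed
    moreover have "\<mu> ^ m * ?N \<le> T h"
    proof -
      \<comment> \<open>The product \<open>h * (1 - h)\<close> is a common lower bound for the
        factors \<open>h\<close> and \<open>1 - h\<close>. It no longer depends on whether
        \<open>(i, j) \<in> S\<close>, so the pattern becomes a complete tripartite one.\<close>
      have "\<mu> ^ m \<le> (\<Sum>a\<in>?A. \<Sum>b\<in>?I. \<Sum>c\<in>?I. \<Prod>(S, i, j)\<in>A\<times>I\<times>I. (\<lambda>q. h q * (1 - h q)) (a S, b i, c j))
        / (card ?A * card ?I * card ?I)"
        unfolding \<mu>_def m using V fin h01 by (intro power_mean_le_mean_prod3) auto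
      then have "\<mu> ^ m * ?N \<le> (\<Sum>a\<in>?A. \<Sum>b\<in>?I. \<Sum>c\<in>?I. \<Prod>(S, i, j)\<in>Q. h (a S, b i, c j) * (1 - h (a S, b i, c j)))"
        using N by (simp add: pos_le_divide_eq Q_def)
      also have "\<dots> \<le> T h"
        unfolding T_def
      proof (intro sum_mono prod_mono)
        fix a :: "(nat \<times> nat) set \<Rightarrow> 'a" and b c :: "nat \<Rightarrow> 'a" and q :: "(nat \<times> nat) set \<times> nat \<times> nat"
        obtain S i j where q: "q = (S, i, j)" by (cases q)
        have "0 \<le> h r * (1 - h r) \<and> h r * (1 - h r) \<le> h r \<and> h r * (1 - h r) \<le> 1 - h r" for r
          using h01[of r] by (simp add: mult_left_le mult_left_le_one_le)
        then show "0 \<le> (case q of (S, i, j) \<Rightarrow> h (a S, b i, c j) * (1 - h (a S, b i, c j))) \<and>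
           (case q of (S, i, j) \<Rightarrow> h (a S, b i, c j) * (1 - h (a S, b i, c j)))
           \<le> (case q of (S, i, j) \<Rightarrow> K h (S, i, j) (a S, b i, c j))"
          by (simp add: q K_def)
      qed
      finally show ?thesis .
    qed
    ultimately have "\<mu> ^ m * ?N \<le> real m * \<delta> * ?N" by linarith
    then have "\<mu> ^ m \<le> real m * \<delta>" using N by (rule mult_right_le_imp_le)
    with m\<delta> have "\<not> \<epsilon> \<le> \<mu>" using power_mono[of \<epsilon> \<mu> m] \<epsilon> by linarith
    then have "(\<Sum>q\<in>V\<times>V\<times>V. h q * (1 - h q)) \<le> \<epsilon> * real (card V) ^ 3"
      using V by (simp add: \<mu>_def not_le pos_divide_less_eq card_gt_0_iff)
    then show "\<exists>\<kappa>1 \<kappa>2 \<kappa>3. (\<forall>b. \<kappa>1 b < M \<and> \<kappa>2 b < M \<and> \<kappa>3 b < M) \<and>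
      (let h = cond_avg (V \<times> V \<times> V) (cyl_map \<kappa>1 \<kappa>2 \<kappa>3) (edge_fun F) in
        (\<Sum>q\<in>V\<times>V\<times>V. h q * (1 - h q)) \<le> \<epsilon> * real (card V) ^ 3)"
      using \<kappa> unfolding h_def Let_def by blast
  qed
qed

section \<open>Graph regularity\<close>

text \<open>Parts are listed by increasing size because \<open>decomposition\<close> asks for this
  order.\<close>

definition equitable :: "nat \<Rightarrow> (nat \<Rightarrow> 'a set) \<Rightarrow> 'a set \<Rightarrow> bool" where
  "equitable t A V \<longleftrightarrow> (\<Union>i\<in>{1..t}. A i) = V \<and> disjoint_family_on A {1..t} \<and>
     (\<forall>i\<in>{1..t}. card V div t \<le> card (A i) \<and> card (A i) \<le> card V div t + 1) \<and>
     (\<forall>i\<in>{1..t}. \<forall>j\<in>{1..t}. i \<le> j \<longrightarrow> card (A i) \<le> card (A j))"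

text \<open>The vertices are sorted by their class under \<open>p\<close> and cut into consecutive
  blocks. In a block that meets several classes, \<open>p\<close> increases from the first to the
  last element; hence the classes of the first elements of such blocks are strictly increasing, and
  there are at most \<open>r\<close> of them.\<close>

lemma ex_equitable_almost_refining:
  fixes p :: "'a \<Rightarrow> nat"
  assumes fin: "finite V" and t: "1 \<le> t" and p: "\<And>x. p x < r"
  shows "\<exists>A. equitable t A V \<and> card {i \<in> {1..t}. \<not> (\<exists>a. \<forall>x\<in>A i. p x = a)} \<le> r"
proof -
  define n where "n = card V"
  obtain xs0 where xs0: "set xs0 = V" "distinct xs0" using finite_distinct_list[OF fin] by blast
  define xs where "xs = sort_key p xs0"
  have xs: "set xs = V" "distinct xs" "sorted (map p xs)" "length xs = n"
    using xs0 by (auto simp: xs_def n_def distinct_card)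
  have mono: "p (xs ! s) \<le> p (xs ! s')" if "s \<le> s'" "s' < n" for s s'
    using xs(3,4) that sorted_nth_mono[of "map p xs" s s'] by simp
  define q where "q = n div t"
  define k where "k = t - n mod t"
  \<comment> \<open>The number of vertices in the first \<open>i\<close> blocks. The truncated
    difference \<open>i - k\<close> adds one for each block after the \<open>k\<close>-th, so that
    exactly the last \<open>n mod t\<close> blocks have size \<open>q + 1\<close>.\<close>
  define st where "st i = i * q + (i - k)" for i
  have k: "k \<le> t" "t - k = n mod t" using t by (auto simp: k_def less_imp_le)
  have st0: "st 0 = 0" by (simp add: st_def)
  have stt: "st t = n" by (simp add: st_def k q_def)
  have st_mono: "st i \<le> st j" if "i \<le> j" for i j using that by (auto simp: st_def intro: add_mono diff_le_mono)
  define A where "A i = (\<lambda>s. xs ! s) ` {st (i - 1)..<st i}" for i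
  have A_mem: "\<exists>s. st (i - 1) \<le> s \<and> s < st i \<and> s < n \<and> x = xs ! s" if "i \<in> {1..t}" "x \<in> A i" for i x
    using that st_mono[of i t] stt by (auto simp: A_def)
  have inj: "inj_on (\<lambda>s. xs ! s) {..<n}" using xs by (simp add: inj_on_nth)
  have card: "card (A i) = q + of_bool (k < i)" if "i \<in> {1..t}" for i
  proof -
    have "card (A i) = st i - st (i - 1)"
      unfolding A_def using st_mono[of i t] stt that
      by (subst card_image) (auto intro: inj_on_subset[OF inj])
    also have "\<dots> = q + of_bool (k < i)"
      using that by (cases i) (auto simp: st_def)
    finally show ?thesis .
  qed
  have un: "(\<Union>i\<in>{1..t}. A i) = V"
  proof
    show "(\<Union>i\<in>{1..t}. A i) \<subseteq> V" using A_mem xs by (fastforce simp: set_conv_nth)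
    show "V \<subseteq> (\<Union>i\<in>{1..t}. A i)"
    proof
      fix x assume "x \<in> V"
      then obtain s where s: "s < n" "x = xs ! s" using xs by (metis in_set_conv_nth)
      define i where "i = (LEAST i. s < st i)"
      have si: "s < st i" unfolding i_def by (rule LeastI[of _ t]) (simp add: stt s)
      have it: "i \<le> t" unfolding i_def by (rule Least_le) (simp add: stt s)
      have i0: "i \<noteq> 0" using si st0 by (cases i) auto
      have "\<not> s < st (i - 1)" using i0 not_less_Least[of "i - 1" "\<lambda>i. s < st i"] by (simp add: i_def)
      then show "x \<in> (\<Union>i\<in>{1..t}. A i)" using si it i0 s by (auto simp: A_def intro!: bexI[of _ i])
    qed
  qed
  have disj: "A i \<inter> A j = {}" if i: "i \<in> {1..t}" and j: "j \<in> {1..t}" and ij: "i < j" for i j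
  proof (rule ccontr)
    assume "A i \<inter> A j \<noteq> {}"
    then obtain x where x: "x \<in> A i" "x \<in> A j" by blast
    obtain s where s: "s < st i" "s < n" "x = xs ! s" using A_mem[OF i x(1)] by blast
    obtain s' where s': "st (j - 1) \<le> s'" "s' < n" "x = xs ! s'" using A_mem[OF j x(2)] by blast
    have "s = s'" using inj s s' by (auto simp: inj_on_def)
    moreover have "st i \<le> st (j - 1)" using ij by (intro st_mono) auto
    ultimately show False using s s' by simp
  qed
  have "disjoint_family_on A {1..t}"
    unfolding disjoint_family_on_def using disj by (metis Int_commute linorder_neqE_nat)
  then have eq: "equitable t A V"
    unfolding equitable_def using un card by (auto simp: q_def n_def)
  define B where "B = {i \<in> {1..t}. \<not> (\<exists>a. \<forall>x\<in>A i. p x = a)}"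
  have jump: "st (i - 1) < n \<and> st i \<le> n \<and> 0 < st i \<and> p (xs ! st (i - 1)) < p (xs ! (st i - 1))" if "i \<in> B" for i
  proof -
    have i: "i \<in> {1..t}" using that by (simp add: B_def)
    have "\<exists>x\<in>A i. p x \<noteq> p (xs ! st (i - 1))" using that by (auto simp: B_def)
    then obtain s where s: "st (i - 1) \<le> s" "s < st i" "s < n" "p (xs ! s) \<noteq> p (xs ! st (i - 1))"
      using A_mem[OF i] by blast
    have "st i \<le> n" using st_mono[of i t] stt i by auto
    moreover have "p (xs ! st (i - 1)) \<le> p (xs ! s)" using s by (intro mono) auto
    moreover have "p (xs ! s) \<le> p (xs ! (st i - 1))" using s \<open>st i \<le> n\<close> by (intro mono) auto
    ultimately show ?thesis using s by auto
  qed
  have "inj_on (\<lambda>i. p (xs ! st (i - 1))) B"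
  proof -
    have "p (xs ! st (i - 1)) < p (xs ! st (j - 1))" if "i \<in> B" "j \<in> B" "i < j" for i j
    proof -
      have "st i \<le> st (j - 1)" using that by (intro st_mono) auto
      then have "p (xs ! (st i - 1)) \<le> p (xs ! st (j - 1))" using jump[OF that(2)] by (intro mono) auto
      then show ?thesis using jump[OF that(1)] by simp
    qed
    then show ?thesis by (intro linorder_inj_onI) (auto simp: less_imp_neq)
  qed
  then have "card B \<le> card {..<r}" using p by (intro card_inj_on_le[of "\<lambda>i. p (xs ! st (i - 1))"]) auto
  then show ?thesis using eq unfolding B_def by auto
qed

text \<open>Since \<open>t \<le> card V\<close>, the quotient \<open>q\<close> is at least 1, and
  rounding costs at most a factor 2 in either direction.\<close>

lemma equitable_card_bounds:
  assumes "equitable t A V" "1 \<le> t" "t \<le> card V" "i \<in> {1..t}"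
  shows "real (card V) / (2 * real t) \<le> real (card (A i))" "real (card (A i)) \<le> 2 * real (card V) / real t"
proof -
  define q where "q = card V div t"
  have q: "q \<le> card (A i)" "card (A i) \<le> q + 1" using assms by (auto simp: equitable_def q_def)
  have q1: "1 \<le> q" using assms by (simp add: q_def div_greater_zero_iff Suc_leI)
  have n: "card V = t * q + card V mod t" by (simp add: q_def)
  have "card V \<le> t * q + t" using n mod_less_divisor[of t "card V"] assms(2) by linarith
  also have "\<dots> \<le> 2 * t * q" using q1 by simp
  also have "\<dots> \<le> 2 * t * card (A i)" using q by simp
  finally have "real (card V) \<le> real (2 * t * card (A i))" using of_nat_le_iff by blast
  then show "real (card V) / (2 * real t) \<le> real (card (A i))"
    using assms(2) by (simp add: divide_le_eq mult_ac)
  have "t * card (A i) \<le> t * (q + 1)" using q(2) by (rule mult_le_mono2)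
  also have "\<dots> \<le> 2 * (t * q)" using q1 by simp
  also have "\<dots> \<le> 2 * card V" using n by linarith
  finally have "real (t * card (A i)) \<le> real (2 * card V)" using of_nat_le_iff by blast
  then show "real (card (A i)) \<le> 2 * real (card V) / real t"
    using assms(2) by (simp add: le_divide_eq mult_ac)
qed

text \<open>The number \<open>D c\<close> need not be the density of the colour \<open>c\<close> between \<open>U\<close> and \<open>W\<close>: it will be a density
  between two classes of a coarser partition.\<close>

definition regular_colouring ::
  "nat \<Rightarrow> real \<Rightarrow> 'a set \<Rightarrow> 'a set \<Rightarrow> ('a \<times> 'a \<Rightarrow> nat) \<Rightarrow> (nat \<Rightarrow> real) \<Rightarrow> bool" where
  "regular_colouring M \<eta> U W \<kappa> D \<longleftrightarrow> (\<forall>c<M. 0 \<le> D c) \<and> (\<Sum>c<M. D c) = 1 \<and>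
     (\<forall>c<M. \<forall>U' W'. U' \<subseteq> U \<and> W' \<subseteq> W \<longrightarrow>
        \<bar>real (card {b \<in> U' \<times> W'. \<kappa> b = c}) - D c * real (card U') * real (card W')\<bar>
          \<le> \<eta> * real (card U) * real (card W))"

text \<open>The indicators of all colours are bundled into one function with the colour as a third
  coordinate, so that a single energy controls all colour classes at once.\<close>

definition colour_fun :: "('a \<times> 'a \<Rightarrow> nat) \<Rightarrow> 'a \<times> 'a \<times> nat \<Rightarrow> real" where
  "colour_fun \<kappa> = (\<lambda>(x, y, c). of_bool (\<kappa> (x, y) = c))"

definition pair_map :: "('a \<Rightarrow> nat) \<Rightarrow> 'a \<times> 'a \<times> nat \<Rightarrow> nat \<times> nat \<times> nat" where
  "pair_map p = (\<lambda>(x, y, c). (p x, p y, c))"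

lemma sum_colour_fun:
  assumes "finite U'" "finite W'"
  shows "(\<Sum>w\<in>U' \<times> W' \<times> {c}. colour_fun \<kappa> w) = real (card {b \<in> U' \<times> W'. \<kappa> b = c})"
proof -
  have "(\<Sum>w\<in>U' \<times> W' \<times> {c}. colour_fun \<kappa> w) = (\<Sum>b\<in>U' \<times> W'. of_bool (\<kappa> b = c))"
    by (rule sum.reindex_bij_witness[where j="\<lambda>(x, y, c). (x, y)" and i="\<lambda>(x, y). (x, y, c)"])
       (auto simp: colour_fun_def)
  also have "\<dots> = real (card {b \<in> U' \<times> W'. \<kappa> b = c})"
    using assms by (simp add: Int_def)
  finally show ?thesis .
qed

text \<open>The colours partition the product of two vertex classes, so their densities there form a
  probability vector, as \<open>regular_colouring\<close> requires of \<open>D\<close>.\<close>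

lemma sum_cond_avg_colour_fun:
  assumes fin: "finite V" and xy: "x \<in> V" "y \<in> V" and \<kappa>: "\<And>b. \<kappa> b < M"
  shows "(\<Sum>c<M. cond_avg (V \<times> V \<times> {..<M}) (pair_map p) (colour_fun \<kappa>) (x, y, c)) = 1"
proof -
  define P Q where "P = {x' \<in> V. p x' = p x}" and "Q = {y' \<in> V. p y' = p y}"
  have fPQ: "finite P" "finite Q" using fin by (auto simp: P_def Q_def)
  have cell: "cell (V \<times> V \<times> {..<M}) (pair_map p) (x, y, c) = P \<times> Q \<times> {c}" if "c < M" for c
    using that by (auto simp: cell_def pair_map_def P_def Q_def)
  have "x \<in> P" "y \<in> Q" using xy by (auto simp: P_def Q_def)
  then have cPQ: "card P > 0" "card Q > 0" using fPQ by (auto simp: card_gt_0_iff)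
  then have pos: "real (card P * card Q) > 0" by simp
  have "(\<Sum>c<M. cond_avg (V \<times> V \<times> {..<M}) (pair_map p) (colour_fun \<kappa>) (x, y, c))
    = (\<Sum>c<M. real (card {b \<in> P \<times> Q. \<kappa> b = c})) / real (card P * card Q)"
    unfolding sum_divide_distrib
    by (rule sum.cong) (auto simp: cond_avg_def cell sum_colour_fun fPQ card_cartesian_product)
  also have "(\<Sum>c<M. real (card {b \<in> P \<times> Q. \<kappa> b = c})) = real (card (\<Union>c<M. {b \<in> P \<times> Q. \<kappa> b = c}))"
    using fPQ by (subst card_UN_disjoint) auto
  also have "(\<Union>c<M. {b \<in> P \<times> Q. \<kappa> b = c}) = P \<times> Q" using \<kappa> by auto
  finally show ?thesis using cPQ by (simp add: card_cartesian_product)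
qed

text \<open>The hypothesis \<open>max\<close> says that no partition of controlled size gains
  energy. The energy is that of \<open>p\<close>, not of the equitable parts, so equalising the
  sizes costs none; the parts only serve to find witnesses of irregularity. For parts inside classes
  of \<open>p\<close>, \<open>D\<close> is the density between these classes, hence a deviation on
  \<open>U \<times> W\<close> is a correlation with \<open>?f - ?h\<close>. If more than
  \<open>\<eta> / 2 * t\<^sup>2\<close> pairs had such a witness, refining \<open>p\<close> by all
  of them would contradict \<open>max\<close>.\<close>

lemma regularity_step:
  fixes p :: "'a \<Rightarrow> nat" and \<kappa> :: "'a \<times> 'a \<Rightarrow> nat"
  assumes fin: "finite V" and t: "1 \<le> t" "t \<le> card V" and p: "\<And>x. p x < r"
    and \<kappa>: "\<And>b. \<kappa> b < M" and \<eta>: "\<eta> > 0" "4 * real r / \<eta> \<le> real t"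
    and max: "\<not> (\<exists>p'. (\<forall>x. p' x < r * 2 ^ (t * t) * 2 ^ (t * t)) \<and>
      energy (V \<times> V \<times> {..<M}) (pair_map p) (colour_fun \<kappa>)
        + (\<eta>\<^sup>2 / (8 * real M))\<^sup>2 * real (card (V \<times> V \<times> {..<M}))
      \<le> energy (V \<times> V \<times> {..<M}) (pair_map p') (colour_fun \<kappa>))"
  shows "\<exists>A Bad. equitable t A V \<and> Bad \<subseteq> {1..t} \<times> {1..t} \<and> real (card Bad) \<le> \<eta> * real t ^ 2 \<and>
    (\<forall>(i, j)\<in>{1..t} \<times> {1..t} - Bad. \<exists>D. regular_colouring M \<eta> (A i) (A j) \<kappa> D)"
proof -
  define \<Omega> where "\<Omega> = V \<times> V \<times> {..<M}"
  have fin\<Omega>: "finite \<Omega>" using fin by (simp add: \<Omega>_def)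
  let ?f = "colour_fun \<kappa>" and ?h = "cond_avg \<Omega> (pair_map p) (colour_fun \<kappa>)"
  let ?n = "real (card V)"
  have M: "M > 0" using \<kappa>[of undefined] by simp
  obtain A where A': "equitable t A V \<and> card {i \<in> {1..t}. \<not> (\<exists>a. \<forall>x\<in>A i. p x = a)} \<le> r"
    using ex_equitable_almost_refining[OF fin t(1), of p r, OF p] by (elim exE)
  note A = conjunct1[OF A'] conjunct2[OF A']
  \<comment> \<open>Parts that straddle several classes of \<open>p\<close> have no common
    \<open>D\<close>. There are at most \<open>r\<close>, so they spoil at most
    \<open>2 * r * t\<close> pairs, which the lower bound on \<open>t\<close> makes at most half of
    the allowance.\<close>
  define B1 where "B1 = {i \<in> {1..t}. \<not> (\<exists>a. \<forall>x\<in>A i. p x = a)}"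
  have AV: "A i \<subseteq> V" if "i \<in> {1..t}" for i using A(1) that by (auto simp: equitable_def)
  have fA: "finite (A i)" if "i \<in> {1..t}" for i using AV[OF that] fin finite_subset by blast
  have Abig: "?n / (2 * real t) \<le> real (card (A i))" if "i \<in> {1..t}" for i
    using equitable_card_bounds[OF A(1) t that] by simp
  have npos: "?n > 0" using t by simp
  have Ane: "A i \<noteq> {}" if "i \<in> {1..t}" for i
    using Abig[OF that] npos t(1) by (auto simp: field_simps)
  define pt where "pt i = (SOME x. x \<in> A i)" for i
  have pt: "pt i \<in> A i" if "i \<in> {1..t}" for i using Ane[OF that] by (auto simp: pt_def some_in_eq)
  define D where "D i j c = ?h (pt i, pt j, c)" for i j c
  have hD: "?h (x, y, c) = D i j c" if "i \<in> {1..t} - B1" "j \<in> {1..t} - B1" "x \<in> A i" "y \<in> A j" for i j x y c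
  proof -
    have "p x = p (pt i)" "p y = p (pt j)" using that pt[of i] pt[of j] by (auto simp: B1_def)
    then show ?thesis unfolding D_def by (intro cond_avg_cong) (simp add: pair_map_def)
  qed
  define viol where "viol i j U W c \<longleftrightarrow> U \<subseteq> A i \<and> W \<subseteq> A j \<and> c < M \<and>
      \<eta> * real (card (A i)) * real (card (A j)) <
      \<bar>real (card {b \<in> U \<times> W. \<kappa> b = c}) - D i j c * real (card U) * real (card W)\<bar>" for i j U W c
  define B2 where "B2 = {(i, j). i \<in> {1..t} - B1 \<and> j \<in> {1..t} - B1 \<and> (\<exists>U W c. viol i j U W c)}"
  have B2sub: "B2 \<subseteq> {1..t} \<times> {1..t}" by (auto simp: B2_def)
  have fB2: "finite B2" using B2sub finite_subset by blast
  have "\<forall>e\<in>B2. \<exists>U W c. viol (fst e) (snd e) U W c" by (auto simp: B2_def)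
  then obtain U W c where viol: "\<And>e. e \<in> B2 \<Longrightarrow> viol (fst e) (snd e) (U e) (W e) (c e)" by metis
  have UA: "U e \<subseteq> A (fst e)" "W e \<subseteq> A (snd e)" "c e < M" if "e \<in> B2" for e
    using viol[OF that] by (auto simp: viol_def)
  have e12: "fst e \<in> {1..t} - B1" "snd e \<in> {1..t} - B1" if "e \<in> B2" for e using that by (auto simp: B2_def)
  have fUW: "finite (U e)" "finite (W e)" if "e \<in> B2" for e
    using UA[OF that] fA e12[OF that] by (meson DiffD1 finite_subset)+
  define S where "S e = (\<Sum>w\<in>U e \<times> W e \<times> {c e}. ?f w - ?h w)" for e
  have S: "S e = real (card {b \<in> U e \<times> W e. \<kappa> b = c e}) - D (fst e) (snd e) (c e) * real (card (U e)) * real (card (W e))"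
    if "e \<in> B2" for e
  proof -
    have "(\<Sum>w\<in>U e \<times> W e \<times> {c e}. ?h w) = (\<Sum>w\<in>U e \<times> W e \<times> {c e}. D (fst e) (snd e) (c e))"
      using UA[OF that] e12[OF that] hD by (intro sum.cong refl) (auto simp: subset_iff)
    then show ?thesis
      by (simp add: S_def sum_subtractf sum_colour_fun fUW[OF that] card_cartesian_product mult_ac)
  qed
  \<comment> \<open>A part has at least \<open>?n / (2 * t)\<close> vertices. With
    \<open>\<eta> / 2 * t\<^sup>2\<close> pairs this adds up to
    \<open>\<eta>\<^sup>2 / 8 * ?n\<^sup>2\<close>, and division by
    \<open>card \<Omega> = M * ?n\<^sup>2\<close> gives the constant
    \<open>\<eta>\<^sup>2 / (8 * M)\<close>.\<close>
  have Sbig: "\<eta> * ?n\<^sup>2 / (4 * real t ^ 2) \<le> \<bar>S e\<bar>" if "e \<in> B2" for e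
  proof -
    have "?n / (2 * real t) * (?n / (2 * real t)) \<le> real (card (A (fst e))) * real (card (A (snd e)))"
      using Abig e12[OF that] by (intro mult_mono) auto
    then have "\<eta> * (?n / (2 * real t) * (?n / (2 * real t))) \<le> \<eta> * (real (card (A (fst e))) * real (card (A (snd e))))"
      using \<eta> by (intro mult_left_mono) auto
    also have "\<dots> \<le> \<bar>S e\<bar>" using viol[OF that] S[OF that] by (simp add: viol_def mult.assoc)
    finally show ?thesis by (simp add: power2_eq_square)
  qed
  \<comment> \<open>The signs make all deviations add up; boxes that belong to different pairs of
    parts are disjoint, so \<open>g\<close> stays within \<open>[-1, 1]\<close>.\<close>
  define g where "g w = (\<Sum>e\<in>B2. sgn (S e) * indicator (U e \<times> W e \<times> {c e}) w)" for w
  have B2small: "real (card B2) \<le> \<eta> / 2 * real t ^ 2"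
  proof (rule ccontr)
    assume big: "\<not> real (card B2) \<le> \<eta> / 2 * real t ^ 2"
    \<comment> \<open>A new class records the old class and the membership in every
      \<open>U e\<close> and every \<open>W e\<close>. There are at most \<open>t * t\<close> pairs
      \<open>e\<close>, whence the two powers of 2.\<close>
    define T where "T = {..<r} \<times> Pow ({1..t} \<times> {1..t}) \<times> Pow ({1..t} \<times> {1..t})"
    have cT: "card T = r * 2 ^ (t * t) * 2 ^ (t * t)" and fT: "finite T"
      by (auto simp: T_def card_cartesian_product card_Pow)
    obtain enc where enc: "bij_betw enc T {0..<card T}" using ex_bij_betw_finite_nat[OF fT] by blast
    define tup where "tup x = (p x, {e \<in> B2. x \<in> U e}, {e \<in> B2. x \<in> W e})" for x
    have tupT: "tup x \<in> T" for x using p B2sub by (auto simp: tup_def T_def)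
    define p' where "p' x = enc (tup x)" for x
    have p'_lt: "p' x < r * 2 ^ (t * t) * 2 ^ (t * t)" for x
      using enc tupT[of x] unfolding cT[symmetric] p'_def bij_betw_def by force
    have p'_eq: "tup x = tup y" if "p' x = p' y" for x y
      using that enc tupT unfolding p'_def bij_betw_def inj_on_def by blast
    have "energy \<Omega> (pair_map p) ?f + (\<eta>\<^sup>2 / (8 * real M))\<^sup>2 * real (card \<Omega>) \<le> energy \<Omega> (pair_map p') ?f"
    proof (rule energy_increment[OF fin\<Omega>, where g=g])
      fix w w' assume ww: "pair_map p' w = pair_map p' w'"
      obtain x y d where w: "w = (x, y, d)" by (cases w)
      obtain x' y' where w': "w' = (x', y', d)" using ww w by (cases w') (auto simp: pair_map_def)
      have tt: "tup x = tup x'" "tup y = tup y'"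
        using ww p'_eq[of x x'] p'_eq[of y y'] by (simp_all add: w w' pair_map_def)
      then show "pair_map p w = pair_map p w'" by (simp add: w w' pair_map_def tup_def)
      have "{e \<in> B2. x \<in> U e} = {e \<in> B2. x' \<in> U e}" "{e \<in> B2. y \<in> W e} = {e \<in> B2. y' \<in> W e}"
        using tt by (simp_all add: tup_def)
      then have "x \<in> U e \<longleftrightarrow> x' \<in> U e" "y \<in> W e \<longleftrightarrow> y' \<in> W e" if "e \<in> B2" for e
        using that by blast+
      then show "g w = g w'" unfolding g_def w w' by (intro sum.cong refl) (simp add: indicator_def)
    next
      fix w assume "w \<in> \<Omega>"
      define E where "E = {e \<in> B2. w \<in> U e \<times> W e \<times> {c e}}"
      have "card E \<le> Suc 0"
      proof -
        have "e = e'" if "e \<in> E" "e' \<in> E" for e e'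
        proof -
          have *: "e \<in> B2" "e' \<in> B2" using that by (auto simp: E_def)
          have "fst w \<in> A (fst e) \<inter> A (fst e')" "fst (snd w) \<in> A (snd e) \<inter> A (snd e')"
            using that UA[OF *(1)] UA[OF *(2)] by (auto simp: E_def)
          then have "fst e = fst e'" "snd e = snd e'"
            using A(1) e12[OF *(1)] e12[OF *(2)] unfolding equitable_def disjoint_family_on_def by blast+
          then show ?thesis by (rule prod_eqI)
        qed
        moreover have "finite E" using fB2 by (simp add: E_def)
        ultimately show ?thesis using card_le_Suc0_iff_eq[of E] by blast
      qed
      have "\<bar>g w\<bar> \<le> (\<Sum>e\<in>B2. \<bar>sgn (S e) * indicator (U e \<times> W e \<times> {c e}) w\<bar>)" unfolding g_def by (rule sum_abs)
      also have "\<dots> \<le> (\<Sum>e\<in>B2. of_bool (w \<in> U e \<times> W e \<times> {c e}))"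
        by (intro sum_mono) (auto simp: abs_mult indicator_def sgn_if)
      also have "\<dots> = real (card E)" using fB2 by (simp add: E_def Int_def)
      finally show "\<bar>g w\<bar> \<le> 1" using \<open>card E \<le> Suc 0\<close> by simp
    next
      have "(\<Sum>w\<in>\<Omega>. (?f w - ?h w) * g w) = (\<Sum>e\<in>B2. \<Sum>w\<in>\<Omega>. (?f w - ?h w) * (sgn (S e) * indicator (U e \<times> W e \<times> {c e}) w))"
        unfolding g_def sum_distrib_left by (rule sum.swap)
      also have "\<dots> = (\<Sum>e\<in>B2. \<bar>S e\<bar>)"
      proof (rule sum.cong[OF refl])
        fix e assume e: "e \<in> B2"
        have sub: "U e \<times> W e \<times> {c e} \<subseteq> \<Omega>"
          using UA[OF e] AV e12[OF e] unfolding \<Omega>_def by blast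
        have "(\<Sum>w\<in>\<Omega>. (?f w - ?h w) * (sgn (S e) * indicator (U e \<times> W e \<times> {c e}) w))
          = sgn (S e) * (\<Sum>w\<in>\<Omega>. (?f w - ?h w) * indicator (U e \<times> W e \<times> {c e}) w)"
          by (simp add: sum_distrib_left mult_ac)
        also have "(\<Sum>w\<in>\<Omega>. (?f w - ?h w) * indicator (U e \<times> W e \<times> {c e}) w) = S e"
          unfolding S_def using sub fin\<Omega> by (simp add: sum.inter_restrict[symmetric] indicator_def if_distrib Int_absorb1 flip: mult.commute cong: if_cong)
        finally show "(\<Sum>w\<in>\<Omega>. (?f w - ?h w) * (sgn (S e) * indicator (U e \<times> W e \<times> {c e}) w)) = \<bar>S e\<bar>"
          by (simp add: abs_sgn)
      qed
      finally have eq: "(\<Sum>w\<in>\<Omega>. (?f w - ?h w) * g w) = (\<Sum>e\<in>B2. \<bar>S e\<bar>)" .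
      have "\<eta>\<^sup>2 / (8 * real M) * real (card \<Omega>) = \<eta> / 2 * real t ^ 2 * (\<eta> * ?n\<^sup>2 / (4 * real t ^ 2))"
        using t M by (simp add: \<Omega>_def card_cartesian_product power2_eq_square field_simps)
      also have "\<dots> \<le> real (card B2) * (\<eta> * ?n\<^sup>2 / (4 * real t ^ 2))"
        using big \<eta> by (intro mult_right_mono) auto
      also have "\<dots> \<le> (\<Sum>e\<in>B2. \<bar>S e\<bar>)" using sum_mono[of B2 "\<lambda>_. \<eta> * ?n\<^sup>2 / (4 * real t ^ 2)" "\<lambda>e. \<bar>S e\<bar>"] Sbig by simp
      finally show "\<eta>\<^sup>2 / (8 * real M) * real (card \<Omega>) \<le> \<bar>\<Sum>w\<in>\<Omega>. (?f w - ?h w) * g w\<bar>"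
        unfolding eq by simp
    qed simp
    then show False using max p'_lt unfolding \<Omega>_def by blast
  qed
  define Bad where "Bad = B1 \<times> {1..t} \<union> {1..t} \<times> B1 \<union> B2"
  have b1: "card B1 \<le> r" using A(2) by (simp add: B1_def)
  have "card Bad \<le> card B1 * t + t * card B1 + card B2"
    unfolding Bad_def
    using card_Un_le[of "B1 \<times> {1..t} \<union> {1..t} \<times> B1" B2] card_Un_le[of "B1 \<times> {1..t}" "{1..t} \<times> B1"]
    by (simp add: card_cartesian_product)
  also have "\<dots> \<le> r * t + t * r + card B2" using b1 by (intro add_mono mult_le_mono order_refl)
  finally have "real (card Bad) \<le> real (r * t + t * r + card B2)" using of_nat_le_iff by blast
  then have "real (card Bad) \<le> 2 * real r * real t + real (card B2)" by simp
  moreover have "2 * real r * real t \<le> \<eta> / 2 * real t ^ 2"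
  proof -
    have "4 * real r \<le> \<eta> * real t" using \<eta> by (simp add: divide_le_eq mult.commute)
    then have "4 * real r * real t \<le> \<eta> * real t * real t" by (intro mult_right_mono) auto
    then show ?thesis by (simp add: power2_eq_square)
  qed
  ultimately have cBad: "real (card Bad) \<le> \<eta> * real t ^ 2" using B2small by simp
  have reg: "regular_colouring M \<eta> (A i) (A j) \<kappa> (D i j)" if ij: "(i, j) \<in> {1..t} \<times> {1..t} - Bad" for i j
  proof -
    have m: "i \<in> {1..t} - B1" "j \<in> {1..t} - B1" "(i, j) \<notin> B2" using ij by (auto simp: Bad_def)
    have v: "\<not> viol i j U W c" for U W c using m by (auto simp: B2_def)
    have V: "pt i \<in> V" "pt j \<in> V" using pt AV m by blast+
    show ?thesis unfolding regular_colouring_def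
    proof (intro conjI allI impI, goal_cases)
      case (1 c)
      show ?case unfolding D_def by (intro cond_avg_bounds fin\<Omega>) (auto simp: colour_fun_def)
    next
      case 2
      show ?case unfolding D_def \<Omega>_def by (rule sum_cond_avg_colour_fun[OF fin V \<kappa>])
    next
      case (3 c U' W')
      then show ?case using v[of U' W' c] by (auto simp: viol_def)
    qed
  qed
  have "Bad \<subseteq> {1..t} \<times> {1..t}" using B2sub by (auto simp: Bad_def B1_def)
  then show ?thesis using A(1) cBad reg by blast
qed

text \<open>The iteration starts with a single class. Against \<open>r\<close> classes
  \<open>tf r\<close> parts are used, and \<open>\<Phi> r\<close> bounds the number of classes after
  a refinement. As \<open>tf\<close> is monotone, its value at the iterated bound covers every
  stage, and \<open>T \<le> card V\<close> ensures that there are no more parts than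
  vertices.\<close>

theorem regularity:
  fixes \<eta> :: real and M t0 :: nat
  assumes \<eta>: "\<eta> > 0"
  shows "\<exists>T. \<forall>V \<kappa>. finite (V :: 'a set) \<and> T \<le> card V \<and> (\<forall>b. \<kappa> b < M) \<longrightarrow>
    (\<exists>t A Bad. t0 \<le> t \<and> 1 \<le> t \<and> t \<le> T \<and> equitable t A V \<and> Bad \<subseteq> {1..t} \<times> {1..t} \<and> real (card Bad) \<le> \<eta> * real t ^ 2 \<and>
    (\<forall>(i, j)\<in>{1..t} \<times> {1..t} - Bad. \<exists>D. regular_colouring M \<eta> (A i) (A j) \<kappa> D))"
proof -
  define \<delta> where "\<delta> = (\<eta>\<^sup>2 / (8 * real M))\<^sup>2"
  define tf where "tf r = max t0 (nat \<lceil>4 * real r / \<eta>\<rceil>) + 1" for r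
  define \<Phi> where "\<Phi> r = r * 2 ^ (tf r * tf r) * 2 ^ (tf r * tf r)" for r
  obtain m :: nat where m: "1 / \<delta> < real m" using reals_Archimedean2 by blast
  define T where "T = tf (iterated_size_bound \<Phi> m 1)"
  have tf: "t0 \<le> tf r" "1 \<le> tf r" "4 * real r / \<eta> \<le> real (tf r)" for r
    unfolding tf_def by (auto, linarith)
  have tf_mono: "tf r \<le> tf r'" if "r \<le> r'" for r r'
  proof -
    have "4 * real r / \<eta> \<le> 4 * real r' / \<eta>" using that \<eta> by (simp add: divide_right_mono)
    then have "nat \<lceil>4 * real r / \<eta>\<rceil> \<le> nat \<lceil>4 * real r' / \<eta>\<rceil>" by (intro nat_mono ceiling_mono)
    then show ?thesis by (simp add: tf_def)
  qed
  show ?thesis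
  proof (rule exI[of _ T], intro allI impI, elim conjE)
    fix V :: "'a set" and \<kappa> :: "'a \<times> 'a \<Rightarrow> nat"
    assume V: "finite V" "T \<le> card V" and \<kappa>: "\<forall>b. \<kappa> b < M"
    define \<Omega> where "\<Omega> = V \<times> V \<times> {..<M}"
    have fin\<Omega>: "finite \<Omega>" using V by (simp add: \<Omega>_def)
    have M: "M > 0" using \<kappa>[rule_format, of undefined] by simp
    have "V \<noteq> {}" using V tf(2) unfolding T_def by (metis card.empty not_one_le_zero le_trans)
    then have pos: "real (card \<Omega>) > 0" using fin\<Omega> M by (auto simp: \<Omega>_def card_gt_0_iff)
    have "\<delta> > 0" using \<eta> M by (simp add: \<delta>_def)
    then have m1: "1 < real m * \<delta>" using m by (simp add: divide_less_eq)
    let ?e = "\<lambda>p. energy \<Omega> (pair_map p) (colour_fun \<kappa>)"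
    let ?bnd = "\<lambda>(p :: 'a \<Rightarrow> nat) r. \<forall>x. p x < r"
    let ?good = "\<lambda>p r. \<not> (\<exists>p'. ?bnd p' (\<Phi> r) \<and> ?e p + \<delta> * real (card \<Omega>) \<le> ?e p')"
    have "\<exists>p r. ?good p r \<and> ?bnd p r \<and> r \<le> iterated_size_bound \<Phi> m 1"
    proof (rule increment_terminates[where e="?e" and B="real (card \<Omega>)" and \<delta>="\<delta> * real (card \<Omega>)" and p="\<lambda>_. 0"])
      show "?e p \<le> real (card \<Omega>)" for p
        by (rule energy_le[OF fin\<Omega>]) (auto simp: colour_fun_def)
      have "1 * real (card \<Omega>) < real m * \<delta> * real (card \<Omega>)" using m1 pos by (intro mult_strict_right_mono)
      then show "real (card \<Omega>) - real m * (\<delta> * real (card \<Omega>)) < ?e (\<lambda>_. 0)"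
        using energy_nonneg[of \<Omega> "pair_map (\<lambda>_. 0)" "colour_fun \<kappa>"] by (simp add: mult.assoc)
    qed auto
    then obtain p r where good: "?good p r" and p: "?bnd p r" and r: "r \<le> iterated_size_bound \<Phi> m 1" by blast
    have tT: "tf r \<le> T" unfolding T_def using r by (rule tf_mono)
    have "\<exists>A Bad. equitable (tf r) A V \<and> Bad \<subseteq> {1..tf r} \<times> {1..tf r} \<and> real (card Bad) \<le> \<eta> * real (tf r) ^ 2 \<and>
      (\<forall>(i, j)\<in>{1..tf r} \<times> {1..tf r} - Bad. \<exists>D. regular_colouring M \<eta> (A i) (A j) \<kappa> D)"
      using good p \<kappa> tT V tf[of r] \<eta>
      by (intro regularity_step[where p=p and r=r]) (auto simp: \<Phi>_def \<Omega>_def \<delta>_def)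
    then show "\<exists>t A Bad. t0 \<le> t \<and> 1 \<le> t \<and> t \<le> T \<and> equitable t A V \<and> Bad \<subseteq> {1..t} \<times> {1..t} \<and> real (card Bad) \<le> \<eta> * real t ^ 2 \<and>
      (\<forall>(i, j)\<in>{1..t} \<times> {1..t} - Bad. \<exists>D. regular_colouring M \<eta> (A i) (A j) \<kappa> D)"
      using tf[of r] tT by blast
  qed
qed

section \<open>Random choices of small deviation\<close>

text \<open>For negative \<open>x = - y\<close> the claim amounts to
  \<open>1 \<le> (1 - y + y\<^sup>2) * exp y\<close>. This follows from the quadratic Taylor bound,
  because the product of the two polynomials expands to 1 plus nonnegative terms.\<close>

lemma exp_le_quadratic:
  fixes x :: real
  assumes "\<bar>x\<bar> \<le> 1"
  shows "exp x \<le> 1 + x + x\<^sup>2"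
proof (cases "x \<ge> 0")
  case True
  then show ?thesis using assms exp_bound[of x] by auto
next
  case False
  define y where "y = - x"
  have y: "0 \<le> y" "y \<le> 1" using False assms by (auto simp: y_def)
  have l: "1 + y + y\<^sup>2 / 2 \<le> exp y" using exp_lower_Taylor_quadratic y by blast
  have nn: "0 \<le> 1 - y + y\<^sup>2" using y by auto
  have "(1 - y + y\<^sup>2) * (1 + y + y\<^sup>2 / 2) = 1 + y\<^sup>2 / 2 + y ^ 3 / 2 + y ^ 4 / 2"
    by (simp add: field_simps power2_eq_square power3_eq_cube power4_eq_xxxx)
  then have "1 \<le> (1 - y + y\<^sup>2) * (1 + y + y\<^sup>2 / 2)" using y by simp
  also have "\<dots> \<le> (1 - y + y\<^sup>2) * exp y" using l nn by (rule mult_left_mono)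
  finally have "exp (- y) \<le> 1 - y + y\<^sup>2" by (simp add: exp_minus inverse_eq_divide divide_le_eq)
  then show ?thesis by (simp add: y_def)
qed

text \<open>Chernoff bound and union bound with the probability space written out:
  \<open>W c\<close> is the weight of \<open>c\<close> under independent choices with distribution
  \<open>p e\<close>. If every \<open>c\<close> of positive weight violated some \<open>j\<close>,
  the weighted sum of the exponentials would be at least \<open>exp (s * D)\<close>, while the
  second moments bound it by \<open>card J * exp (s\<^sup>2 * card X)\<close>. Choices of weight 0
  do not enter, whence \<open>0 < p e (c e)\<close>; this later keeps different colours
  apart.\<close>

lemma ex_choice_small_deviation:
  fixes p :: "'e \<Rightarrow> 'c \<Rightarrow> real" and \<phi> :: "'j \<Rightarrow> 'e \<Rightarrow> 'c \<Rightarrow> real"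
  assumes fin: "finite X" "finite C" "finite J"
    and p0: "\<And>e \<alpha>. e \<in> X \<Longrightarrow> \<alpha> \<in> C \<Longrightarrow> 0 \<le> p e \<alpha>"
    and p1: "\<And>e. e \<in> X \<Longrightarrow> (\<Sum>\<alpha>\<in>C. p e \<alpha>) = 1"
    and \<phi>1: "\<And>j e \<alpha>. j \<in> J \<Longrightarrow> e \<in> X \<Longrightarrow> \<alpha> \<in> C \<Longrightarrow> \<bar>\<phi> j e \<alpha>\<bar> \<le> 1"
    and \<phi>0: "\<And>j e. j \<in> J \<Longrightarrow> e \<in> X \<Longrightarrow> (\<Sum>\<alpha>\<in>C. p e \<alpha> * \<phi> j e \<alpha>) = 0"
    and s: "0 \<le> s" "s \<le> 1"
    and small: "real (card J) * exp (s\<^sup>2 * real (card X)) < exp (s * D)"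
  shows "\<exists>c\<in>X \<rightarrow>\<^sub>E C. (\<forall>e\<in>X. 0 < p e (c e)) \<and> (\<forall>j\<in>J. (\<Sum>e\<in>X. \<phi> j e (c e)) \<le> D)"
proof (rule ccontr)
  assume neg: "\<not> ?thesis"
  define W where "W c = (\<Prod>e\<in>X. p e (c e))" for c
  let ?P = "X \<rightarrow>\<^sub>E C"
  have W0: "0 \<le> W c" if "c \<in> ?P" for c
    unfolding W_def using that p0 by (intro prod_nonneg) (auto simp: PiE_mem)
  have W1: "(\<Sum>c\<in>?P. W c) = 1"
    unfolding W_def using p1 by (simp add: prod_sum_PiE[symmetric] fin)
  have one: "(\<Sum>c\<in>?P. W c * exp (s * (\<Sum>e\<in>X. \<phi> j e (c e)))) \<le> exp (s\<^sup>2 * real (card X))" if j: "j \<in> J" for j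
  proof -
    have "(\<Sum>c\<in>?P. W c * exp (s * (\<Sum>e\<in>X. \<phi> j e (c e))))
        = (\<Sum>c\<in>?P. \<Prod>e\<in>X. p e (c e) * exp (s * \<phi> j e (c e)))"
      by (simp add: W_def prod.distrib exp_sum fin sum_distrib_left)
    also have "\<dots> = (\<Prod>e\<in>X. \<Sum>\<alpha>\<in>C. p e \<alpha> * exp (s * \<phi> j e \<alpha>))"
      by (simp add: prod_sum_PiE fin)
    also have "\<dots> \<le> (\<Prod>e\<in>X. exp (s\<^sup>2))"
    proof (rule prod_mono)
      fix e assume e: "e \<in> X"
      have "(\<Sum>\<alpha>\<in>C. p e \<alpha> * exp (s * \<phi> j e \<alpha>)) \<le> (\<Sum>\<alpha>\<in>C. p e \<alpha> + s * (p e \<alpha> * \<phi> j e \<alpha>) + s\<^sup>2 * p e \<alpha>)"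
      proof (rule sum_mono)
        fix \<alpha> assume \<alpha>: "\<alpha> \<in> C"
        have a: "\<bar>\<phi> j e \<alpha>\<bar> \<le> 1" by (rule \<phi>1[OF j e \<alpha>])
        have "\<bar>s * \<phi> j e \<alpha>\<bar> \<le> 1" unfolding abs_mult using s a by (intro mult_le_one) auto
        then have "exp (s * \<phi> j e \<alpha>) \<le> 1 + s * \<phi> j e \<alpha> + (s * \<phi> j e \<alpha>)\<^sup>2" by (rule exp_le_quadratic)
        also have "\<dots> \<le> 1 + s * \<phi> j e \<alpha> + s\<^sup>2"
          using a by (simp add: power_mult_distrib abs_square_le_1 mult_left_le)
        finally have "p e \<alpha> * exp (s * \<phi> j e \<alpha>) \<le> p e \<alpha> * (1 + s * \<phi> j e \<alpha> + s\<^sup>2)"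
          using p0[OF e \<alpha>] by (rule mult_left_mono)
        then show "p e \<alpha> * exp (s * \<phi> j e \<alpha>) \<le> p e \<alpha> + s * (p e \<alpha> * \<phi> j e \<alpha>) + s\<^sup>2 * p e \<alpha>"
          by (simp add: algebra_simps)
      qed
      also have "\<dots> = 1 + s\<^sup>2"
        by (simp add: sum.distrib sum_distrib_left[symmetric] p1[OF e] \<phi>0[OF j e])
      also have "\<dots> \<le> exp (s\<^sup>2)" by (rule exp_ge_add_one_self)
      finally show "0 \<le> (\<Sum>\<alpha>\<in>C. p e \<alpha> * exp (s * \<phi> j e \<alpha>)) \<and> (\<Sum>\<alpha>\<in>C. p e \<alpha> * exp (s * \<phi> j e \<alpha>)) \<le> exp (s\<^sup>2)"
        using p0[OF e] by (auto intro!: sum_nonneg)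
    qed
    also have "\<dots> = exp (s\<^sup>2 * real (card X))" by (simp add: exp_of_nat_mult[symmetric] mult.commute)
    finally show ?thesis .
  qed
  have "exp (s * D) = (\<Sum>c\<in>?P. W c * exp (s * D))" by (simp add: sum_distrib_right[symmetric] W1)
  also have "\<dots> \<le> (\<Sum>c\<in>?P. W c * (\<Sum>j\<in>J. exp (s * (\<Sum>e\<in>X. \<phi> j e (c e)))))"
  proof (rule sum_mono)
    fix c assume c: "c \<in> ?P"
    show "W c * exp (s * D) \<le> W c * (\<Sum>j\<in>J. exp (s * (\<Sum>e\<in>X. \<phi> j e (c e))))"
    proof (cases "\<forall>e\<in>X. 0 < p e (c e)")
      case True
      then obtain j where j: "j \<in> J" "D < (\<Sum>e\<in>X. \<phi> j e (c e))" using neg c by (meson not_le)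
      then have "exp (s * D) \<le> exp (s * (\<Sum>e\<in>X. \<phi> j e (c e)))" using s by (auto intro: mult_left_mono)
      also have "\<dots> \<le> (\<Sum>j\<in>J. exp (s * (\<Sum>e\<in>X. \<phi> j e (c e))))"
        using j fin by (intro member_le_sum) auto
      finally show ?thesis using W0[OF c] by (rule mult_left_mono)
    next
      case False
      then obtain e where "e \<in> X" "p e (c e) = 0" using p0 c by (metis PiE_mem less_eq_real_def)
      then have "W c = 0" using fin by (auto simp: W_def)
      then show ?thesis by simp
    qed
  qed
  also have "\<dots> = (\<Sum>j\<in>J. \<Sum>c\<in>?P. W c * exp (s * (\<Sum>e\<in>X. \<phi> j e (c e))))"
    by (simp add: sum_distrib_left) (rule sum.swap)
  also have "\<dots> \<le> (\<Sum>j\<in>J. exp (s\<^sup>2 * real (card X)))" by (intro sum_mono one)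
  also have "\<dots> < exp (s * D)" using small by simp
  finally show False by simp
qed

text \<open>Both signs are handled by doubling \<open>J\<close>. The choice
  \<open>s = \<delta> / 2\<close> maximises \<open>s * \<delta> - s\<^sup>2\<close>, whose maximum
  is \<open>\<delta>\<^sup>2 / 4\<close>.\<close>

corollary ex_choice_small_abs_deviation:
  fixes p :: "'e \<Rightarrow> 'c \<Rightarrow> real" and \<phi> :: "'j \<Rightarrow> 'e \<Rightarrow> 'c \<Rightarrow> real"
  assumes fin: "finite X" "finite C" "finite J"
    and p0: "\<And>e \<alpha>. e \<in> X \<Longrightarrow> \<alpha> \<in> C \<Longrightarrow> 0 \<le> p e \<alpha>"
    and p1: "\<And>e. e \<in> X \<Longrightarrow> (\<Sum>\<alpha>\<in>C. p e \<alpha>) = 1"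
    and \<phi>1: "\<And>j e \<alpha>. j \<in> J \<Longrightarrow> e \<in> X \<Longrightarrow> \<alpha> \<in> C \<Longrightarrow> \<bar>\<phi> j e \<alpha>\<bar> \<le> 1"
    and \<phi>0: "\<And>j e. j \<in> J \<Longrightarrow> e \<in> X \<Longrightarrow> (\<Sum>\<alpha>\<in>C. p e \<alpha> * \<phi> j e \<alpha>) = 0"
    and \<delta>: "0 \<le> \<delta>" "\<delta> \<le> 1"
    and small: "2 * real (card J) < exp (\<delta>\<^sup>2 * real (card X) / 4)"
  shows "\<exists>c\<in>X \<rightarrow>\<^sub>E C. (\<forall>e\<in>X. 0 < p e (c e)) \<and> (\<forall>j\<in>J. \<bar>\<Sum>e\<in>X. \<phi> j e (c e)\<bar> \<le> \<delta> * real (card X))"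
proof -
  define \<psi> where "\<psi> = (\<lambda>(j, \<sigma>) e \<alpha>. if \<sigma> then \<phi> j e \<alpha> else - \<phi> j e \<alpha>)"
  let ?s = "\<delta> / 2" and ?J = "J \<times> (UNIV :: bool set)" and ?D = "\<delta> * real (card X)"
  have eq: "?s * ?D = \<delta>\<^sup>2 * real (card X) / 4 + ?s\<^sup>2 * real (card X)"
    by (simp add: power2_eq_square algebra_simps)
  have "real (card ?J) * exp (?s\<^sup>2 * real (card X)) < exp (?s * ?D)"
    unfolding eq exp_add using small
    by (intro mult_strict_right_mono) (auto simp: card_cartesian_product)
  moreover have "(\<Sum>\<alpha>\<in>C. p e \<alpha> * \<psi> (j, b) e \<alpha>) = 0" if "j \<in> J" "e \<in> X" for j b e
    using \<phi>0[OF that] by (cases b) (simp_all add: \<psi>_def sum_negf)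
  ultimately have "\<exists>c\<in>X \<rightarrow>\<^sub>E C. (\<forall>e\<in>X. 0 < p e (c e)) \<and> (\<forall>j\<in>?J. (\<Sum>e\<in>X. \<psi> j e (c e)) \<le> ?D)"
    using fin p0 p1 \<phi>1 \<delta>
    by (intro ex_choice_small_deviation[where s="?s"]) (auto simp: \<psi>_def)
  then obtain c where c: "c \<in> X \<rightarrow>\<^sub>E C" "\<forall>e\<in>X. 0 < p e (c e)"
    and le: "\<And>j \<sigma>. j \<in> J \<Longrightarrow> (\<Sum>e\<in>X. \<psi> (j, \<sigma>) e (c e)) \<le> ?D" by auto
  have "\<bar>\<Sum>e\<in>X. \<phi> j e (c e)\<bar> \<le> ?D" if "j \<in> J" for j
    using le[OF that, of True] le[OF that, of False] by (simp add: \<psi>_def sum_negf abs_le_iff)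
  then show ?thesis using c by blast
qed

section \<open>Splitting edge colourings into classes of equal density\<close>

text \<open>The unit interval is cut into consecutive intervals of lengths \<open>D c\<close>, and
  again into \<open>l\<close> intervals of length \<open>1 / l\<close>; \<open>q\<close> records the
  overlaps. An interval of the second kind that meets two colours has an endpoint
  \<open>s (Suc c)\<close> in its interior, and each endpoint is interior to at most one of them.
  Hence the number of mixed labels is bounded independently of \<open>l\<close>.\<close>

lemma ex_transport_matrix:
  fixes D :: "nat \<Rightarrow> real"
  assumes D0: "\<forall>c<M. 0 \<le> D c" and D1: "(\<Sum>c<M. D c) = 1" and l: "1 \<le> l"
  shows "\<exists>q. (\<forall>c<M. \<forall>\<alpha>\<in>{1..l}. 0 \<le> q c \<alpha>) \<and> (\<forall>c<M. (\<Sum>\<alpha>\<in>{1..l}. q c \<alpha>) = D c) \<and>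
    (\<forall>\<alpha>\<in>{1..l}. (\<Sum>c<M. q c \<alpha>) = 1 / real l) \<and>
    card {\<alpha> \<in> {1..l}. \<exists>c<M. \<exists>c'<M. c \<noteq> c' \<and> 0 < q c \<alpha> \<and> 0 < q c' \<alpha>} \<le> M"
proof -
  define s where "s c = (\<Sum>c'<c. D c')" for c
  define w where "w = 1 / real l"
  have w: "w > 0" "real l * w = 1" using l by (auto simp: w_def)
  \<comment> \<open>For \<open>x \<ge> 0\<close> this is the length of the part of the
    \<open>\<alpha>\<close>-th interval to the left of \<open>x\<close>; sums over
    \<open>\<alpha>\<close> and over \<open>c\<close> then collapse.\<close>
  define \<phi> where "\<phi> \<alpha> x = max 0 (min w (x - (real \<alpha> - 1) * w))" for \<alpha> x
  \<comment> \<open>the length of the intersection of \<open>[s c, s (c + 1)]\<close> with \<open>[(\<alpha> - 1) w, \<alpha> w]\<close>\<close>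
  define q where "q c \<alpha> = \<phi> \<alpha> (s (Suc c)) - \<phi> \<alpha> (s c)" for c \<alpha>
  have s0: "s 0 = 0" "s M = 1" by (simp_all add: s_def D1)
  have s_mono: "s c \<le> s c'" if "c \<le> c'" "c' \<le> M" for c c'
    unfolding s_def using that D0 by (intro sum_mono2) auto
  have s01: "0 \<le> s c" "s c \<le> 1" if "c \<le> M" for c using s_mono[of 0 c] s_mono[of c M] s0 that by auto
  have sum\<phi>: "(\<Sum>\<alpha>\<in>{1..m}. \<phi> \<alpha> x) = min x (real m * w)" if "0 \<le> x" for x m
  proof (induction m)
    case 0 then show ?case using that by simp
  next
    case (Suc m)
    have "min x (real m * w) + max 0 (min w (x - real m * w)) = min x (real m * w + w)"
      using w by (auto simp: min_def max_def)
    then show ?case using Suc by (simp add: \<phi>_def algebra_simps)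
  qed
  have q0: "0 \<le> q c \<alpha>" if "c < M" for c \<alpha>
    using s_mono[of c "Suc c"] that by (auto simp: q_def \<phi>_def max_def min_def)
  have rows: "(\<Sum>\<alpha>\<in>{1..l}. q c \<alpha>) = D c" if "c < M" for c
  proof -
    have "(\<Sum>\<alpha>\<in>{1..l}. q c \<alpha>) = min (s (Suc c)) 1 - min (s c) 1"
      unfolding q_def using s01[of c] s01[of "Suc c"] that sum\<phi>[of "s c" l] sum\<phi>[of "s (Suc c)" l]
      by (simp add: sum_subtractf w)
    then show ?thesis using s01[of c] s01[of "Suc c"] that by (simp add: s_def)
  qed
  have cols: "(\<Sum>c<M. q c \<alpha>) = w" if "\<alpha> \<in> {1..l}" for \<alpha>
  proof -
    have "(\<Sum>c<M. q c \<alpha>) = \<phi> \<alpha> (s M) - \<phi> \<alpha> (s 0)" unfolding q_def by (rule sum_lessThan_telescope)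
    moreover have "\<phi> \<alpha> 0 = 0"
    proof -
      have "0 \<le> (real \<alpha> - 1) * w" using that w by (intro mult_nonneg_nonneg) auto
      then show ?thesis by (simp add: \<phi>_def)
    qed
    moreover have "\<phi> \<alpha> 1 = w"
    proof -
      have "real \<alpha> * w \<le> real l * w" using that w(1) by (intro mult_right_mono) auto
      then have "w \<le> 1 - (real \<alpha> - 1) * w" unfolding w(2) by (simp add: algebra_simps)
      then show ?thesis using w by (simp add: \<phi>_def)
    qed
    ultimately show ?thesis by (simp add: s0)
  qed
  have qpos: "s c < real \<alpha> * w" "(real \<alpha> - 1) * w < s (Suc c)" if "c < M" "0 < q c \<alpha>" for c \<alpha>
    using that s_mono[of c "Suc c"] w
    by (auto simp: q_def \<phi>_def max_def min_def algebra_simps split: if_splits)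
  define X where "X = {\<alpha> \<in> {1..l}. \<exists>c<M. \<exists>c'<M. c \<noteq> c' \<and> 0 < q c \<alpha> \<and> 0 < q c' \<alpha>}"
  have "\<exists>c<M. (real \<alpha> - 1) * w < s (Suc c) \<and> s (Suc c) < real \<alpha> * w" if "\<alpha> \<in> X" for \<alpha>
  proof -
    obtain c c' where c: "c < M" "c' < M" "c < c'" "0 < q c \<alpha>" "0 < q c' \<alpha>"
      using \<open>\<alpha> \<in> X\<close> unfolding X_def by (smt (verit) linorder_neqE_nat mem_Collect_eq)
    then have "s (Suc c) \<le> s c'" by (intro s_mono) auto
    then show ?thesis using qpos[of c \<alpha>] qpos[of c' \<alpha>] c by (intro exI[of _ c]) auto
  qed
  then obtain F where F: "\<And>\<alpha>. \<alpha> \<in> X \<Longrightarrow> F \<alpha> < M \<and> (real \<alpha> - 1) * w < s (Suc (F \<alpha>)) \<and> s (Suc (F \<alpha>)) < real \<alpha> * w"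
    by metis
  have "inj_on F X"
  proof (rule inj_onI)
    fix \<alpha> \<beta> assume ab: "\<alpha> \<in> X" "\<beta> \<in> X" "F \<alpha> = F \<beta>"
    have "(real \<alpha> - 1) * w < real \<beta> * w" "(real \<beta> - 1) * w < real \<alpha> * w"
      using F[OF ab(1)] F[OF ab(2)] ab(3) by auto
    then have "real \<alpha> - 1 < real \<beta>" "real \<beta> - 1 < real \<alpha>" using w by (auto simp: mult_less_cancel_right)
    then show "\<alpha> = \<beta>" by linarith
  qed
  then have "card X \<le> card {..<M}" using F by (intro card_inj_on_le[of F]) auto
  then show ?thesis using q0 rows cols unfolding X_def w_def by (intro exI[of _ q]) auto
qed

text \<open>A pair of colour \<open>c\<close> independently receives the label
  \<open>\<alpha>\<close> with probability \<open>q c \<alpha> / D c\<close>, so every label has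
  expected density about \<open>1 / l\<close>. Half of \<open>\<epsilon>\<close> pays for the errors
  \<open>\<eta>\<close> of the \<open>M\<close> colours, the other half for the random deviation,
  uniformly over all \<open>U'\<close>, \<open>W'\<close> and labels.\<close>

lemma ex_split_colouring:
  fixes \<kappa> :: "'a \<times> 'a \<Rightarrow> nat"
  assumes fin: "finite U" "finite W" and reg: "regular_colouring M \<eta> U W \<kappa> D" and \<kappa>: "\<And>b. \<kappa> b < M"
    and l: "1 \<le> l" and \<epsilon>: "0 < \<epsilon>" "\<epsilon> \<le> 1" "real M * \<eta> \<le> \<epsilon> / 2"
    and large: "2 * real l * 2 ^ (card U + card W) < exp ((\<epsilon> / 2)\<^sup>2 * (real (card U) * real (card W)) / 4)"
  shows "\<exists>\<psi> Mix. (\<forall>b\<in>U \<times> W. \<psi> b \<in> {1..l}) \<and>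
    (\<forall>\<alpha>\<in>{1..l}. \<forall>U' W'. U' \<subseteq> U \<and> W' \<subseteq> W \<longrightarrow>
        \<bar>real (card {b \<in> U' \<times> W'. \<psi> b = \<alpha>}) - 1 / real l * real (card U') * real (card W')\<bar>
          \<le> \<epsilon> * real (card U) * real (card W)) \<and>
    Mix \<subseteq> {1..l} \<and> card Mix \<le> M + 1 \<and> (\<forall>\<alpha>\<in>{1..l} - Mix. \<exists>c. \<forall>b\<in>U \<times> W. \<psi> b = \<alpha> \<longrightarrow> \<kappa> b = c)"
proof -
  have D0: "\<And>c. c < M \<Longrightarrow> 0 \<le> D c" and D1: "(\<Sum>c<M. D c) = 1"
    and disc: "\<And>c U' W'. c < M \<Longrightarrow> U' \<subseteq> U \<Longrightarrow> W' \<subseteq> W \<Longrightarrow>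
        \<bar>real (card {b \<in> U' \<times> W'. \<kappa> b = c}) - D c * real (card U') * real (card W')\<bar>
          \<le> \<eta> * real (card U) * real (card W)"
    using reg by (auto simp: regular_colouring_def)
  obtain q where q: "(\<forall>c<M. \<forall>\<alpha>\<in>{1..l}. 0 \<le> q c \<alpha>) \<and> (\<forall>c<M. (\<Sum>\<alpha>\<in>{1..l}. q c \<alpha>) = D c) \<and>
    (\<forall>\<alpha>\<in>{1..l}. (\<Sum>c<M. q c \<alpha>) = 1 / real l) \<and>
    card {\<alpha> \<in> {1..l}. \<exists>c<M. \<exists>c'<M. c \<noteq> c' \<and> 0 < q c \<alpha> \<and> 0 < q c' \<alpha>} \<le> M"
    using ex_transport_matrix[of M D l, OF _ D1 l] reg unfolding regular_colouring_def by blast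
  have q0: "0 \<le> q c \<alpha>" if "c < M" "\<alpha> \<in> {1..l}" for c \<alpha> using q that by blast
  have rows: "(\<Sum>\<alpha>\<in>{1..l}. q c \<alpha>) = D c" if "c < M" for c using q that by blast
  have cols: "(\<Sum>c<M. q c \<alpha>) = 1 / real l" if "\<alpha> \<in> {1..l}" for \<alpha> using q that by blast
  have mix: "card {\<alpha> \<in> {1..l}. \<exists>c<M. \<exists>c'<M. c \<noteq> c' \<and> 0 < q c \<alpha> \<and> 0 < q c' \<alpha>} \<le> M"
    using q by blast
  have q_le: "q c \<alpha> \<le> D c" if "c < M" "\<alpha> \<in> {1..l}" for c \<alpha>
    unfolding rows[OF that(1), symmetric] using that q0 by (intro member_le_sum) auto
  \<comment> \<open>A colour with \<open>D c = 0\<close> may still occur on a few pairs, as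
    \<open>D\<close> need not be the density between \<open>U\<close> and \<open>W\<close>. Such
    pairs are sent to label 1, which is therefore counted in \<open>Mix\<close> and turns the bound
    \<open>M\<close> into \<open>M + 1\<close>.\<close>
  define p where "p c \<alpha> = (if D c = 0 then of_bool (\<alpha> = 1) else q c \<alpha> / D c)" for c \<alpha>
  have p0: "0 \<le> p c \<alpha>" and p_le: "p c \<alpha> \<le> 1" if "c < M" "\<alpha> \<in> {1..l}" for c \<alpha>
    using q0[OF that] q_le[OF that] D0[OF that(1)] by (auto simp: p_def divide_le_eq_1)
  have p1: "(\<Sum>\<alpha>\<in>{1..l}. p c \<alpha>) = 1" if "c < M" for c
  proof (cases "D c = 0")
    case True
    then show ?thesis using l by (simp add: p_def of_bool_def)
  next
    case False
    then show ?thesis using rows[OF that] by (simp add: p_def sum_divide_distrib[symmetric])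
  qed
  have pD: "p c \<alpha> * D c = q c \<alpha>" if "c < M" "\<alpha> \<in> {1..l}" for c \<alpha>
    using q0[OF that] q_le[OF that] by (auto simp: p_def)
  define \<phi> where "\<phi> = (\<lambda>(U', W', \<alpha>') b \<alpha>. of_bool (b \<in> U' \<times> W') * (of_bool (\<alpha> = \<alpha>') - p (\<kappa> b) \<alpha>'))"
  let ?X = "U \<times> W" and ?J = "Pow U \<times> Pow W \<times> {1..l}"
  have "\<exists>\<psi>\<in>?X \<rightarrow>\<^sub>E {1..l}. (\<forall>b\<in>?X. 0 < p (\<kappa> b) (\<psi> b)) \<and> (\<forall>j\<in>?J. \<bar>\<Sum>b\<in>?X. \<phi> j b (\<psi> b)\<bar> \<le> \<epsilon> / 2 * real (card ?X))"
  proof (rule ex_choice_small_abs_deviation)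
    show "\<bar>\<phi> j e \<alpha>\<bar> \<le> 1" if "j \<in> ?J" "e \<in> ?X" "\<alpha> \<in> {1..l}" for j e \<alpha>
    proof -
      obtain U' W' \<alpha>' where j: "j = (U', W', \<alpha>')" by (cases j)
      have "0 \<le> p (\<kappa> e) \<alpha>'" "p (\<kappa> e) \<alpha>' \<le> 1" using that \<kappa> p0 p_le by (auto simp: j)
      then show ?thesis by (auto simp: \<phi>_def j)
    qed
    show "(\<Sum>\<alpha>\<in>{1..l}. p (\<kappa> e) \<alpha> * \<phi> j e \<alpha>) = 0" if "j \<in> ?J" "e \<in> ?X" for j e
    proof -
      obtain U' W' \<alpha>' where j: "j = (U', W', \<alpha>')" by (cases j)
      have a: "\<alpha>' \<in> {1..l}" using that by (simp add: j)
      have "(\<Sum>\<alpha>\<in>{1..l}. p (\<kappa> e) \<alpha> * \<phi> j e \<alpha>) = of_bool (e \<in> U' \<times> W') *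
         ((\<Sum>\<alpha>\<in>{1..l}. p (\<kappa> e) \<alpha> * of_bool (\<alpha> = \<alpha>')) - (\<Sum>\<alpha>\<in>{1..l}. p (\<kappa> e) \<alpha>) * p (\<kappa> e) \<alpha>')"
        unfolding \<phi>_def j prod.case sum_distrib_right sum_subtractf[symmetric] sum_distrib_left
        by (rule sum.cong) (auto simp: algebra_simps)
      also have "(\<Sum>\<alpha>\<in>{1..l}. p (\<kappa> e) \<alpha> * of_bool (\<alpha> = \<alpha>')) = p (\<kappa> e) \<alpha>'"
        using a by (simp add: of_bool_def if_distrib cong: if_cong)
      finally show ?thesis unfolding p1[OF \<kappa>] by simp
    qed
    show "2 * real (card ?J) < exp ((\<epsilon> / 2)\<^sup>2 * real (card ?X) / 4)"
      using large fin by (simp add: card_cartesian_product card_Pow power_add mult_ac)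
    show "0 \<le> p (\<kappa> b) \<alpha>" if "\<alpha> \<in> {1..l}" for b \<alpha> using p0[OF \<kappa> that] .
    show "(\<Sum>\<alpha>\<in>{1..l}. p (\<kappa> b) \<alpha>) = 1" for b using p1[OF \<kappa>] .
  qed (use fin \<epsilon> in simp_all)
  then obtain \<psi> where \<psi>1: "\<psi> \<in> ?X \<rightarrow>\<^sub>E {1..l}"
    and \<psi>2: "(\<forall>b\<in>?X. 0 < p (\<kappa> b) (\<psi> b)) \<and> (\<forall>j\<in>?J. \<bar>\<Sum>b\<in>?X. \<phi> j b (\<psi> b)\<bar> \<le> \<epsilon> / 2 * real (card ?X))"
    by (elim bexE)
  note \<psi> = \<psi>1 conjunct1[OF \<psi>2, rule_format]
  note dev = conjunct2[OF \<psi>2, rule_format]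
  define Mix where "Mix = insert 1 {\<alpha> \<in> {1..l}. \<exists>c<M. \<exists>c'<M. c \<noteq> c' \<and> 0 < q c \<alpha> \<and> 0 < q c' \<alpha>}"
  have "Mix \<subseteq> {1..l}" using l by (auto simp: Mix_def)
  moreover have "card Mix \<le> M + 1" unfolding Mix_def using mix by (intro order_trans[OF card_insert_le_m1]) auto
  moreover have "\<exists>c. \<forall>b\<in>U \<times> W. \<psi> b = \<alpha> \<longrightarrow> \<kappa> b = c" if "\<alpha> \<in> {1..l} - Mix" for \<alpha>
  proof -
    have "0 < q (\<kappa> b) \<alpha>" if "b \<in> U \<times> W" "\<psi> b = \<alpha>" for b
    proof -
      have "\<alpha> \<noteq> 1" using \<open>\<alpha> \<in> {1..l} - Mix\<close> by (auto simp: Mix_def)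
      then have "D (\<kappa> b) \<noteq> 0" "0 < q (\<kappa> b) \<alpha> / D (\<kappa> b)"
        using \<psi>(2)[OF that(1)] that(2) by (auto simp: p_def split: if_splits)
      then show ?thesis using D0[OF \<kappa>, of b] by (simp add: zero_less_divide_iff)
    qed
    moreover have "c = c'" if "c < M" "c' < M" "0 < q c \<alpha>" "0 < q c' \<alpha>" for c c'
      using that \<open>\<alpha> \<in> {1..l} - Mix\<close> by (auto simp: Mix_def)
    ultimately show ?thesis using \<kappa> by metis
  qed
  moreover have "\<bar>real (card {b \<in> U' \<times> W'. \<psi> b = \<alpha>}) - 1 / real l * real (card U') * real (card W')\<bar>
          \<le> \<epsilon> * real (card U) * real (card W)" if \<alpha>: "\<alpha> \<in> {1..l}" and sub: "U' \<subseteq> U" "W' \<subseteq> W" for \<alpha> U' W'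
  proof -
    have finUW: "finite (U' \<times> W')" using sub fin finite_subset by blast
    have "(\<Sum>b\<in>?X. \<phi> (U', W', \<alpha>) b (\<psi> b)) = (\<Sum>b\<in>?X. if b \<in> U' \<times> W' then of_bool (\<psi> b = \<alpha>) - p (\<kappa> b) \<alpha> else 0)"
      by (rule sum.cong) (auto simp: \<phi>_def)
    also have "\<dots> = (\<Sum>b\<in>?X \<inter> U' \<times> W'. of_bool (\<psi> b = \<alpha>) - p (\<kappa> b) \<alpha>)"
      using fin by (intro sum.inter_restrict[symmetric]) auto
    also have "?X \<inter> U' \<times> W' = U' \<times> W'" using sub by auto
    also have "(\<Sum>b\<in>U' \<times> W'. of_bool (\<psi> b = \<alpha>) - p (\<kappa> b) \<alpha>) = real (card {b \<in> U' \<times> W'. \<psi> b = \<alpha>}) - (\<Sum>b\<in>U' \<times> W'. p (\<kappa> b) \<alpha>)"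
      using finUW by (simp add: sum_subtractf Int_def)
    finally have 1: "\<bar>real (card {b \<in> U' \<times> W'. \<psi> b = \<alpha>}) - (\<Sum>b\<in>U' \<times> W'. p (\<kappa> b) \<alpha>)\<bar> \<le> \<epsilon> / 2 * (real (card U) * real (card W))"
      using dev[of "(U', W', \<alpha>)"] \<alpha> sub by (simp add: card_cartesian_product)
    have "(\<Sum>b\<in>U' \<times> W'. p (\<kappa> b) \<alpha>) = (\<Sum>c<M. \<Sum>b\<in>{b \<in> U' \<times> W'. \<kappa> b = c}. p (\<kappa> b) \<alpha>)"
      using \<kappa> finUW by (intro sum.group[symmetric]) auto
    also have "\<dots> = (\<Sum>c<M. p c \<alpha> * real (card {b \<in> U' \<times> W'. \<kappa> b = c}))"
      by (rule sum.cong) (auto simp: mult.commute)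
    finally have 2: "(\<Sum>b\<in>U' \<times> W'. p (\<kappa> b) \<alpha>) = (\<Sum>c<M. p c \<alpha> * real (card {b \<in> U' \<times> W'. \<kappa> b = c}))" .
    have 3: "(\<Sum>c<M. p c \<alpha> * (D c * real (card U') * real (card W'))) = 1 / real l * real (card U') * real (card W')"
      unfolding cols[OF \<alpha>, symmetric] sum_distrib_right
      by (rule sum.cong) (auto simp: pD[OF _ \<alpha>] mult.assoc[symmetric])
    have "\<bar>(\<Sum>b\<in>U' \<times> W'. p (\<kappa> b) \<alpha>) - 1 / real l * real (card U') * real (card W')\<bar>
      = \<bar>\<Sum>c<M. p c \<alpha> * (real (card {b \<in> U' \<times> W'. \<kappa> b = c}) - D c * real (card U') * real (card W'))\<bar>"
      unfolding 2 3[symmetric] by (simp add: sum_subtractf right_diff_distrib)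
    also have "\<dots> \<le> (\<Sum>c<M. \<eta> * real (card U) * real (card W))"
    proof (intro order_trans[OF sum_abs] sum_mono)
      fix c assume c: "c \<in> {..<M}"
      let ?d = "\<bar>real (card {b \<in> U' \<times> W'. \<kappa> b = c}) - D c * real (card U') * real (card W')\<bar>"
      have "\<bar>p c \<alpha> * (real (card {b \<in> U' \<times> W'. \<kappa> b = c}) - D c * real (card U') * real (card W'))\<bar> = p c \<alpha> * ?d"
        using p0[of c \<alpha>] c \<alpha> by (simp add: abs_mult)
      also have "\<dots> \<le> 1 * ?d" using p_le[of c \<alpha>] c \<alpha> by (intro mult_right_mono) auto
      also have "\<dots> \<le> \<eta> * real (card U) * real (card W)" using disc[of c U' W'] c sub by simp
      finally show "\<bar>p c \<alpha> * (real (card {b \<in> U' \<times> W'. \<kappa> b = c}) - D c * real (card U') * real (card W'))\<bar>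
        \<le> \<eta> * real (card U) * real (card W)" .
    qed
    also have "\<dots> = real M * \<eta> * (real (card U) * real (card W))" by simp
    also have "\<dots> \<le> \<epsilon> / 2 * (real (card U) * real (card W))" using \<epsilon> by (intro mult_right_mono) auto
    finally have "\<bar>(\<Sum>b\<in>U' \<times> W'. p (\<kappa> b) \<alpha>) - 1 / real l * real (card U') * real (card W')\<bar>
      \<le> \<epsilon> / 2 * (real (card U) * real (card W))" .
    with 1 show ?thesis unfolding mult.assoc[of \<epsilon>] by linarith
  qed
  moreover have "\<forall>b\<in>U \<times> W. \<psi> b \<in> {1..l}" using \<psi>(1) by auto
  ultimately show ?thesis by blast
qed

text \<open>The number of pairs of subsets is exponential in \<open>u + w\<close>, the gain is
  exponential in \<open>u * w\<close>. From \<open>64 / \<epsilon>\<^sup>2\<close> on, the exponent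
  on the right is at least \<open>2 * (u + w)\<close>; one half of this beats
  \<open>2 ^ (u + w)\<close>, the other half beats \<open>2 * l\<close>.\<close>

lemma ex_exp_product_gt:
  fixes \<epsilon> :: real
  assumes "0 < \<epsilon>"
  shows "\<exists>n0. \<forall>u\<ge>n0. \<forall>w\<ge>n0. 2 * real l * 2 ^ (u + w) < exp ((\<epsilon> / 2)\<^sup>2 * (real u * real w) / 4)"
proof (rule exI[of _ "max (l + 1) (nat \<lceil>64 / \<epsilon>\<^sup>2\<rceil>)"], intro allI impI)
  fix u w :: nat
  let ?n = "max (l + 1) (nat \<lceil>64 / \<epsilon>\<^sup>2\<rceil>)"
  assume u: "?n \<le> u" and w: "?n \<le> w"
  have "64 / \<epsilon>\<^sup>2 \<le> real u" "64 / \<epsilon>\<^sup>2 \<le> real w" using u w by linarith+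
  then have e: "64 \<le> \<epsilon>\<^sup>2 * real u" "64 \<le> \<epsilon>\<^sup>2 * real w" using assms by (auto simp: divide_le_eq mult.commute)
  have "64 * real w \<le> \<epsilon>\<^sup>2 * real u * real w" "64 * real u \<le> \<epsilon>\<^sup>2 * real w * real u"
    using e by (auto intro: mult_right_mono)
  then have "2 * (real u + real w) \<le> (\<epsilon> / 2)\<^sup>2 * (real u * real w) / 4" by (simp add: power2_eq_square mult_ac)
  then have le: "exp (2 * (real u + real w)) \<le> exp ((\<epsilon> / 2)\<^sup>2 * (real u * real w) / 4)" by simp
  have a: "2 * real l < exp (real u + real w)"
  proof -
    have "real l + 1 \<le> real u" "real l + 1 \<le> real w" using u w by linarith+
    then show ?thesis using exp_ge_add_one_self[of "real u + real w"] by linarith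
  qed
  have b: "2 ^ (u + w) \<le> exp (real u + real w)"
  proof -
    have "(2::real) ^ (u + w) \<le> exp 1 ^ (u + w)" using exp_ge_add_one_self[of 1] by (intro power_mono) auto
    also have "\<dots> = exp (real u + real w)" by (simp add: exp_of_nat_mult[symmetric])
    finally show ?thesis .
  qed
  have "2 * real l * 2 ^ (u + w) < exp (real u + real w) * exp (real u + real w)"
    using a b by (intro mult_less_le_imp_less) auto
  also have "\<dots> = exp (2 * (real u + real w))" by (simp add: exp_add[symmetric])
  finally show "2 * real l * 2 ^ (u + w) < exp ((\<epsilon> / 2)\<^sup>2 * (real u * real w) / 4)"
    using le by (rule less_le_trans)
qed

section \<open>Discrepancy, triangles and triads\<close>

lemma card_doubletons:
  assumes "U \<inter> W = {}"
  shows "card {{x, y} | x y. x \<in> U \<and> y \<in> W \<and> Q (x, y)} = card {b \<in> U \<times> W. Q b}"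
proof -
  have "{{x, y} | x y. x \<in> U \<and> y \<in> W \<and> Q (x, y)} = (\<lambda>(x, y). {x, y}) ` {b \<in> U \<times> W. Q b}" by auto
  moreover have "inj_on (\<lambda>(x, y). {x, y}) {b \<in> U \<times> W. Q b}"
    using assms by (auto simp: inj_on_def doubleton_eq_iff)
  ultimately show ?thesis by (simp add: card_image)
qed

text \<open>\<open>disc2\<close> compares with the actual density of \<open>E\<close>, the
  hypothesis with a prescribed \<open>d\<close>. The case \<open>U' = U\<close>,
  \<open>W' = W\<close> shows that changing the density costs another \<open>\<epsilon> / 2\<close>,
  which is why the hypothesis has half the error.\<close>

lemma disc2_densityI:
  assumes fin: "finite U" "finite W" and disj: "U \<inter> W = {}"
    and E: "E = {{x, y} | x y. x \<in> U \<and> y \<in> W \<and> Q (x, y)}"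
    and disc: "\<And>U' W'. U' \<subseteq> U \<Longrightarrow> W' \<subseteq> W \<Longrightarrow>
      \<bar>real (card {b \<in> U' \<times> W'. Q b}) - d * real (card U') * real (card W')\<bar>
        \<le> \<epsilon> / 2 * real (card U) * real (card W)"
    and \<epsilon>: "0 < \<epsilon>"
  shows "disc2_density \<epsilon> d U W E"
proof -
  define uw where "uw = real (card U) * real (card W)"
  have uw: "uw \<ge> 0" by (simp add: uw_def)
  have cnt: "real (card (E \<inter> K2 U' W')) = real (card {b \<in> U' \<times> W'. Q b})" if "U' \<subseteq> U" "W' \<subseteq> W" for U' W'
  proof -
    have "E \<inter> K2 U' W' = {{x, y} | x y. x \<in> U' \<and> y \<in> W' \<and> Q (x, y)}"
      using that disj unfolding E K2_def by (auto simp: doubleton_eq_iff) blast+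
    moreover have "U' \<inter> W' = {}" using that disj by blast
    ultimately show ?thesis using card_doubletons[of U' W' Q] by simp
  qed
  have EK: "E \<subseteq> K2 U W" using disj unfolding E K2_def by blast
  then have cE: "real (card E) = real (card {b \<in> U \<times> W. Q b})"
    using cnt[of U W] by (simp add: Int_absorb2)
  have dE: "\<bar>real (card E) - d * uw\<bar> \<le> \<epsilon> / 2 * uw" using disc[of U W] cE by (simp add: uw_def mult.assoc)
  define d' where "d' = real (card E) / uw"
  have "\<bar>real (card (E \<inter> K2 U' W')) - d' * real (card U') * real (card W')\<bar> \<le> \<epsilon> * uw"
    if sub: "U' \<subseteq> U" "W' \<subseteq> W" for U' W'
  proof (cases "uw = 0")
    case True
    then have "U' = {} \<or> W' = {}" using sub fin by (auto simp: uw_def)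
    then show ?thesis unfolding cnt[OF sub] using True by auto
  next
    case False
    define r where "r = real (card U') * real (card W')"
    have r: "0 \<le> r" "r \<le> uw" unfolding r_def uw_def using sub fin
      by (auto intro!: mult_mono card_mono)
    have "\<bar>d * r - d' * r\<bar> = \<bar>d - d'\<bar> * r" using r by (simp add: abs_mult left_diff_distrib[symmetric])
    also have "\<dots> \<le> \<bar>d - d'\<bar> * uw" using r by (intro mult_left_mono) auto
    also have "\<dots> = \<bar>(d - d') * uw\<bar>" using uw by (simp add: abs_mult)
    also have "(d - d') * uw = - (real (card E) - d * uw)"
      using False by (simp add: d'_def left_diff_distrib)
    also have "\<bar>\<dots>\<bar> = \<bar>real (card E) - d * uw\<bar>" by (rule abs_minus_cancel)
    also have "\<dots> \<le> \<epsilon> / 2 * uw" by (rule dE)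
    finally have "\<bar>d * r - d' * r\<bar> \<le> \<epsilon> / 2 * uw" .
    moreover have "\<bar>real (card {b \<in> U' \<times> W'. Q b}) - d * r\<bar> \<le> \<epsilon> / 2 * uw"
      using disc[OF sub] by (simp add: r_def uw_def mult.assoc)
    ultimately have "\<bar>real (card {b \<in> U' \<times> W'. Q b}) - d' * r\<bar> \<le> \<epsilon> * uw" by linarith
    then show ?thesis unfolding cnt[OF sub] by (simp add: r_def mult.assoc)
  qed
  moreover have "\<epsilon> / 2 * uw \<le> \<epsilon> * uw" using \<epsilon> uw by (intro mult_right_mono) auto
  ultimately show ?thesis
    unfolding disc2_density_def disc2_def bipartite_def Let_def using disj EK dE
    by (auto simp: uw_def d'_def mult.assoc)
qed

text \<open>The relations are replaced by the density one at a time: \<open>Q3\<close> between the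
  neighbourhoods of a fixed \<open>x\<close>, then \<open>Q2\<close> for a fixed \<open>y\<close>,
  finally \<open>Q1\<close> on \<open>X \<times> Y\<close>. The errors add up to
  \<open>\<epsilon> * (1 + d + d\<^sup>2)\<close>.\<close>

lemma card_triangles_le:
  fixes d \<epsilon> :: real
  assumes fin: "finite X" "finite Y" "finite Z" and d: "0 \<le> d" "d \<le> 1" and \<epsilon>: "0 \<le> \<epsilon>"
    and XY: "\<And>U' W'. U' \<subseteq> X \<Longrightarrow> W' \<subseteq> Y \<Longrightarrow> real (card {b \<in> U' \<times> W'. Q1 b}) \<le> d * real (card U') * real (card W') + \<epsilon> * real (card X) * real (card Y)"
    and XZ: "\<And>U' W'. U' \<subseteq> X \<Longrightarrow> W' \<subseteq> Z \<Longrightarrow> real (card {b \<in> U' \<times> W'. Q2 b}) \<le> d * real (card U') * real (card W') + \<epsilon> * real (card X) * real (card Z)"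
    and YZ: "\<And>U' W'. U' \<subseteq> Y \<Longrightarrow> W' \<subseteq> Z \<Longrightarrow> real (card {b \<in> U' \<times> W'. Q3 b}) \<le> d * real (card U') * real (card W') + \<epsilon> * real (card Y) * real (card Z)"
  shows "real (card {(x, y, z) \<in> X \<times> Y \<times> Z. Q1 (x, y) \<and> Q2 (x, z) \<and> Q3 (y, z)})
    \<le> (d ^ 3 + 3 * \<epsilon>) * real (card X) * real (card Y) * real (card Z)"
proof -
  let ?x = "real (card X)" and ?y = "real (card Y)" and ?z = "real (card Z)"
  have T1: "{(x, y, z) \<in> X \<times> Y \<times> Z. Q1 (x, y) \<and> Q2 (x, z) \<and> Q3 (y, z)}
      = (SIGMA x:X. {b \<in> {y \<in> Y. Q1 (x, y)} \<times> {z \<in> Z. Q2 (x, z)}. Q3 b})" by auto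
  have T2: "card (SIGMA x:X. {y \<in> Y. Q1 (x, y)} \<times> {z \<in> Z. Q2 (x, z)})
      = card (SIGMA y:Y. {b \<in> {x \<in> X. Q1 (x, y)} \<times> Z. Q2 b})"
    by (rule bij_betw_same_card[of "\<lambda>(x, y, z). (y, x, z)"], rule bij_betwI[where g="\<lambda>(y, x, z). (x, y, z)"]) auto
  have T3: "card (SIGMA y:Y. {x \<in> X. Q1 (x, y)}) = card {b \<in> X \<times> Y. Q1 b}"
    by (rule bij_betw_same_card[of "\<lambda>(x, y). (y, x)"], rule bij_betwI[where g="\<lambda>(y, x). (x, y)"]) auto
  have "real (card {(x, y, z) \<in> X \<times> Y \<times> Z. Q1 (x, y) \<and> Q2 (x, z) \<and> Q3 (y, z)})
      = (\<Sum>x\<in>X. real (card {b \<in> {y \<in> Y. Q1 (x, y)} \<times> {z \<in> Z. Q2 (x, z)}. Q3 b}))"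
    unfolding T1 using fin by (subst card_SigmaI) auto
  also have "\<dots> \<le> (\<Sum>x\<in>X. d * real (card ({y \<in> Y. Q1 (x, y)} \<times> {z \<in> Z. Q2 (x, z)})) + \<epsilon> * ?y * ?z)"
  proof (rule sum_mono)
    fix x
    show "real (card {b \<in> {y \<in> Y. Q1 (x, y)} \<times> {z \<in> Z. Q2 (x, z)}. Q3 b})
      \<le> d * real (card ({y \<in> Y. Q1 (x, y)} \<times> {z \<in> Z. Q2 (x, z)})) + \<epsilon> * ?y * ?z"
      using YZ[of "{y \<in> Y. Q1 (x, y)}" "{z \<in> Z. Q2 (x, z)}"] by (simp add: card_cartesian_product mult.assoc)
  qed
  also have "\<dots> = d * real (card (SIGMA x:X. {y \<in> Y. Q1 (x, y)} \<times> {z \<in> Z. Q2 (x, z)})) + \<epsilon> * ?x * ?y * ?z"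
    using fin by (subst card_SigmaI) (auto simp: sum.distrib sum_distrib_left)
  also have "real (card (SIGMA x:X. {y \<in> Y. Q1 (x, y)} \<times> {z \<in> Z. Q2 (x, z)}))
      = (\<Sum>y\<in>Y. real (card {b \<in> {x \<in> X. Q1 (x, y)} \<times> Z. Q2 b}))"
    unfolding T2 using fin by (subst card_SigmaI) auto
  also have "d * \<dots> + \<epsilon> * ?x * ?y * ?z
      \<le> d * (\<Sum>y\<in>Y. d * ?z * real (card {x \<in> X. Q1 (x, y)}) + \<epsilon> * ?x * ?z) + \<epsilon> * ?x * ?y * ?z"
  proof (intro add_right_mono mult_left_mono sum_mono d)
    fix y
    show "real (card {b \<in> {x \<in> X. Q1 (x, y)} \<times> Z. Q2 b}) \<le> d * ?z * real (card {x \<in> X. Q1 (x, y)}) + \<epsilon> * ?x * ?z"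
      using XZ[of "{x \<in> X. Q1 (x, y)}" Z] by (simp add: mult_ac)
  qed
  also have "(\<Sum>y\<in>Y. d * ?z * real (card {x \<in> X. Q1 (x, y)}) + \<epsilon> * ?x * ?z)
      = d * ?z * real (card (SIGMA y:Y. {x \<in> X. Q1 (x, y)})) + \<epsilon> * ?x * ?y * ?z"
    using fin by (subst card_SigmaI) (auto simp: sum.distrib sum_distrib_left)
  also have "d * (d * ?z * real (card (SIGMA y:Y. {x \<in> X. Q1 (x, y)})) + \<epsilon> * ?x * ?y * ?z) + \<epsilon> * ?x * ?y * ?z
      \<le> d * (d * ?z * (d * ?x * ?y + \<epsilon> * ?x * ?y) + \<epsilon> * ?x * ?y * ?z) + \<epsilon> * ?x * ?y * ?z"
    unfolding T3 using XY[of X Y] d by (intro add_right_mono mult_left_mono) auto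
  also have "\<dots> = (d ^ 3 + \<epsilon> * (d\<^sup>2 + d + 1)) * (?x * ?y * ?z)" by (simp add: algebra_simps power2_eq_square power3_eq_cube)
  also have "\<dots> \<le> (d ^ 3 + 3 * \<epsilon>) * (?x * ?y * ?z)"
  proof (intro mult_right_mono add_left_mono)
    have "d\<^sup>2 \<le> 1" using d by (simp add: power_le_one)
    then have "\<epsilon> * (d\<^sup>2 + d + 1) \<le> \<epsilon> * 3" using d \<epsilon> by (intro mult_left_mono) auto
    then show "\<epsilon> * (d\<^sup>2 + d + 1) \<le> 3 * \<epsilon>" by simp
  qed simp
  finally show ?thesis by (simp add: mult.assoc)
qed

text \<open>\<open>K3\<close> speaks of unlabelled triangles. All edges join different parts, so the
  parts of \<open>a\<close> and \<open>b\<close> determine that of \<open>c\<close> and the kind of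
  each edge; the six cases are the ways to distribute \<open>a\<close>, \<open>b\<close>,
  \<open>c\<close> over the parts.\<close>

lemma K3_tripartite:
  fixes A B C :: "'a set"
  assumes disj: "A \<inter> B = {}" "A \<inter> C = {}" "B \<inter> C = {}"
    and E: "E1 \<subseteq> K2 A B" "E2 \<subseteq> K2 A C" "E3 \<subseteq> K2 B C"
  shows "T \<in> K3 (X, E1 \<union> E2 \<union> E3) \<longleftrightarrow>
    (\<exists>x\<in>A. \<exists>y\<in>B. \<exists>z\<in>C. T = {x, y, z} \<and> {x, y} \<in> E1 \<and> {x, z} \<in> E2 \<and> {y, z} \<in> E3)"
proof
  assume "\<exists>x\<in>A. \<exists>y\<in>B. \<exists>z\<in>C. T = {x, y, z} \<and> {x, y} \<in> E1 \<and> {x, z} \<in> E2 \<and> {y, z} \<in> E3"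
  then obtain x y z where xyz: "x \<in> A" "y \<in> B" "z \<in> C" "T = {x, y, z}" "{x, y} \<in> E1" "{x, z} \<in> E2" "{y, z} \<in> E3"
    by blast
  then have "x \<noteq> y" "x \<noteq> z" "y \<noteq> z" using disj by auto
  then show "T \<in> K3 (X, E1 \<union> E2 \<union> E3)" unfolding K3_def using xyz by auto
next
  let ?E = "E1 \<union> E2 \<union> E3"
  assume "T \<in> K3 (X, ?E)"
  then obtain a b c where T: "T = {a, b, c}" and abc: "{a, b} \<in> ?E" "{a, c} \<in> ?E" "{b, c} \<in> ?E"
    unfolding K3_def by auto
  have K: "(p \<in> U \<and> q \<in> W) \<or> (q \<in> U \<and> p \<in> W)" if "{p, q} \<in> K2 U W" for p q :: 'a and U W
    using that unfolding K2_def by (auto simp: doubleton_eq_iff)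
  have EA: "q \<in> B \<and> {p, q} \<in> E1 \<or> q \<in> C \<and> {p, q} \<in> E2" if "{p, q} \<in> ?E" "p \<in> A" for p q
    using that E disj K[of p q A B] K[of p q A C] K[of p q B C] by blast
  have EB: "q \<in> A \<and> {q, p} \<in> E1 \<or> q \<in> C \<and> {p, q} \<in> E3" if "{p, q} \<in> ?E" "p \<in> B" for p q
  proof -
    have "q \<in> A \<and> {p, q} \<in> E1 \<or> q \<in> C \<and> {p, q} \<in> E3"
      using that E disj K[of p q A B] K[of p q A C] K[of p q B C] by blast
    then show ?thesis by (simp add: insert_commute)
  qed
  have EC: "q \<in> A \<and> {q, p} \<in> E2 \<or> q \<in> B \<and> {q, p} \<in> E3" if "{p, q} \<in> ?E" "p \<in> C" for p q
  proof -
    have "q \<in> A \<and> {p, q} \<in> E2 \<or> q \<in> B \<and> {p, q} \<in> E3"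
      using that E disj K[of p q A B] K[of p q A C] K[of p q B C] by blast
    then show ?thesis by (simp add: insert_commute)
  qed
  have dis: "\<not> (p \<in> A \<and> p \<in> B) \<and> \<not> (p \<in> A \<and> p \<in> C) \<and> \<not> (p \<in> B \<and> p \<in> C)" for p
    using disj by blast
  have fin: "\<exists>x\<in>A. \<exists>y\<in>B. \<exists>z\<in>C. T = {x, y, z} \<and> {x, y} \<in> E1 \<and> {x, z} \<in> E2 \<and> {y, z} \<in> E3" if "x \<in> A" "y \<in> B" "z \<in> C" "{a, b, c} = {x, y, z}" "{x, y} \<in> E1" "{x, z} \<in> E2" "{y, z} \<in> E3" for x y z
    using that T by blast
  have "a \<in> A \<or> a \<in> B \<or> a \<in> C" using abc(1) E K[of a b A B] K[of a b A C] K[of a b B C] by blast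
  then show "\<exists>x\<in>A. \<exists>y\<in>B. \<exists>z\<in>C. T = {x, y, z} \<and> {x, y} \<in> E1 \<and> {x, z} \<in> E2 \<and> {y, z} \<in> E3"
  proof (elim disjE)
    assume a: "a \<in> A"
    show ?thesis
    proof (cases "b \<in> B")
      case True
      then have "c \<in> C" "{a, b} \<in> E1" "{a, c} \<in> E2" "{b, c} \<in> E3"
        using EA[OF abc(1) a] EA[OF abc(2) a] EB[OF abc(3)] dis[of a] dis[of b] dis[of c] by auto
      then show ?thesis using a True fin[of a b c] by simp
    next
      case False
      then have b: "b \<in> C" "{a, b} \<in> E2" using EA[OF abc(1) a] by auto
      then have "c \<in> B" "{a, c} \<in> E1" "{c, b} \<in> E3"
        using EA[OF abc(2) a] EC[OF abc(3)] dis[of a] dis[of b] dis[of c] by auto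
      then show ?thesis using a b fin[of a c b] by (simp add: insert_commute)
    qed
  next
    assume a: "a \<in> B"
    show ?thesis
    proof (cases "b \<in> A")
      case True
      then have "c \<in> C" "{b, a} \<in> E1" "{a, c} \<in> E3" "{b, c} \<in> E2"
        using EB[OF abc(1) a] EB[OF abc(2) a] EA[OF abc(3)] dis[of a] dis[of b] dis[of c] by auto
      then show ?thesis using a True fin[of b a c] by (simp add: insert_commute)
    next
      case False
      then have b: "b \<in> C" "{a, b} \<in> E3" using EB[OF abc(1) a] by auto
      then have "c \<in> A" "{c, a} \<in> E1" "{c, b} \<in> E2"
        using EB[OF abc(2) a] EC[OF abc(3)] dis[of a] dis[of b] dis[of c] by auto
      then show ?thesis using a b fin[of c a b] by (simp add: insert_commute)
    qed
  next
    assume a: "a \<in> C"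
    show ?thesis
    proof (cases "b \<in> A")
      case True
      then have "c \<in> B" "{b, a} \<in> E2" "{c, a} \<in> E3" "{b, c} \<in> E1"
        using EC[OF abc(1) a] EC[OF abc(2) a] EA[OF abc(3)] dis[of a] dis[of b] dis[of c] by auto
      then show ?thesis using a True fin[of b c a] by (simp add: insert_commute)
    next
      case False
      then have b: "b \<in> B" "{b, a} \<in> E3" using EC[OF abc(1) a] by auto
      then have "c \<in> A" "{c, a} \<in> E2" "{c, b} \<in> E1"
        using EC[OF abc(2) a] EB[OF abc(3)] dis[of a] dis[of b] dis[of c] by auto
      then show ?thesis using a b fin[of c b a] by (simp add: insert_commute)
    qed
  qed
qed

text \<open>With \<open>f\<close> the index of the part, sorting reduces every triple to
  \<open>i \<le> j \<le> k\<close>, the orientation in which the labels of pairs are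
  defined.\<close>

lemma ex_ordered_triple:
  fixes f :: "'a \<Rightarrow> nat"
  assumes "T \<in> nsets V 3"
  shows "\<exists>x y z. T = {x, y, z} \<and> x \<in> V \<and> y \<in> V \<and> z \<in> V \<and> f x \<le> f y \<and> f y \<le> f z"
proof -
  obtain a b c where T: "T = {a, b, c}" "a \<in> V" "b \<in> V" "c \<in> V"
    using assms unfolding nsets_3_eq by auto
  have fin: ?thesis if "{a, b, c} = {x, y, z}" "x \<in> V" "y \<in> V" "z \<in> V" "f x \<le> f y" "f y \<le> f z" for x y z
    using that T(1) by blast
  consider "f a \<le> f b" "f b \<le> f c" | "f a \<le> f c" "f c \<le> f b" | "f b \<le> f a" "f a \<le> f c"
    | "f b \<le> f c" "f c \<le> f a" | "f c \<le> f a" "f a \<le> f b" | "f c \<le> f b" "f b \<le> f a" by linarith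
  then show ?thesis
    by cases (use T fin[of a b c] fin[of a c b] fin[of b a c] fin[of b c a] fin[of c a b] fin[of c b a]
      in \<open>simp_all add: insert_commute\<close>)
qed

lemma K2_commute: "K2 A B = K2 B A"
  unfolding K2_def by (auto simp: insert_commute)

lemma finite_K3: "finite (\<Union> (snd G)) \<Longrightarrow> finite (K3 G)"
  by (rule finite_subset[of _ "Pow (\<Union> (snd G))"]) (auto simp: K3_def)

text \<open>If \<open>d3 < \<mu>\<close>, then for every \<open>G'\<close> the number of edges and
  its expected value both lie between 0 and \<open>\<mu> * card (K3 G)\<close>; if
  \<open>d3 > 1 - \<mu>\<close>, the same holds for non-edges. The bound on the triangles brings
  this to the scale \<open>d ^ 3\<close>, and its factor 2 accounts for
  \<open>\<mu> \<le> \<epsilon>1 / 2\<close>.\<close>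

lemma disc23_of_homogeneous:
  fixes V1 V2 V3 :: "'a set"
  assumes fin: "finite V1" "finite V2" "finite V3"
    and disj: "V1 \<inter> V2 = {}" "V1 \<inter> V3 = {}" "V2 \<inter> V3 = {}"
    and E: "E1 \<subseteq> K2 V1 V2" "E2 \<subseteq> K2 V1 V3" "E3 \<subseteq> K2 V2 V3"
    and G: "G = (V1 \<union> V2 \<union> V3, E1 \<union> E2 \<union> E3)"
    and d: "0 < d" "d \<le> 1"
    and disc: "disc2_density \<epsilon>2 d V1 V2 E1" "disc2_density \<epsilon>2 d V1 V3 E2" "disc2_density \<epsilon>2 d V2 V3 E3"
    and K3_le: "real (card (K3 G)) \<le> 2 * d ^ 3 * real (card V1) * real (card V2) * real (card V3)"
    and hom: "real (card (F \<inter> K3 G)) / real (card (K3 G)) \<in> {0..<\<mu>} \<union> {1 - \<mu><..1}"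
    and \<mu>: "0 \<le> \<mu>" "\<mu> \<le> \<epsilon>1 / 2"
  shows "disc23 \<epsilon>1 \<epsilon>2 V1 V2 V3 (V1 \<union> V2 \<union> V3, F \<inter> K3 G) G"
proof -
  have "K2 V1 V2 \<inter> K2 V1 V3 = {}" "K2 V1 V2 \<inter> K2 V2 V3 = {}" "K2 V1 V3 \<inter> K2 V2 V3 = {}"
    using disj unfolding K2_def by (auto simp: doubleton_eq_iff)
  then have E_eq: "snd G \<inter> K2 V1 V2 = E1" "snd G \<inter> K2 V1 V3 = E2" "snd G \<inter> K2 V2 V3 = E3"
    using E unfolding G by auto
  have "\<Union> (snd G) \<subseteq> V1 \<union> V2 \<union> V3" using E unfolding G K2_def by fastforce
  then have finK: "finite (K3 G)" using fin by (intro finite_K3) (simp add: finite_subset)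
  define m where "m = real (card (K3 G))"
  define a where "a = real (card (F \<inter> K3 G))"
  define d3 where "d3 = a / m"
  have bound: "\<bar>real (card (F \<inter> K3 G \<inter> K3 G')) - d3 * real (card (K3 G'))\<bar>
      \<le> \<epsilon>1 * d ^ 3 * real (card V1) * real (card V2) * real (card V3)" if "subgraph G' G" for G'
  proof -
    have sub: "K3 G' \<subseteq> K3 G" using that unfolding subgraph_def K3_def by blast
    define m' where "m' = real (card (K3 G'))"
    define a' where "a' = real (card (F \<inter> K3 G \<inter> K3 G'))"
    have le: "0 \<le> a'" "0 \<le> m'" "a' \<le> a" "m' \<le> m" "a \<le> m" "a' \<le> m'"
      unfolding a'_def m'_def a_def m_def using finK sub by (auto intro!: card_mono finite_subset[OF sub])
    have le2: "m' - a' \<le> m - a"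
    proof -
      have "m' - a' = real (card (K3 G' - F))"
      proof -
        have "card (K3 G') = card (K3 G' - F) + card (F \<inter> K3 G \<inter> K3 G')"
          using finite_subset[OF sub finK] sub
          by (subst card_Un_disjoint[symmetric]) (auto intro!: arg_cong[where f=card])
        then show ?thesis by (simp add: m'_def a'_def)
      qed
      moreover have "m - a = real (card (K3 G - F))"
      proof -
        have "card (K3 G) = card (K3 G - F) + card (F \<inter> K3 G)"
          using finK by (subst card_Un_disjoint[symmetric]) (auto intro!: arg_cong[where f=card])
        then show ?thesis by (simp add: m_def a_def)
      qed
      moreover have "card (K3 G' - F) \<le> card (K3 G - F)" using finK sub by (intro card_mono) auto
      ultimately show ?thesis by simp
    qed
    have "\<bar>a' - d3 * m'\<bar> \<le> \<mu> * m"
    proof (cases "m = 0")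
      case True
      then have "a' = 0" "m' = 0" using le by linarith+
      then show ?thesis using True by simp
    next
      case False
      then have m: "m > 0" using le by linarith
      have am: "a = d3 * m" using m by (simp add: d3_def)
      have d3: "0 \<le> d3" "d3 \<le> 1" using le m by (auto simp: d3_def)
      from hom have "d3 < \<mu> \<or> 1 - \<mu> < d3" by (auto simp: d3_def a_def m_def)
      then show ?thesis
      proof
        assume "d3 < \<mu>"
        then have "d3 * m \<le> \<mu> * m" using m by (intro mult_right_mono) auto
        moreover have "d3 * m' \<le> d3 * m" "0 \<le> d3 * m'" using d3 le by (auto intro: mult_left_mono)
        ultimately show ?thesis using le am by linarith
      next
        assume "1 - \<mu> < d3"
        then have "(1 - d3) * m \<le> \<mu> * m" using m by (intro mult_right_mono) auto
        moreover have "(1 - d3) * m' \<le> (1 - d3) * m" "0 \<le> (1 - d3) * m'" using d3 le by (auto intro: mult_left_mono)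
        moreover have "m' - a' \<le> (1 - d3) * m" using le2 am by (simp add: algebra_simps)
        moreover have "a' - d3 * m' = (1 - d3) * m' - (m' - a')" by (simp add: algebra_simps)
        ultimately show ?thesis using le by linarith
      qed
    qed
    also have "\<dots> \<le> \<epsilon>1 / 2 * (2 * d ^ 3 * real (card V1) * real (card V2) * real (card V3))"
      using \<mu> K3_le by (intro mult_mono) (auto simp: m_def)
    finally show ?thesis by (simp add: a'_def m'_def mult.assoc)
  qed
  have "fst G = V1 \<union> V2 \<union> V3" "snd G \<subseteq> K2 V1 V2 \<union> K2 V1 V3 \<union> K2 V2 V3"
    using E unfolding G by auto
  then show ?thesis
    unfolding disc23_def tripartite_def Let_def snd_conv fst_conv E_eq
    using disj d disc bound unfolding d3_def a_def m_def by (intro conjI exI[of _ d]) auto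
qed

section \<open>Homogeneous decompositions\<close>

text \<open>For values 0 and 1 of \<open>f\<close>,
  \<open>\<bar>f - h\<bar> = f + h - 2 * f * h\<close>, and under the sum \<open>f\<close> may be
  replaced by \<open>h\<close> against functions constant on cells. Thus the bound on
  \<open>h * (1 - h)\<close> is a bound in L1.\<close>

lemma sum_abs_cond_avg_diff:
  fixes f :: "'w \<Rightarrow> real"
  assumes fin: "finite \<Omega>" and f: "\<And>w. f w = 0 \<or> f w = 1"
  shows "(\<Sum>w\<in>\<Omega>. \<bar>f w - cond_avg \<Omega> \<pi> f w\<bar>)
    = 2 * (\<Sum>w\<in>\<Omega>. cond_avg \<Omega> \<pi> f w * (1 - cond_avg \<Omega> \<pi> f w))"
proof -
  let ?h = "cond_avg \<Omega> \<pi> f"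
  have h: "0 \<le> ?h w" "?h w \<le> 1" for w
    using f by (auto intro!: cond_avg_bounds[OF fin]) (metis order_refl zero_le_one)+
  have "\<bar>f w - ?h w\<bar> = f w * 1 + ?h w * 1 - 2 * (f w * ?h w)" for w using f[of w] h[of w] by auto
  then have "(\<Sum>w\<in>\<Omega>. \<bar>f w - ?h w\<bar>) = (\<Sum>w\<in>\<Omega>. f w * 1) + (\<Sum>w\<in>\<Omega>. ?h w * 1) - 2 * (\<Sum>w\<in>\<Omega>. f w * ?h w)"
    by (simp add: sum.distrib sum_subtractf sum_distrib_left)
  also have "(\<Sum>w\<in>\<Omega>. f w * 1) = (\<Sum>w\<in>\<Omega>. ?h w * 1)" by (rule sum_cond_avg_mult[OF fin, symmetric]) simp
  also have "(\<Sum>w\<in>\<Omega>. f w * ?h w) = (\<Sum>w\<in>\<Omega>. ?h w * ?h w)"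
    by (rule sum_cond_avg_mult[OF fin, symmetric]) (rule cond_avg_cong)
  finally show ?thesis by (simp add: right_diff_distrib sum_subtractf)
qed

text \<open>On \<open>Z \<tau>\<close> the function \<open>h\<close> equals some constant in
  \<open>[0, 1]\<close>. A function with values 0 and 1 and mean between \<open>\<mu>\<close> and
  \<open>1 - \<mu>\<close> has average distance at least \<open>\<mu>\<close> from every such
  constant, and the sets \<open>Z \<tau>\<close> are disjoint.\<close>

lemma card_nonhomogeneous_cells_le:
  fixes f h :: "'w \<Rightarrow> real" and \<mu> :: real
  assumes fin: "finite \<Omega>" "finite S" and f: "\<And>w. f w = 0 \<or> f w = 1"
    and Z: "\<And>\<tau>. \<tau> \<in> S \<Longrightarrow> Z \<tau> \<subseteq> \<Omega>"
    and disj: "\<And>\<tau> \<tau>'. \<tau> \<in> S \<Longrightarrow> \<tau>' \<in> S \<Longrightarrow> \<tau> \<noteq> \<tau>' \<Longrightarrow> Z \<tau> \<inter> Z \<tau>' = {}"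
    and h: "\<And>\<tau> w w'. \<tau> \<in> S \<Longrightarrow> w \<in> Z \<tau> \<Longrightarrow> w' \<in> Z \<tau> \<Longrightarrow> h w = h w'"
    and h01: "\<And>w. 0 \<le> h w \<and> h w \<le> 1"
    and mid: "\<And>\<tau>. \<tau> \<in> S \<Longrightarrow> \<mu> * card (Z \<tau>) \<le> (\<Sum>w\<in>Z \<tau>. f w) \<and> (\<Sum>w\<in>Z \<tau>. f w) \<le> (1 - \<mu>) * card (Z \<tau>)"
  shows "\<mu> * real (card (\<Union>\<tau>\<in>S. Z \<tau>)) \<le> (\<Sum>w\<in>\<Omega>. \<bar>f w - h w\<bar>)"
proof -
  have finZ: "finite (Z \<tau>)" if "\<tau> \<in> S" for \<tau> using Z[OF that] fin finite_subset by blast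
  have one: "\<mu> * real (card (Z \<tau>)) \<le> (\<Sum>w\<in>Z \<tau>. \<bar>f w - h w\<bar>)" if \<tau>: "\<tau> \<in> S" for \<tau>
  proof (cases "Z \<tau> = {}")
    case True then show ?thesis by simp
  next
    case False
    then obtain w0 where w0: "w0 \<in> Z \<tau>" by blast
    define h0 where "h0 = h w0"
    have h0: "0 \<le> h0" "h0 \<le> 1" using h01 by (auto simp: h0_def)
    define a where "a = (\<Sum>w\<in>Z \<tau>. f w)"
    define m where "m = real (card (Z \<tau>))"
    have am: "\<mu> * m \<le> a" "a \<le> (1 - \<mu>) * m" using mid[OF \<tau>] by (auto simp: a_def m_def)
    have "(\<Sum>w\<in>Z \<tau>. \<bar>f w - h w\<bar>) = (\<Sum>w\<in>Z \<tau>. f w * (1 - h0) + (1 - f w) * h0)"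
    proof (rule sum.cong[OF refl])
      fix w assume "w \<in> Z \<tau>"
      then have "h w = h0" using h[OF \<tau> _ w0] by (simp add: h0_def)
      then show "\<bar>f w - h w\<bar> = f w * (1 - h0) + (1 - f w) * h0" using f[of w] h0 by auto
    qed
    also have "\<dots> = a * (1 - h0) + (m - a) * h0"
      by (simp add: sum.distrib sum_distrib_right[symmetric] sum_subtractf a_def m_def)
    also have "\<dots> \<ge> \<mu> * m * (1 - h0) + \<mu> * m * h0"
      using am h0 by (intro add_mono mult_right_mono) (auto simp: algebra_simps)
    finally show ?thesis by (simp add: m_def algebra_simps)
  qed
  have "\<mu> * real (card (\<Union>\<tau>\<in>S. Z \<tau>)) = (\<Sum>\<tau>\<in>S. \<mu> * real (card (Z \<tau>)))"
    using fin finZ disj by (subst card_UN_disjoint) (auto simp: sum_distrib_left)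
  also have "\<dots> \<le> (\<Sum>\<tau>\<in>S. \<Sum>w\<in>Z \<tau>. \<bar>f w - h w\<bar>)" by (intro sum_mono one)
  also have "\<dots> = (\<Sum>w\<in>(\<Union>\<tau>\<in>S. Z \<tau>). \<bar>f w - h w\<bar>)"
    using fin finZ disj by (subst sum.UNION_disjoint) auto
  also have "\<dots> \<le> (\<Sum>w\<in>\<Omega>. \<bar>f w - h w\<bar>)" using fin Z by (intro sum_mono2) auto
  finally show ?thesis .
qed

lemma card_triples_meeting_le:
  assumes fin: "finite V" and B: "B \<subseteq> V \<times> V"
  shows "card {(x, y, z) \<in> V \<times> V \<times> V. (x, y) \<in> B \<or> (x, z) \<in> B \<or> (y, z) \<in> B} \<le> 3 * card V * card B"
proof -
  have finB: "finite B" using B fin finite_subset by blast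
  let ?f1 = "\<lambda>((x, y), z). (x, y, z)" and ?f2 = "\<lambda>((x, z), y). (x, y, z)" and ?f3 = "\<lambda>((y, z), x). (x, y, z)"
  have "{(x, y, z) \<in> V \<times> V \<times> V. (x, y) \<in> B \<or> (x, z) \<in> B \<or> (y, z) \<in> B}
      \<subseteq> ?f1 ` (B \<times> V) \<union> ?f2 ` (B \<times> V) \<union> ?f3 ` (B \<times> V)" (is "?L \<subseteq> ?R")
  proof
    fix q assume "q \<in> ?L"
    then obtain x y z where q: "q = (x, y, z)" "x \<in> V" "y \<in> V" "z \<in> V"
      and c: "(x, y) \<in> B \<or> (x, z) \<in> B \<or> (y, z) \<in> B" by auto
    have "q = ?f1 ((x, y), z)" "q = ?f2 ((x, z), y)" "q = ?f3 ((y, z), x)" using q by auto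
    then show "q \<in> ?R" using c q(2-4) by blast
  qed
  then have "card ?L \<le> card ?R" using fin finB by (intro card_mono) auto
  also have "\<dots> \<le> card (?f1 ` (B \<times> V)) + card (?f2 ` (B \<times> V)) + card (?f3 ` (B \<times> V))"
    by (intro order_trans[OF card_Un_le] add_right_mono card_Un_le)
  also have "\<dots> \<le> card (B \<times> V) + card (B \<times> V) + card (B \<times> V)"
    using fin finB by (intro add_mono card_image_le) auto
  also have "\<dots> = 3 * card V * card B" by (simp add: card_cartesian_product)
  finally show ?thesis .
qed

text \<open>Classes are indexed by unordered pairs as in \<open>decomposition\<close>;
  \<open>Min\<close> and \<open>Max\<close> restore the order, so that for pairs of distinct indices
  \<open>\<psi> i j\<close> is consulted only with \<open>i < j\<close>.\<close>

definition edge_class :: "(nat \<Rightarrow> 'a set) \<Rightarrow> (nat \<Rightarrow> nat \<Rightarrow> 'a \<times> 'a \<Rightarrow> nat) \<Rightarrow> nat set \<Rightarrow> nat \<Rightarrow> 'a set set" where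
  "edge_class A \<psi> s \<alpha> = {{x, y} | x y. x \<in> A (Min s) \<and> y \<in> A (Max s) \<and> \<psi> (Min s) (Max s) (x, y) = \<alpha>}"

definition triad_tuples :: "(nat \<Rightarrow> 'a set) \<Rightarrow> (nat \<Rightarrow> nat \<Rightarrow> 'a \<times> 'a \<Rightarrow> nat) \<Rightarrow>
    nat \<times> nat \<times> nat \<times> nat \<times> nat \<times> nat \<Rightarrow> ('a \<times> 'a \<times> 'a) set" where
  "triad_tuples A \<psi> = (\<lambda>(i, j, k, \<alpha>, \<beta>, \<gamma>).
     {(x, y, z) \<in> A i \<times> A j \<times> A k. \<psi> i j (x, y) = \<alpha> \<and> \<psi> i k (x, z) = \<beta> \<and> \<psi> j k (y, z) = \<gamma>})"

text \<open>Collects what the three conditions on a decomposition ask of a single triple: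
  quasirandom pairs, a homogeneous triad, and the triangle bound from which \<open>disc23\<close> is
  derived. The order of the indices agrees with \<open>edge_class\<close>.\<close>

definition good_triple :: "nat \<Rightarrow> nat \<Rightarrow> (nat \<Rightarrow> 'a set) \<Rightarrow> (nat set \<Rightarrow> nat \<Rightarrow> 'a set set) \<Rightarrow>
    real \<Rightarrow> real \<Rightarrow> 'a set set \<Rightarrow> 'a set \<Rightarrow> bool" where
  "good_triple t l A P \<epsilon> \<mu> F T \<longleftrightarrow> (\<exists>i j k \<alpha> \<beta> \<gamma>. 1 \<le> i \<and> i < j \<and> j < k \<and> k \<le> t \<and>
     \<alpha> \<in> {1..l} \<and> \<beta> \<in> {1..l} \<and> \<gamma> \<in> {1..l} \<and>
     disc2_density \<epsilon> (1 / real l) (A i) (A j) (P {i, j} \<alpha>) \<and>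
     disc2_density \<epsilon> (1 / real l) (A i) (A k) (P {i, k} \<beta>) \<and>
     disc2_density \<epsilon> (1 / real l) (A j) (A k) (P {j, k} \<gamma>) \<and>
     (let K = K3 (triad A P i j k \<alpha> \<beta> \<gamma>) in T \<in> K \<and>
       real (card K) \<le> 2 * (1 / real l) ^ 3 * real (card (A i)) * real (card (A j)) * real (card (A k)) \<and>
       real (card (F \<inter> K)) / real (card K) \<in> {0..<\<mu>} \<union> {1 - \<mu><..1}))"

lemma edge_class_pair:
  assumes "i < j"
  shows "edge_class A \<psi> {i, j} \<alpha> = {{x, y} | x y. x \<in> A i \<and> y \<in> A j \<and> \<psi> i j (x, y) = \<alpha>}"
proof -
  have "Min {i, j} = i" "Max {i, j} = j" using assms by auto
  then show ?thesis unfolding edge_class_def by simp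
qed

lemma K3_triad_edge_class:
  assumes ij: "i < j" "j < k" and disj: "A i \<inter> A j = {}" "A i \<inter> A k = {}" "A j \<inter> A k = {}"
  shows "K3 (triad A (edge_class A \<psi>) i j k \<alpha> \<beta> \<gamma>)
      = (\<lambda>(x, y, z). {x, y, z}) ` triad_tuples A \<psi> (i, j, k, \<alpha>, \<beta>, \<gamma>)"
    and "inj_on (\<lambda>(x, y, z). {x, y, z}) (triad_tuples A \<psi> (i, j, k, \<alpha>, \<beta>, \<gamma>))"
proof -
  have ik: "i < k" using ij by simp
  note ec = edge_class_pair[OF ij(1)] edge_class_pair[OF ij(2)] edge_class_pair[OF ik]
  have mem: "{x, y} \<in> edge_class A \<psi> {i, j} \<alpha> \<longleftrightarrow> \<psi> i j (x, y) = \<alpha>" if "x \<in> A i" "y \<in> A j" for x y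
    using that disj unfolding ec by (auto simp: doubleton_eq_iff)
  have mem2: "{x, y} \<in> edge_class A \<psi> {i, k} \<alpha> \<longleftrightarrow> \<psi> i k (x, y) = \<alpha>" if "x \<in> A i" "y \<in> A k" for x y \<alpha>
    using that disj unfolding ec by (auto simp: doubleton_eq_iff)
  have mem3: "{x, y} \<in> edge_class A \<psi> {j, k} \<alpha> \<longleftrightarrow> \<psi> j k (x, y) = \<alpha>" if "x \<in> A j" "y \<in> A k" for x y \<alpha>
    using that disj unfolding ec by (auto simp: doubleton_eq_iff)
  have sub: "edge_class A \<psi> {i, j} \<alpha> \<subseteq> K2 (A i) (A j)" "edge_class A \<psi> {i, k} \<beta> \<subseteq> K2 (A i) (A k)"
    "edge_class A \<psi> {j, k} \<gamma> \<subseteq> K2 (A j) (A k)"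
    using disj unfolding ec K2_def by blast+
  have "T \<in> K3 (triad A (edge_class A \<psi>) i j k \<alpha> \<beta> \<gamma>) \<longleftrightarrow>
    T \<in> (\<lambda>(x, y, z). {x, y, z}) ` triad_tuples A \<psi> (i, j, k, \<alpha>, \<beta>, \<gamma>)" for T
  proof -
    have "T \<in> K3 (triad A (edge_class A \<psi>) i j k \<alpha> \<beta> \<gamma>) \<longleftrightarrow>
      (\<exists>x\<in>A i. \<exists>y\<in>A j. \<exists>z\<in>A k. T = {x, y, z} \<and> \<psi> i j (x, y) = \<alpha> \<and> \<psi> i k (x, z) = \<beta> \<and> \<psi> j k (y, z) = \<gamma>)"
      unfolding triad_def K3_tripartite[OF disj sub] using mem mem2 mem3 by (intro bex_cong refl) auto
    also have "\<dots> \<longleftrightarrow> T \<in> (\<lambda>(x, y, z). {x, y, z}) ` triad_tuples A \<psi> (i, j, k, \<alpha>, \<beta>, \<gamma>)"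
      unfolding triad_tuples_def by force
    finally show ?thesis .
  qed
  then show "K3 (triad A (edge_class A \<psi>) i j k \<alpha> \<beta> \<gamma>)
      = (\<lambda>(x, y, z). {x, y, z}) ` triad_tuples A \<psi> (i, j, k, \<alpha>, \<beta>, \<gamma>)" by blast
  show "inj_on (\<lambda>(x, y, z). {x, y, z}) (triad_tuples A \<psi> (i, j, k, \<alpha>, \<beta>, \<gamma>))"
  proof (rule inj_onI, clarsimp simp: triad_tuples_def)
    fix x y z x' y' z'
    assume m: "x \<in> A i" "y \<in> A j" "z \<in> A k" "x' \<in> A i" "y' \<in> A j" "z' \<in> A k" and eq: "{x, y, z} = {x', y', z'}"
    have "x \<in> {x', y', z'}" "y \<in> {x', y', z'}" "z \<in> {x', y', z'}" using eq by auto
    then show "x = x' \<and> y = y' \<and> z = z'" using m disj by auto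
  qed
qed

text \<open>One colouring has to serve all three coordinate pairs, because the same pair of parts
  can be the first, middle or last pair of a triad. The colours are read as three digits in base
  \<open>m\<close>.\<close>

lemma ex_colouring_refining3:
  fixes \<kappa>1 \<kappa>2 \<kappa>3 :: "'b \<Rightarrow> nat"
  assumes "\<And>b. \<kappa>1 b < m" "\<And>b. \<kappa>2 b < m" "\<And>b. \<kappa>3 b < m"
  shows "\<exists>\<kappa>. (\<forall>b. \<kappa> b < m * (m * m)) \<and> (\<forall>b b'. \<kappa> b = \<kappa> b' \<longrightarrow> \<kappa>1 b = \<kappa>1 b' \<and> \<kappa>2 b = \<kappa>2 b' \<and> \<kappa>3 b = \<kappa>3 b')"
proof (intro exI[of _ "\<lambda>b. \<kappa>1 b + m * (\<kappa>2 b + m * \<kappa>3 b)"] conjI allI impI)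
  fix b
  have "\<kappa>2 b + m * \<kappa>3 b < m * m"
  proof -
    have "m * \<kappa>3 b \<le> m * (m - 1)" using assms(3)[of b] by (intro mult_le_mono2) auto
    then have "\<kappa>2 b + m * \<kappa>3 b < m + m * (m - 1)" using assms(2)[of b] by linarith
    also have "\<dots> = m * m" using assms(1)[of b] by (cases m) auto
    finally show ?thesis .
  qed
  then have "m * (\<kappa>2 b + m * \<kappa>3 b) \<le> m * (m * m - 1)" by (intro mult_le_mono2) auto
  then have "\<kappa>1 b + m * (\<kappa>2 b + m * \<kappa>3 b) < m + m * (m * m - 1)" using assms(1)[of b] by linarith
  also have "\<dots> = m * (m * m)" using assms(1)[of b] by (cases m) auto
  finally show "\<kappa>1 b + m * (\<kappa>2 b + m * \<kappa>3 b) < m * (m * m)" .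
next
  fix b b' assume eq: "\<kappa>1 b + m * (\<kappa>2 b + m * \<kappa>3 b) = \<kappa>1 b' + m * (\<kappa>2 b' + m * \<kappa>3 b')"
  have dec: "a = a' \<and> c = c'" if "a + m * c = a' + m * c'" "a < m" "a' < m" for a a' c c' :: nat
  proof -
    have "(a + m * c) mod m = a" "(a' + m * c') mod m = a'" "(a + m * c) div m = c" "(a' + m * c') div m = c'"
      using that(2,3) by simp_all
    then show ?thesis using that(1) by metis
  qed
  have 1: "\<kappa>1 b = \<kappa>1 b' \<and> \<kappa>2 b + m * \<kappa>3 b = \<kappa>2 b' + m * \<kappa>3 b'" using dec[OF eq] assms by blast
  then have "\<kappa>2 b = \<kappa>2 b' \<and> \<kappa>3 b = \<kappa>3 b'" using dec assms by blast
  with 1 show "\<kappa>1 b = \<kappa>1 b'" "\<kappa>2 b = \<kappa>2 b'" "\<kappa>3 b = \<kappa>3 b'" by auto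
qed

text \<open>\<open>X\<close> consists of the exceptional labels, which may mix colours; every other
  label lies inside one class of \<open>\<kappa>\<close>. Their number is bounded independently of
  \<open>l\<close>.\<close>

definition split_pair ::
  "nat \<Rightarrow> nat \<Rightarrow> real \<Rightarrow> 'a set \<Rightarrow> 'a set \<Rightarrow> ('a \<times> 'a \<Rightarrow> nat) \<Rightarrow> ('a \<times> 'a \<Rightarrow> nat) \<Rightarrow> nat set \<Rightarrow> bool" where
  "split_pair M l \<epsilon> U W \<kappa> \<psi> X \<longleftrightarrow>
    (\<forall>\<alpha>\<in>{1..l}. \<forall>U' W'. U' \<subseteq> U \<and> W' \<subseteq> W \<longrightarrow>
        \<bar>real (card {b \<in> U' \<times> W'. \<psi> b = \<alpha>}) - 1 / real l * real (card U') * real (card W')\<bar>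
          \<le> \<epsilon> * real (card U) * real (card W)) \<and>
    X \<subseteq> {1..l} \<and> card X \<le> M + 1 \<and> (\<forall>\<alpha>\<in>{1..l} - X. \<exists>c. \<forall>b\<in>U \<times> W. \<psi> b = \<alpha> \<longrightarrow> \<kappa> b = c)"

text \<open>The error \<open>\<epsilon> / 2\<close> enters the triangle count three times, and
  \<open>3 / 2 * \<epsilon> \<le> (1 / l) ^ 3\<close> turns the total into the factor 2. Triangles
  correspond bijectively to ordered tuples, so means of \<open>edge_fun\<close> are densities of
  \<open>F\<close> in the triad.\<close>

lemma good_triple_of_split:
  fixes \<epsilon> \<epsilon>' \<mu> :: real
  assumes fin: "finite (A i)" "finite (A j)" "finite (A k)"
    and disj: "A i \<inter> A j = {}" "A i \<inter> A k = {}" "A j \<inter> A k = {}"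
    and ijk: "1 \<le> i" "i < j" "j < k" "k \<le> t" and l: "1 \<le> l"
    and sp: "split_pair M l (\<epsilon> / 2) (A i) (A j) \<kappa> (\<psi> i j) X1" "split_pair M l (\<epsilon> / 2) (A i) (A k) \<kappa> (\<psi> i k) X2"
      "split_pair M l (\<epsilon> / 2) (A j) (A k) \<kappa> (\<psi> j k) X3"
    and abg: "\<alpha> \<in> {1..l}" "\<beta> \<in> {1..l}" "\<gamma> \<in> {1..l}"
    and \<epsilon>: "0 < \<epsilon>" "\<epsilon> \<le> \<epsilon>'" "3 / 2 * \<epsilon> \<le> (1 / real l) ^ 3"
    and q: "q \<in> triad_tuples A \<psi> (i, j, k, \<alpha>, \<beta>, \<gamma>)"
    and hom: "(\<Sum>q\<in>triad_tuples A \<psi> (i, j, k, \<alpha>, \<beta>, \<gamma>). edge_fun F q) < \<mu> * card (triad_tuples A \<psi> (i, j, k, \<alpha>, \<beta>, \<gamma>))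
      \<or> (1 - \<mu>) * card (triad_tuples A \<psi> (i, j, k, \<alpha>, \<beta>, \<gamma>)) < (\<Sum>q\<in>triad_tuples A \<psi> (i, j, k, \<alpha>, \<beta>, \<gamma>). edge_fun F q)"
  shows "good_triple t l A (edge_class A \<psi>) \<epsilon>' \<mu> F ((\<lambda>(x, y, z). {x, y, z}) q)"
proof -
  let ?O = "triad_tuples A \<psi> (i, j, k, \<alpha>, \<beta>, \<gamma>)" and ?s = "\<lambda>(x, y, z). {x, y, z}"
  have ik: "i < k" using ijk by simp
  define K where "K = K3 (triad A (edge_class A \<psi>) i j k \<alpha> \<beta> \<gamma>)"
  have K: "K = ?s ` ?O" unfolding K_def by (rule K3_triad_edge_class(1)[OF ijk(2,3) disj])
  have inj: "inj_on ?s ?O" by (rule K3_triad_edge_class(2)[OF ijk(2,3) disj])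
  have disc: "disc2_density \<epsilon>' (1 / real l) U W {{x, y} | x y. x \<in> U \<and> y \<in> W \<and> \<phi> (x, y) = c}"
    if sp: "split_pair M l (\<epsilon> / 2) U W \<kappa> \<phi> X" and fin: "finite U" "finite W" and disj: "U \<inter> W = {}" and c: "c \<in> {1..l}"
    for U W :: "'a set" and \<phi> X c
  proof (rule disc2_densityI[OF fin disj refl])
    fix U' W' assume "U' \<subseteq> U" "W' \<subseteq> W"
    then have "\<bar>real (card {b \<in> U' \<times> W'. \<phi> b = c}) - 1 / real l * real (card U') * real (card W')\<bar>
        \<le> \<epsilon> / 2 * real (card U) * real (card W)" using sp c unfolding split_pair_def by blast
    also have "\<dots> \<le> \<epsilon>' / 2 * real (card U) * real (card W)" using \<epsilon> by (intro mult_right_mono) auto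
    finally show "\<bar>real (card {b \<in> U' \<times> W'. \<phi> b = c}) - 1 / real l * real (card U') * real (card W')\<bar>
        \<le> \<epsilon>' / 2 * real (card U) * real (card W)" .
  qed (use \<epsilon> in simp)
  have cnt: "real (card {b \<in> U' \<times> W'. \<phi> b = c}) \<le> 1 / real l * real (card U') * real (card W') + \<epsilon> / 2 * real (card U) * real (card W)"
    if "split_pair M l (\<epsilon> / 2) U W \<kappa> \<phi> X" "c \<in> {1..l}" "U' \<subseteq> U" "W' \<subseteq> W" for U W U' W' :: "'a set" and \<phi> X c
  proof -
    have "\<bar>real (card {b \<in> U' \<times> W'. \<phi> b = c}) - 1 / real l * real (card U') * real (card W')\<bar>
        \<le> \<epsilon> / 2 * real (card U) * real (card W)" using that unfolding split_pair_def by blast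
    then show ?thesis by linarith
  qed
  have cK: "card K = card ?O" unfolding K using inj by (rule card_image)
  have O_eq: "?O = {(x, y, z) \<in> A i \<times> A j \<times> A k. \<psi> i j (x, y) = \<alpha> \<and> \<psi> i k (x, z) = \<beta> \<and> \<psi> j k (y, z) = \<gamma>}"
    by (simp add: triad_tuples_def)
  have finO: "finite ?O" unfolding O_eq by (rule finite_subset[of _ "A i \<times> A j \<times> A k"]) (use fin in auto)
  have "real (card ?O) \<le> ((1 / real l) ^ 3 + 3 * (\<epsilon> / 2)) * real (card (A i)) * real (card (A j)) * real (card (A k))"
    unfolding O_eq
    by (rule card_triangles_le[OF fin, of "1 / real l" "\<epsilon> / 2" "\<lambda>b. \<psi> i j b = \<alpha>" "\<lambda>b. \<psi> i k b = \<beta>" "\<lambda>b. \<psi> j k b = \<gamma>"])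
      (use l \<epsilon> cnt[OF sp(1) abg(1)] cnt[OF sp(2) abg(2)] cnt[OF sp(3) abg(3)] in auto)
  also have "\<dots> \<le> (2 * (1 / real l) ^ 3) * real (card (A i)) * real (card (A j)) * real (card (A k))"
    using \<epsilon> by (intro mult_right_mono) auto
  finally have K_le: "real (card K) \<le> 2 * (1 / real l) ^ 3 * real (card (A i)) * real (card (A j)) * real (card (A k))"
    unfolding cK .
  have cF: "real (card (F \<inter> K)) = (\<Sum>q\<in>?O. edge_fun F q)"
  proof -
    have "F \<inter> K = ?s ` {q \<in> ?O. ?s q \<in> F}" unfolding K by auto
    then have "card (F \<inter> K) = card {q \<in> ?O. ?s q \<in> F}"
      using inj by (simp add: card_image inj_on_subset)
    moreover have "edge_fun F q = of_bool (?s q \<in> F)" for q by (simp add: edge_fun_def split: prod.splits)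
    ultimately show ?thesis using finO by (simp add: Int_def)
  qed
  have cO: "real (card ?O) > 0" using q finO by (auto simp: card_gt_0_iff)
  have "(\<Sum>q\<in>?O. edge_fun F q) \<le> (\<Sum>q\<in>?O. 1)" by (intro sum_mono) (auto simp: edge_fun_def)
  moreover have "0 \<le> (\<Sum>q\<in>?O. edge_fun F q)" by (intro sum_nonneg) (auto simp: edge_fun_def)
  ultimately have "real (card (F \<inter> K)) / real (card K) \<in> {0..<\<mu>} \<union> {1 - \<mu><..1}"
    using hom cO unfolding cK cF by (auto simp: divide_less_eq less_divide_eq divide_le_eq)
  moreover have "?s q \<in> K" using q unfolding K by blast
  moreover have "disc2_density \<epsilon>' (1 / real l) (A i) (A j) (edge_class A \<psi> {i, j} \<alpha>)"
    unfolding edge_class_pair[OF ijk(2)] by (rule disc[OF sp(1) fin(1,2) disj(1) abg(1)])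
  moreover have "disc2_density \<epsilon>' (1 / real l) (A i) (A k) (edge_class A \<psi> {i, k} \<beta>)"
    unfolding edge_class_pair[OF ik] by (rule disc[OF sp(2) fin(1,3) disj(2) abg(2)])
  moreover have "disc2_density \<epsilon>' (1 / real l) (A j) (A k) (edge_class A \<psi> {j, k} \<gamma>)"
    unfolding edge_class_pair[OF ijk(3)] by (rule disc[OF sp(3) fin(2,3) disj(3) abg(3)])
  ultimately show ?thesis
    unfolding good_triple_def Let_def using ijk abg K_le unfolding K_def by blast
qed

text \<open>The three terms count pairs inside a part, pairs between irregular parts and pairs with
  an exceptional label. A product of two parts has at most \<open>4 * n\<^sup>2 / t\<^sup>2\<close>
  elements, where \<open>n = card V\<close>; there are \<open>t\<close> products of the first kind
  and at most \<open>\<eta> * t\<^sup>2\<close> of the second, and each of at most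
  \<open>M + 1\<close> exceptional labels takes a share of at most \<open>2 / l\<close>.\<close>

lemma card_bad_pairs_le:
  fixes \<epsilon> \<eta> :: real
  assumes fin: "finite V" and eq: "equitable t A V" and t: "1 \<le> t" "t \<le> card V"
    and Bad: "Bad \<subseteq> {1..t} \<times> {1..t}" "real (card Bad) \<le> \<eta> * real t ^ 2"
    and sp: "\<And>i j. (i, j) \<in> {1..t} \<times> {1..t} - Bad \<Longrightarrow> split_pair M l \<epsilon> (A i) (A j) \<kappa> (\<psi> i j) (X i j)"
    and l: "1 \<le> l" and \<epsilon>: "\<epsilon> \<le> 1 / real l"
  shows "real (card ((\<Union>i\<in>{1..t}. A i \<times> A i) \<union> (\<Union>(i, j)\<in>Bad. A i \<times> A j) \<union>
      (\<Union>(i, j)\<in>{1..t} \<times> {1..t} - Bad. \<Union>\<alpha>\<in>X i j. {b \<in> A i \<times> A j. \<psi> i j b = \<alpha>})))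
    \<le> (4 / real t + 4 * \<eta> + 8 * (real M + 1) / real l) * (real (card V))\<^sup>2"
proof -
  let ?n = "real (card V)"
  have AV: "A i \<subseteq> V" if "i \<in> {1..t}" for i using eq that by (auto simp: equitable_def)
  have fA: "finite (A i)" if "i \<in> {1..t}" for i using AV[OF that] fin finite_subset by blast
  have cA: "real (card (A i)) \<le> 2 * ?n / real t" if "i \<in> {1..t}" for i
    using equitable_card_bounds[OF eq t that] by simp
  define s where "s = 4 * ?n\<^sup>2 / (real t)\<^sup>2"
  have s0: "0 \<le> s" by (simp add: s_def)
  have cAA: "real (card (A i)) * real (card (A j)) \<le> s" if "i \<in> {1..t}" "j \<in> {1..t}" for i j
  proof -
    have "real (card (A i)) * real (card (A j)) \<le> (2 * ?n / real t) * (2 * ?n / real t)"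
      using cA that by (intro mult_mono) auto
    then show ?thesis by (simp add: s_def power2_eq_square)
  qed
  have fBad: "finite Bad" using Bad(1) finite_subset by blast
  let ?R = "{1..t} \<times> {1..t} - Bad"
  let ?S1 = "\<Union>i\<in>{1..t}. A i \<times> A i" and ?S2 = "\<Union>(i, j)\<in>Bad. A i \<times> A j"
    and ?S3 = "\<Union>(i, j)\<in>?R. \<Union>\<alpha>\<in>X i j. {b \<in> A i \<times> A j. \<psi> i j b = \<alpha>}"
  have "real (card ?S1) \<le> (\<Sum>i\<in>{1..t}. real (card (A i \<times> A i)))"
    using card_UN_le[of "{1..t}" "\<lambda>i. A i \<times> A i"] of_nat_le_iff[where 'a=real] by (simp flip: of_nat_sum)
  also have "\<dots> \<le> (\<Sum>i\<in>{1..t}. s)" using cAA by (intro sum_mono) (simp add: card_cartesian_product)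
  finally have 1: "real (card ?S1) \<le> real t * s" by simp
  have "real (card ?S2) \<le> (\<Sum>(i, j)\<in>Bad. real (card (A i \<times> A j)))"
    using card_UN_le[OF fBad, of "\<lambda>(i, j). A i \<times> A j"] of_nat_le_iff[where 'a=real]
    by (simp add: case_prod_unfold flip: of_nat_sum)
  also have "\<dots> \<le> (\<Sum>e\<in>Bad. s)" using cAA Bad(1) by (intro sum_mono) (auto simp: card_cartesian_product)
  also have "\<dots> \<le> \<eta> * real t ^ 2 * s" using Bad(2) s0 by (simp add: mult_right_mono)
  finally have 2: "real (card ?S2) \<le> \<eta> * real t ^ 2 * s" .
  have X: "X i j \<subseteq> {1..l}" "card (X i j) \<le> M + 1" if "(i, j) \<in> ?R" for i j
    using sp[OF that] unfolding split_pair_def by blast+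
  have one: "real (card {b \<in> A i \<times> A j. \<psi> i j b = \<alpha>}) \<le> 2 / real l * s" if ij: "(i, j) \<in> ?R" and \<alpha>: "\<alpha> \<in> X i j" for i j \<alpha>
  proof -
    have "\<alpha> \<in> {1..l}" using X(1)[OF ij] \<alpha> by blast
    then have "\<bar>real (card {b \<in> A i \<times> A j. \<psi> i j b = \<alpha>}) - 1 / real l * real (card (A i)) * real (card (A j))\<bar>
        \<le> \<epsilon> * real (card (A i)) * real (card (A j))"
      using sp[OF ij] unfolding split_pair_def by blast
    then have "real (card {b \<in> A i \<times> A j. \<psi> i j b = \<alpha>}) \<le> (1 / real l + \<epsilon>) * (real (card (A i)) * real (card (A j)))"
      by (simp add: distrib_right mult.assoc)
    also have "\<dots> \<le> 2 / real l * (real (card (A i)) * real (card (A j)))" using \<epsilon> by (intro mult_right_mono) auto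
    also have "\<dots> \<le> 2 / real l * s" using cAA ij by (intro mult_left_mono) auto
    finally show ?thesis .
  qed
  have "real (card ?S3) \<le> (\<Sum>(i, j)\<in>?R. real (card (\<Union>\<alpha>\<in>X i j. {b \<in> A i \<times> A j. \<psi> i j b = \<alpha>})))"
    using card_UN_le[of ?R "\<lambda>(i, j). \<Union>\<alpha>\<in>X i j. {b \<in> A i \<times> A j. \<psi> i j b = \<alpha>}"] of_nat_le_iff[where 'a=real]
    by (simp add: case_prod_unfold flip: of_nat_sum)
  also have "\<dots> \<le> (\<Sum>e\<in>?R. (real M + 1) * (2 / real l * s))"
  proof (rule sum_mono)
    fix e assume e: "e \<in> ?R"
    obtain i j where ij: "e = (i, j)" by (cases e)
    have fX: "finite (X i j)" using X(1)[of i j] e ij finite_subset by blast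
    have "real (card (\<Union>\<alpha>\<in>X i j. {b \<in> A i \<times> A j. \<psi> i j b = \<alpha>})) \<le> (\<Sum>\<alpha>\<in>X i j. real (card {b \<in> A i \<times> A j. \<psi> i j b = \<alpha>}))"
      using card_UN_le[OF fX, of "\<lambda>\<alpha>. {b \<in> A i \<times> A j. \<psi> i j b = \<alpha>}"] of_nat_le_iff[where 'a=real] by (simp flip: of_nat_sum)
    also have "\<dots> \<le> (\<Sum>\<alpha>\<in>X i j. 2 / real l * s)" using one e ij by (intro sum_mono) auto
    also have "\<dots> = real (card (X i j)) * (2 / real l * s)" by simp
    also have "\<dots> \<le> (real M + 1) * (2 / real l * s)" using X(2)[of i j] e ij s0 by (intro mult_right_mono) auto
    finally show "(case e of (i, j) \<Rightarrow> real (card (\<Union>\<alpha>\<in>X i j. {b \<in> A i \<times> A j. \<psi> i j b = \<alpha>}))) \<le> (real M + 1) * (2 / real l * s)"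
      by (simp add: ij)
  qed
  also have "\<dots> = real (card ?R) * ((real M + 1) * (2 / real l * s))" by simp
  also have "\<dots> \<le> real t ^ 2 * ((real M + 1) * (2 / real l * s))"
  proof (rule mult_right_mono)
    have "card ?R \<le> card ({1..t} \<times> {1..t})" by (intro card_mono) auto
    also have "\<dots> = t * t" by (simp add: card_cartesian_product)
    finally show "real (card ?R) \<le> real t ^ 2" by (simp add: power2_eq_square flip: of_nat_mult)
  qed (use s0 in simp)
  finally have 3: "real (card ?S3) \<le> real t ^ 2 * ((real M + 1) * (2 / real l * s))" .
  have "real (card (?S1 \<union> ?S2 \<union> ?S3)) \<le> real (card ?S1) + real (card ?S2) + real (card ?S3)"
    using card_Un_le[of "?S1 \<union> ?S2" ?S3] card_Un_le[of ?S1 ?S2] by linarith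
  also have "\<dots> \<le> real t * s + \<eta> * real t ^ 2 * s + real t ^ 2 * ((real M + 1) * (2 / real l * s))"
    using 1 2 3 by linarith
  also have "\<dots> = (4 / real t + 4 * \<eta> + 8 * (real M + 1) / real l) * ?n\<^sup>2"
    using t l unfolding s_def by (simp add: field_simps power2_eq_square)
  finally show ?thesis .
qed

text \<open>A triple that is not good contains a bad pair or lies in a triad of intermediate
  density. With \<open>n = card V\<close>, the at most \<open>\<mu> / 4 * n\<^sup>2\<close> bad
  pairs spoil at most \<open>3 / 4 * \<mu> * n ^ 3\<close> ordered triples. The L1 distance of
  \<open>f\<close> and \<open>h\<close> is at most \<open>\<mu>\<^sup>2 / 4 * n ^ 3\<close>, so the
  triads of intermediate density hold at most \<open>\<mu> / 4 * n ^ 3\<close> further ones.\<close>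

lemma card_not_good_triples_le:
  fixes \<epsilon> \<epsilon>' \<eta> \<mu> :: real
  assumes fin: "finite V" and eq: "equitable t A V" and t: "1 \<le> t" "t \<le> card V"
    and Bad: "Bad \<subseteq> {1..t} \<times> {1..t}" "real (card Bad) \<le> \<eta> * real t ^ 2"
    and \<psi>: "\<And>i j b. i \<in> {1..t} \<Longrightarrow> j \<in> {1..t} \<Longrightarrow> b \<in> A i \<times> A j \<Longrightarrow> \<psi> i j b \<in> {1..l}"
    and sp: "\<And>i j. (i, j) \<in> {1..t} \<times> {1..t} - Bad \<Longrightarrow> split_pair M l (\<epsilon> / 2) (A i) (A j) \<kappa> (\<psi> i j) (X i j)"
    and l: "1 \<le> l" and \<epsilon>: "0 < \<epsilon>" "\<epsilon> \<le> \<epsilon>'" "3 / 2 * \<epsilon> \<le> (1 / real l) ^ 3"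
    and \<kappa>: "\<And>b b'. \<kappa> b = \<kappa> b' \<Longrightarrow> \<kappa>1 b = \<kappa>1 b' \<and> \<kappa>2 b = \<kappa>2 b' \<and> \<kappa>3 b = \<kappa>3 b'"
    and h: "h = cond_avg (V \<times> V \<times> V) (cyl_map \<kappa>1 \<kappa>2 \<kappa>3) (edge_fun F)"
    and h_le: "(\<Sum>q\<in>V\<times>V\<times>V. h q * (1 - h q)) \<le> \<mu>\<^sup>2 / 8 * real (card V) ^ 3"
    and \<mu>: "0 < \<mu>"
    and small: "4 / real t + 4 * \<eta> + 8 * (real M + 1) / real l \<le> \<mu> / 4"
  shows "real (card {T \<in> nsets V 3. \<not> good_triple t l A (edge_class A \<psi>) \<epsilon>' \<mu> F T}) \<le> \<mu> * real (card V) ^ 3"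
proof -
  let ?n = "real (card V)" and ?f = "edge_fun F" and ?\<Omega> = "V \<times> V \<times> V" and ?s = "\<lambda>(x, y, z). {x, y, z}"
  have fin\<Omega>: "finite ?\<Omega>" using fin by simp
  have AV: "A i \<subseteq> V" if "i \<in> {1..t}" for i using eq that by (auto simp: equitable_def)
  have fA: "finite (A i)" if "i \<in> {1..t}" for i using AV[OF that] fin finite_subset by blast
  have disj: "A i \<inter> A j = {}" if "i \<in> {1..t}" "j \<in> {1..t}" "i \<noteq> j" for i j
    using eq that unfolding equitable_def disjoint_family_on_def by blast
  define B where "B = (\<Union>i\<in>{1..t}. A i \<times> A i) \<union> (\<Union>(i, j)\<in>Bad. A i \<times> A j) \<union>
      (\<Union>(i, j)\<in>{1..t} \<times> {1..t} - Bad. \<Union>\<alpha>\<in>X i j. {b \<in> A i \<times> A j. \<psi> i j b = \<alpha>})"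
  have l3: "(1 / real l) ^ 3 \<le> 1 / real l" using l power_decreasing[of 1 3 "1 / real l"] by simp
  have cB: "real (card B) \<le> \<mu> / 4 * ?n\<^sup>2"
  proof -
    have "\<epsilon> / 2 \<le> 1 / real l" using \<epsilon> l3 by linarith
    then have "real (card B) \<le> (4 / real t + 4 * \<eta> + 8 * (real M + 1) / real l) * ?n\<^sup>2"
      unfolding B_def by (intro card_bad_pairs_le[OF fin eq t Bad, where \<epsilon>="\<epsilon> / 2" and \<kappa>=\<kappa>] sp l)
    also have "\<dots> \<le> \<mu> / 4 * ?n\<^sup>2" using small by (intro mult_right_mono) auto
    finally show ?thesis .
  qed
  have BX: "b \<in> B" if "i \<in> {1..t}" "j \<in> {1..t}" "(i, j) \<notin> Bad" "b \<in> A i \<times> A j" "\<psi> i j b \<in> X i j" for i j b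
  proof -
    have "b \<in> (\<Union>\<alpha>\<in>X i j. {b \<in> A i \<times> A j. \<psi> i j b = \<alpha>})" using that by blast
    then show ?thesis unfolding B_def using that(1-3) by blast
  qed
  have BV: "B \<subseteq> V \<times> V" using AV Bad(1) unfolding B_def by blast
  define B3 where "B3 = {(x, y, z) \<in> V \<times> V \<times> V. (x, y) \<in> B \<or> (x, z) \<in> B \<or> (y, z) \<in> B}"
  have cB3: "real (card B3) \<le> 3 / 4 * \<mu> * ?n ^ 3"
  proof -
    have "real (card B3) \<le> real (3 * card V * card B)"
      unfolding B3_def using card_triples_meeting_le[OF fin BV] by (intro of_nat_mono)
    also have "\<dots> = 3 * ?n * real (card B)" by simp
    also have "\<dots> \<le> 3 * ?n * (\<mu> / 4 * ?n\<^sup>2)" using cB by (intro mult_left_mono) auto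
    finally show ?thesis by (simp add: power2_eq_square power3_eq_cube mult_ac)
  qed
  \<comment> \<open>Triads with regular pairs and unexceptional labels. There the labels determine
    the colours under \<open>\<kappa>\<close>, so the triad lies in one cell and \<open>h\<close> is
    constant on it.\<close>
  define I where "I = {(i, j, k, \<alpha>, \<beta>, \<gamma>). i \<in> {1..t} \<and> j \<in> {1..t} \<and> k \<in> {1..t} \<and> i < j \<and> j < k \<and>
    (i, j) \<notin> Bad \<and> (i, k) \<notin> Bad \<and> (j, k) \<notin> Bad \<and>
    \<alpha> \<in> {1..l} - X i j \<and> \<beta> \<in> {1..l} - X i k \<and> \<gamma> \<in> {1..l} - X j k}"
  have finI: "finite I"
    by (rule finite_subset[of _ "{1..t} \<times> {1..t} \<times> {1..t} \<times> {1..l} \<times> {1..l} \<times> {1..l}"]) (auto simp: I_def)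
  let ?O = "triad_tuples A \<psi>"
  define S where "S = {\<tau> \<in> I. \<mu> * card (?O \<tau>) \<le> (\<Sum>q\<in>?O \<tau>. ?f q) \<and> (\<Sum>q\<in>?O \<tau>. ?f q) \<le> (1 - \<mu>) * card (?O \<tau>)}"
  have SI: "S \<subseteq> I" by (auto simp: S_def)
  have f01: "?f q = 0 \<or> ?f q = 1" for q by (cases q) (simp add: edge_fun_def)
  have "\<mu> * real (card (\<Union>\<tau>\<in>S. ?O \<tau>)) \<le> (\<Sum>q\<in>?\<Omega>. \<bar>?f q - h q\<bar>)"
  proof (rule card_nonhomogeneous_cells_le[OF fin\<Omega>])
    show "finite S" using finI SI finite_subset by blast
    show "?f q = 0 \<or> ?f q = 1" for q by (rule f01)
    show "?O \<tau> \<subseteq> ?\<Omega>" if "\<tau> \<in> S" for \<tau>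
      using that SI AV unfolding I_def triad_tuples_def by fastforce
    show "?O \<tau> \<inter> ?O \<tau>' = {}" if "\<tau> \<in> S" "\<tau>' \<in> S" "\<tau> \<noteq> \<tau>'" for \<tau> \<tau>'
    proof (rule ccontr)
      obtain i j k \<alpha> \<beta> \<gamma> where \<tau>: "\<tau> = (i, j, k, \<alpha>, \<beta>, \<gamma>)" by (cases \<tau>)
      obtain i' j' k' \<alpha>' \<beta>' \<gamma>' where \<tau>': "\<tau>' = (i', j', k', \<alpha>', \<beta>', \<gamma>')" by (cases \<tau>')
      assume "?O \<tau> \<inter> ?O \<tau>' \<noteq> {}"
      then obtain x y z where 1: "(x, y, z) \<in> ?O \<tau>" and 2: "(x, y, z) \<in> ?O \<tau>'" by auto
      have ii: "i \<in> {1..t}" "j \<in> {1..t}" "k \<in> {1..t}" "i' \<in> {1..t}" "j' \<in> {1..t}" "k' \<in> {1..t}"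
        using that SI unfolding I_def \<tau> \<tau>' by auto
      have "x \<in> A i" "x \<in> A i'" "y \<in> A j" "y \<in> A j'" "z \<in> A k" "z \<in> A k'"
        using 1 2 unfolding \<tau> \<tau>' triad_tuples_def by auto
      then have "i = i'" "j = j'" "k = k'" using disj ii by blast+
      then have "\<tau> = \<tau>'" using 1 2 unfolding \<tau> \<tau>' triad_tuples_def by auto
      then show False using that by simp
    qed
    show "h q = h q'" if \<tau>S: "\<tau> \<in> S" and q: "q \<in> ?O \<tau>" and q': "q' \<in> ?O \<tau>" for \<tau> q q'
    proof -
      obtain i j k \<alpha> \<beta> \<gamma> where \<tau>: "\<tau> = (i, j, k, \<alpha>, \<beta>, \<gamma>)" by (cases \<tau>)
      obtain x y z where xyz: "q = (x, y, z)" by (cases q)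
      obtain x' y' z' where xyz': "q' = (x', y', z')" by (cases q')
      have mono: "\<kappa> b = \<kappa> b'" if "(i, j) \<in> {1..t} \<times> {1..t} - Bad" "\<alpha> \<in> {1..l} - X i j"
        "b \<in> A i \<times> A j" "b' \<in> A i \<times> A j" "\<psi> i j b = \<alpha>" "\<psi> i j b' = \<alpha>" for i j \<alpha> b b'
        using sp[OF that(1)] that(2-) unfolding split_pair_def by metis
      have I': "(i, j) \<in> {1..t} \<times> {1..t} - Bad" "(i, k) \<in> {1..t} \<times> {1..t} - Bad" "(j, k) \<in> {1..t} \<times> {1..t} - Bad"
        "\<alpha> \<in> {1..l} - X i j" "\<beta> \<in> {1..l} - X i k" "\<gamma> \<in> {1..l} - X j k"
        using \<tau>S SI unfolding I_def \<tau> by auto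
      have m: "(x, y) \<in> A i \<times> A j" "(x', y') \<in> A i \<times> A j" "(x, z) \<in> A i \<times> A k" "(x', z') \<in> A i \<times> A k"
        "(y, z) \<in> A j \<times> A k" "(y', z') \<in> A j \<times> A k"
        "\<psi> i j (x, y) = \<alpha>" "\<psi> i j (x', y') = \<alpha>" "\<psi> i k (x, z) = \<beta>" "\<psi> i k (x', z') = \<beta>"
        "\<psi> j k (y, z) = \<gamma>" "\<psi> j k (y', z') = \<gamma>"
        using q q' unfolding \<tau> xyz xyz' triad_tuples_def by auto
      have "\<kappa> (x, y) = \<kappa> (x', y')" by (rule mono[OF I'(1,4) m(1,2,7,8)])
      moreover have "\<kappa> (x, z) = \<kappa> (x', z')" by (rule mono[OF I'(2,5) m(3,4,9,10)])
      moreover have "\<kappa> (y, z) = \<kappa> (y', z')" by (rule mono[OF I'(3,6) m(5,6,11,12)])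
      ultimately have "\<kappa>1 (x, y) = \<kappa>1 (x', y')" "\<kappa>2 (x, z) = \<kappa>2 (x', z')" "\<kappa>3 (y, z) = \<kappa>3 (y', z')"
        using \<kappa> by blast+
      then show ?thesis unfolding h xyz xyz' by (intro cond_avg_cong) (simp add: cyl_map_def)
    qed
    show "0 \<le> h q \<and> h q \<le> 1" for q
      unfolding h by (intro conjI cond_avg_bounds fin\<Omega>) (use f01 in \<open>metis order_refl zero_le_one\<close>)+
    show "\<mu> * card (?O \<tau>) \<le> (\<Sum>q\<in>?O \<tau>. ?f q) \<and> (\<Sum>q\<in>?O \<tau>. ?f q) \<le> (1 - \<mu>) * card (?O \<tau>)" if "\<tau> \<in> S" for \<tau>
      using that by (simp add: S_def)
  qed
  also have "\<dots> = 2 * (\<Sum>q\<in>?\<Omega>. h q * (1 - h q))" unfolding h by (rule sum_abs_cond_avg_diff[OF fin\<Omega> f01])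
  also have "\<dots> \<le> \<mu> * (\<mu> / 4 * ?n ^ 3)" using h_le by (simp add: power2_eq_square)
  finally have cS: "real (card (\<Union>\<tau>\<in>S. ?O \<tau>)) \<le> \<mu> / 4 * ?n ^ 3" using \<mu> by (simp only: mult_le_cancel_left_pos)
  have "\<forall>x\<in>V. \<exists>i. i \<in> {1..t} \<and> x \<in> A i" using eq unfolding equitable_def by blast
  then obtain ix where ix: "\<And>x. x \<in> V \<Longrightarrow> ix x \<in> {1..t} \<and> x \<in> A (ix x)" by metis
  have finU: "finite (B3 \<union> (\<Union>\<tau>\<in>S. ?O \<tau>))"
  proof -
    have "finite B3" unfolding B3_def by (rule finite_subset[OF _ fin\<Omega>]) auto
    moreover have "finite (?O \<tau>)" if "\<tau> \<in> S" for \<tau>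
    proof -
      obtain i j k \<alpha> \<beta> \<gamma> where \<tau>: "\<tau> = (i, j, k, \<alpha>, \<beta>, \<gamma>)" by (cases \<tau>)
      have "finite (A i \<times> A j \<times> A k)" using that SI fA unfolding I_def \<tau> by auto
      then show ?thesis by (rule rev_finite_subset) (auto simp: \<tau> triad_tuples_def)
    qed
    ultimately show ?thesis using finI SI finite_subset by blast
  qed
  have "{T \<in> nsets V 3. \<not> good_triple t l A (edge_class A \<psi>) \<epsilon>' \<mu> F T} \<subseteq> ?s ` (B3 \<union> (\<Union>\<tau>\<in>S. ?O \<tau>))"
  proof (rule subsetI, elim CollectE conjE)
    fix T assume T3: "T \<in> nsets V 3" and ng: "\<not> good_triple t l A (edge_class A \<psi>) \<epsilon>' \<mu> F T"
    obtain x y z where T: "T = {x, y, z}" and V: "x \<in> V" "y \<in> V" "z \<in> V" and le: "ix x \<le> ix y" "ix y \<le> ix z"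
      using ex_ordered_triple[OF T3, of ix] by blast
    define i j k where "i = ix x" and "j = ix y" and "k = ix z"
    have iA: "i \<in> {1..t}" "j \<in> {1..t}" "k \<in> {1..t}" "x \<in> A i" "y \<in> A j" "z \<in> A k"
      using ix V by (auto simp: i_def j_def k_def)
    have "(x, y, z) \<in> B3 \<union> (\<Union>\<tau>\<in>S. ?O \<tau>)"
    proof (rule ccontr)
      assume neg: "(x, y, z) \<notin> B3 \<union> (\<Union>\<tau>\<in>S. ?O \<tau>)"
      then have nB: "(x, y) \<notin> B" "(x, z) \<notin> B" "(y, z) \<notin> B" using V by (auto simp: B3_def)
      have ij: "i < j" "j < k"
      proof -
        have "i \<noteq> j" using nB(1) iA unfolding B_def by auto
        moreover have "j \<noteq> k" using nB(3) iA unfolding B_def by auto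
        ultimately show "i < j" "j < k" using le by (auto simp: i_def j_def k_def)
      qed
      have nBad: "(i, j) \<notin> Bad" "(i, k) \<notin> Bad" "(j, k) \<notin> Bad" using nB iA unfolding B_def by auto
      define \<alpha> \<beta> \<gamma> where "\<alpha> = \<psi> i j (x, y)" and "\<beta> = \<psi> i k (x, z)" and "\<gamma> = \<psi> j k (y, z)"
      have abg: "\<alpha> \<in> {1..l}" "\<beta> \<in> {1..l}" "\<gamma> \<in> {1..l}" using \<psi> iA by (auto simp: \<alpha>_def \<beta>_def \<gamma>_def)
      have nX: "\<alpha> \<notin> X i j" "\<beta> \<notin> X i k" "\<gamma> \<notin> X j k"
        using nB iA nBad BX[of i j "(x, y)"] BX[of i k "(x, z)"] BX[of j k "(y, z)"]
        unfolding \<alpha>_def \<beta>_def \<gamma>_def by auto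
      have \<tau>I: "(i, j, k, \<alpha>, \<beta>, \<gamma>) \<in> I" using iA ij nBad abg nX unfolding I_def by auto
      have q: "(x, y, z) \<in> ?O (i, j, k, \<alpha>, \<beta>, \<gamma>)" using iA by (auto simp: triad_tuples_def \<alpha>_def \<beta>_def \<gamma>_def)
      then have "(i, j, k, \<alpha>, \<beta>, \<gamma>) \<notin> S" using neg by blast
      then have hom: "(\<Sum>q\<in>?O (i, j, k, \<alpha>, \<beta>, \<gamma>). ?f q) < \<mu> * card (?O (i, j, k, \<alpha>, \<beta>, \<gamma>))
        \<or> (1 - \<mu>) * card (?O (i, j, k, \<alpha>, \<beta>, \<gamma>)) < (\<Sum>q\<in>?O (i, j, k, \<alpha>, \<beta>, \<gamma>). ?f q)"
        using \<tau>I unfolding S_def by auto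
      have ijk': "1 \<le> i" "k \<le> t" "i \<noteq> j" "i \<noteq> k" "j \<noteq> k" using iA ij by auto
      have sps: "split_pair M l (\<epsilon> / 2) (A i) (A j) \<kappa> (\<psi> i j) (X i j)" "split_pair M l (\<epsilon> / 2) (A i) (A k) \<kappa> (\<psi> i k) (X i k)"
        "split_pair M l (\<epsilon> / 2) (A j) (A k) \<kappa> (\<psi> j k) (X j k)" using iA nBad by (auto intro: sp)
      have "good_triple t l A (edge_class A \<psi>) \<epsilon>' \<mu> F (?s (x, y, z))"
        by (rule good_triple_of_split[OF fA[OF iA(1)] fA[OF iA(2)] fA[OF iA(3)] disj[OF iA(1,2) ijk'(3)]
            disj[OF iA(1,3) ijk'(4)] disj[OF iA(2,3) ijk'(5)] ijk'(1) ij ijk'(2) l sps abg \<epsilon> q hom])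
      then show False using ng T by simp
    qed
    then show "T \<in> ?s ` (B3 \<union> (\<Union>\<tau>\<in>S. ?O \<tau>))" by (rule rev_image_eqI) (simp add: T)
  qed
  then have "card {T \<in> nsets V 3. \<not> good_triple t l A (edge_class A \<psi>) \<epsilon>' \<mu> F T} \<le> card (?s ` (B3 \<union> (\<Union>\<tau>\<in>S. ?O \<tau>)))"
    using finU by (intro card_mono) auto
  also have "\<dots> \<le> card (B3 \<union> (\<Union>\<tau>\<in>S. ?O \<tau>))" by (rule card_image_le[OF finU])
  also have "\<dots> \<le> card B3 + card (\<Union>\<tau>\<in>S. ?O \<tau>)" by (rule card_Un_le)
  finally have "real (card {T \<in> nsets V 3. \<not> good_triple t l A (edge_class A \<psi>) \<epsilon>' \<mu> F T})
      \<le> real (card B3) + real (card (\<Union>\<tau>\<in>S. ?O \<tau>))" by linarith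
  also have "\<dots> \<le> \<mu> * ?n ^ 3" using cB3 cS by linarith
  finally show ?thesis .
qed

theorem ex_decomposition_good_triples:
  fixes \<mu> :: real and \<epsilon>2 :: "nat \<Rightarrow> real"
  assumes \<mu>: "0 < \<mu>" and \<epsilon>2_all: "\<forall>n. 0 < \<epsilon>2 n \<and> \<epsilon>2 n \<le> 1"
  shows "\<exists>T L N. \<forall>V F. finite (V :: 'a set) \<and> \<not> VC2_shattered (V, F) k \<and> N \<le> card V \<longrightarrow>
    (\<exists>t l A \<psi>. t0 \<le> t \<and> 1 \<le> t \<and> t \<le> T \<and> l0 \<le> l \<and> 1 \<le> l \<and> l \<le> L \<and> equitable t A V \<and>
      (\<forall>i\<in>{1..t}. \<forall>j\<in>{1..t}. \<forall>b\<in>A i \<times> A j. \<psi> i j b \<in> {1..l}) \<and>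
      real (card {T \<in> nsets V 3. \<not> good_triple t l A (edge_class A \<psi>) (\<epsilon>2 l) \<mu> F T}) \<le> \<mu> * real (card V) ^ 3)"
proof -
  have \<epsilon>2: "0 < \<epsilon>2 n" "\<epsilon>2 n \<le> 1" for n using \<epsilon>2_all by auto
  have "0 < \<mu>\<^sup>2 / 8" using \<mu> by simp
  then obtain M0 where M0: "\<forall>V F. finite (V :: 'a set) \<and> V \<noteq> {} \<and> \<not> VC2_shattered (V, F) k \<longrightarrow>
    (\<exists>\<kappa>1 \<kappa>2 \<kappa>3. (\<forall>b. \<kappa>1 b < M0 \<and> \<kappa>2 b < M0 \<and> \<kappa>3 b < M0) \<and>
      (let h = cond_avg (V \<times> V \<times> V) (cyl_map \<kappa>1 \<kappa>2 \<kappa>3) (edge_fun F) in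
        (\<Sum>q\<in>V\<times>V\<times>V. h q * (1 - h q)) \<le> \<mu>\<^sup>2 / 8 * real (card V) ^ 3))"
    by (rule exE[OF VC2_bounded_cylinder_approximation])
  define M where "M = M0 * (M0 * M0)"
  \<comment> \<open>The factor 96 makes the last term of the bound on bad pairs at most
    \<open>\<mu> / 12\<close>; \<open>\<eta> \<le> \<mu> / 48\<close> and
    \<open>48 / \<mu> \<le> t\<close> do the same for the other two, together
    \<open>\<mu> / 4\<close>.\<close>
  define l where "l = Suc (max l0 (nat \<lceil>96 * (real M + 1) / \<mu>\<rceil>))"
  have l: "l0 \<le> l" "1 \<le> l" "96 * (real M + 1) / \<mu> \<le> real l" unfolding l_def by (auto, linarith)
  have l_pos: "real l > 0" using l by simp
  define \<epsilon> where "\<epsilon> = min (\<epsilon>2 l) (2 / 3 * (1 / real l) ^ 3)"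
  have \<epsilon>: "0 < \<epsilon>" "\<epsilon> \<le> \<epsilon>2 l" "3 / 2 * \<epsilon> \<le> (1 / real l) ^ 3" "\<epsilon> \<le> 1"
    using \<epsilon>2[of l] l_pos unfolding \<epsilon>_def by (auto simp: min_def)
  \<comment> \<open>The second entry keeps the total error \<open>M * \<eta>\<close> of the colours
    within half of the accuracy \<open>\<epsilon> / 2\<close> demanded of the labels.\<close>
  define \<eta> where "\<eta> = min (\<mu> / 48) (\<epsilon> / (4 * (real M + 1)))"
  have "0 < \<epsilon> / (4 * (real M + 1))" using \<epsilon>(1) by (intro divide_pos_pos) auto
  then have \<eta>: "0 < \<eta>" "\<eta> \<le> \<mu> / 48" using \<mu> unfolding \<eta>_def by (simp_all only: min_less_iff_conj min.cobounded1) simp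
  have M\<eta>: "real M * \<eta> \<le> (\<epsilon> / 2) / 2"
  proof -
    have "\<eta> \<le> \<epsilon> / (4 * (real M + 1))" by (simp add: \<eta>_def)
    moreover have "0 < 4 * (real M + 1)" by simp
    ultimately have "\<eta> * (4 * (real M + 1)) \<le> \<epsilon>" by (simp only: pos_le_divide_eq)
    then have "4 * (real M * \<eta>) + 4 * \<eta> \<le> \<epsilon>" by (simp add: distrib_left mult_ac)
    then show ?thesis using \<eta>(1) by linarith
  qed
  define t1 where "t1 = max t0 (nat \<lceil>48 / \<mu>\<rceil>)"
  obtain T where T: "\<forall>V \<kappa>. finite (V :: 'a set) \<and> T \<le> card V \<and> (\<forall>b. \<kappa> b < M) \<longrightarrow>
    (\<exists>t A Bad. t1 \<le> t \<and> 1 \<le> t \<and> t \<le> T \<and> equitable t A V \<and> Bad \<subseteq> {1..t} \<times> {1..t} \<and> real (card Bad) \<le> \<eta> * real t ^ 2 \<and>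
    (\<forall>(i, j)\<in>{1..t} \<times> {1..t} - Bad. \<exists>D. regular_colouring M \<eta> (A i) (A j) \<kappa> D))"
    using regularity[OF \<eta>(1), of M t1] by (elim exE)
  obtain n0 where n0: "\<And>u w. n0 \<le> u \<Longrightarrow> n0 \<le> w \<Longrightarrow> 2 * real l * 2 ^ (u + w) < exp ((\<epsilon> / 2 / 2)\<^sup>2 * (real u * real w) / 4)"
    using ex_exp_product_gt[of "\<epsilon> / 2" l] \<epsilon>(1) by auto
  \<comment> \<open>A part has at least \<open>card V / (2 * t)\<close> vertices, so the summand
    \<open>2 * T * n0\<close> makes every part large enough for the random labels.\<close>
  define N where "N = T + 2 * T * n0 + 1"
  show ?thesis
  proof (rule exI[of _ T], rule exI[of _ l], rule exI[of _ N], intro allI impI, elim conjE)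
    fix V :: "'a set" and F
    assume V: "finite V" and nsh: "\<not> VC2_shattered (V, F) k" and N: "N \<le> card V"
    have Vne: "V \<noteq> {}" using N by (auto simp: N_def)
    have TV: "T \<le> card V" using N by (simp add: N_def)
    obtain \<kappa>1 \<kappa>2 \<kappa>3 where k3: "\<forall>b. \<kappa>1 b < M0 \<and> \<kappa>2 b < M0 \<and> \<kappa>3 b < M0"
      and h_le: "let h = cond_avg (V \<times> V \<times> V) (cyl_map \<kappa>1 \<kappa>2 \<kappa>3) (edge_fun F) in
        (\<Sum>q\<in>V\<times>V\<times>V. h q * (1 - h q)) \<le> \<mu>\<^sup>2 / 8 * real (card V) ^ 3"
      using mp[OF spec[OF spec[OF M0, of V], of F], OF conjI[OF V conjI[OF Vne nsh]]] by (elim exE conjE)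
    have "\<exists>\<kappa>. (\<forall>b. \<kappa> b < M0 * (M0 * M0)) \<and> (\<forall>b b'. \<kappa> b = \<kappa> b' \<longrightarrow> \<kappa>1 b = \<kappa>1 b' \<and> \<kappa>2 b = \<kappa>2 b' \<and> \<kappa>3 b = \<kappa>3 b')"
      using k3 by (intro ex_colouring_refining3) auto
    then obtain \<kappa> where \<kappa>M: "\<forall>b. \<kappa> b < M"
      and \<kappa>: "\<forall>b b'. \<kappa> b = \<kappa> b' \<longrightarrow> \<kappa>1 b = \<kappa>1 b' \<and> \<kappa>2 b = \<kappa>2 b' \<and> \<kappa>3 b = \<kappa>3 b'"
      unfolding M_def by (elim exE conjE)
    obtain t A Bad where t: "t1 \<le> t" "1 \<le> t" "t \<le> T" and eq: "equitable t A V"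
      and Bad: "Bad \<subseteq> {1..t} \<times> {1..t}" "real (card Bad) \<le> \<eta> * real t ^ 2"
      and reg: "\<forall>(i, j)\<in>{1..t} \<times> {1..t} - Bad. \<exists>D. regular_colouring M \<eta> (A i) (A j) \<kappa> D"
      using mp[OF spec[OF spec[OF T, of V], of \<kappa>], OF conjI[OF V conjI[OF TV \<kappa>M]]] by (elim exE conjE)
    have tV: "t \<le> card V" using t TV by simp
    have fA: "finite (A i)" if "i \<in> {1..t}" for i
      using eq that V unfolding equitable_def by (metis UN_upper finite_subset)
    have big: "n0 \<le> card (A i)" if "i \<in> {1..t}" for i
    proof -
      have "2 * t * n0 \<le> 2 * T * n0" using t by simp
      also have "\<dots> \<le> card V" using N by (simp add: N_def)
      finally have "real (2 * t * n0) \<le> real (card V)" using of_nat_le_iff by blast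
      then have "real n0 \<le> real (card V) / (2 * real t)" using t by (simp add: field_simps)
      also have "\<dots> \<le> real (card (A i))" by (rule equitable_card_bounds(1)[OF eq t(2) tV that])
      finally show ?thesis by simp
    qed
    define Pr where "Pr i j \<phi> X \<longleftrightarrow> (\<forall>b\<in>A i \<times> A j. \<phi> b \<in> {1..l}) \<and>
      ((i, j) \<notin> Bad \<longrightarrow> split_pair M l (\<epsilon> / 2) (A i) (A j) \<kappa> \<phi> X)" for i j \<phi> X
    have "\<exists>\<phi> X. i \<in> {1..t} \<and> j \<in> {1..t} \<longrightarrow> Pr i j \<phi> X" for i j
    proof (cases "(i, j) \<in> {1..t} \<times> {1..t} - Bad")
      case True
      then obtain D where D: "regular_colouring M \<eta> (A i) (A j) \<kappa> D" using reg by blast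
      have ij: "i \<in> {1..t}" "j \<in> {1..t}" using True by auto
      have e: "0 < \<epsilon> / 2" "\<epsilon> / 2 \<le> 1" using \<epsilon> by auto
      have \<kappa>M': "\<And>b. \<kappa> b < M" using \<kappa>M by (rule spec)
      show ?thesis
        using ex_split_colouring[OF fA[OF ij(1)] fA[OF ij(2)] D \<kappa>M' l(2) e M\<eta> n0[OF big[OF ij(1)] big[OF ij(2)]]]
        unfolding Pr_def split_pair_def by blast
    next
      case False
      \<comment> \<open>Between irregular parts any labelling serves: the edge classes only have to
        partition the pairs.\<close>
      then show ?thesis using l by (intro exI[of _ "\<lambda>_. 1"]) (auto simp: Pr_def)
    qed
    then obtain \<psi> X where Pr: "\<And>i j. i \<in> {1..t} \<Longrightarrow> j \<in> {1..t} \<Longrightarrow> Pr i j (\<psi> i j) (X i j)" by metis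
    have small: "4 / real t + 4 * \<eta> + 8 * (real M + 1) / real l \<le> \<mu> / 4"
    proof -
      have "48 / \<mu> \<le> real t" using t(1) unfolding t1_def by linarith
      then have "4 / real t \<le> \<mu> / 12" using \<mu> t by (simp add: field_simps)
      moreover have "8 * (real M + 1) / real l \<le> \<mu> / 12" using l \<mu> by (simp add: field_simps)
      ultimately show ?thesis using \<eta>(2) by linarith
    qed
    have "real (card {T \<in> nsets V 3. \<not> good_triple t l A (edge_class A \<psi>) (\<epsilon>2 l) \<mu> F T}) \<le> \<mu> * real (card V) ^ 3"
    proof (rule card_not_good_triples_le[OF V eq t(2) tV Bad _ _ l(2) \<epsilon>(1,2,3) _ refl _ \<mu> small])
      show "\<psi> i j b \<in> {1..l}" if "i \<in> {1..t}" "j \<in> {1..t}" "b \<in> A i \<times> A j" for i j b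
        using Pr[OF that(1,2)] that(3) unfolding Pr_def by blast
      show "split_pair M l (\<epsilon> / 2) (A i) (A j) \<kappa> (\<psi> i j) (X i j)" if "(i, j) \<in> {1..t} \<times> {1..t} - Bad" for i j
        using Pr[of i j] that unfolding Pr_def by blast
      show "\<kappa>1 b = \<kappa>1 b' \<and> \<kappa>2 b = \<kappa>2 b' \<and> \<kappa>3 b = \<kappa>3 b'" if "\<kappa> b = \<kappa> b'" for b b' using \<kappa> that by blast
      show "(\<Sum>q\<in>V\<times>V\<times>V. cond_avg (V \<times> V \<times> V) (cyl_map \<kappa>1 \<kappa>2 \<kappa>3) (edge_fun F) q *
          (1 - cond_avg (V \<times> V \<times> V) (cyl_map \<kappa>1 \<kappa>2 \<kappa>3) (edge_fun F) q)) \<le> \<mu>\<^sup>2 / 8 * real (card V) ^ 3"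
        using h_le by (simp add: Let_def)
    qed
    moreover have "\<forall>i\<in>{1..t}. \<forall>j\<in>{1..t}. \<forall>b\<in>A i \<times> A j. \<psi> i j b \<in> {1..l}" using Pr unfolding Pr_def by blast
    moreover have "t0 \<le> t" using t(1) by (simp add: t1_def)
    ultimately show "\<exists>t l' A \<psi>. t0 \<le> t \<and> 1 \<le> t \<and> t \<le> T \<and> l0 \<le> l' \<and> 1 \<le> l' \<and> l' \<le> l \<and> equitable t A V \<and>
      (\<forall>i\<in>{1..t}. \<forall>j\<in>{1..t}. \<forall>b\<in>A i \<times> A j. \<psi> i j b \<in> {1..l'}) \<and>
      real (card {T \<in> nsets V 3. \<not> good_triple t l' A (edge_class A \<psi>) (\<epsilon>2 l') \<mu> F T}) \<le> \<mu> * real (card V) ^ 3"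
      using t(2,3) l(1,2) eq by (intro exI[of _ t] exI[of _ l] exI[of _ A] exI[of _ \<psi>] conjI order_refl)
  qed
qed

section \<open>From good triples to the conditions on a decomposition\<close>

lemma good_triple_decomposition:
  assumes good: "good_triple t l A P \<epsilon> \<mu> F T" and disj: "disjoint_family_on A {1..t}"
    and P: "\<forall>i\<in>{1..t}. \<forall>j\<in>{1..t}. i \<noteq> j \<longrightarrow>
      (\<Union>\<alpha>\<in>{1..l}. P {i, j} \<alpha>) = K2 (A i) (A j) \<and> disjoint_family_on (P {i, j}) {1..l}"
    and fin: "\<forall>i\<in>{1..t}. finite (A i)" and l: "1 \<le> l" and \<mu>: "0 \<le> \<mu>" "\<mu> \<le> \<epsilon>1 / 2"
  shows "\<exists>x y z i j k \<alpha> \<beta> \<gamma>. T = {x, y, z} \<and>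
        {i, j, k} \<in> nsets {1..t} 3 \<and> \<alpha> \<in> {1..l} \<and> \<beta> \<in> {1..l} \<and> \<gamma> \<in> {1..l} \<and>
        {x, y} \<in> P {i, j} \<alpha> \<and> {x, z} \<in> P {i, k} \<beta> \<and> {y, z} \<in> P {j, k} \<gamma> \<and>
        disc2_density \<epsilon> (1 / real l) (A i) (A j) (P {i, j} \<alpha>) \<and>
        disc2_density \<epsilon> (1 / real l) (A i) (A k) (P {i, k} \<beta>) \<and>
        disc2_density \<epsilon> (1 / real l) (A j) (A k) (P {j, k} \<gamma>)" (is ?t1)
    and "\<exists>i j k \<alpha> \<beta> \<gamma>.
        {i, j, k} \<in> nsets {1..t} 3 \<and> \<alpha> \<in> {1..l} \<and> \<beta> \<in> {1..l} \<and> \<gamma> \<in> {1..l} \<and>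
        (let G = triad A P i j k \<alpha> \<beta> \<gamma> in
          T \<in> K3 G \<and> disc23 \<epsilon>1 \<epsilon> (A i) (A j) (A k) (A i \<union> A j \<union> A k, F \<inter> K3 G) G)" (is ?t2)
    and "\<exists>i j k \<alpha> \<beta> \<gamma>.
        {i, j, k} \<in> nsets {1..t} 3 \<and> \<alpha> \<in> {1..l} \<and> \<beta> \<in> {1..l} \<and> \<gamma> \<in> {1..l} \<and>
        (let G = triad A P i j k \<alpha> \<beta> \<gamma> in
          T \<in> K3 G \<and> real (card (F \<inter> K3 G)) / real (card (K3 G)) \<in> {0..<\<epsilon>1} \<union> {1 - \<epsilon>1<..1})" (is ?t3)
proof -
  obtain i j k \<alpha> \<beta> \<gamma> where ijk: "1 \<le> i" "i < j" "j < k" "k \<le> t"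
    and abg: "\<alpha> \<in> {1..l}" "\<beta> \<in> {1..l}" "\<gamma> \<in> {1..l}"
    and disc: "disc2_density \<epsilon> (1 / real l) (A i) (A j) (P {i, j} \<alpha>)"
      "disc2_density \<epsilon> (1 / real l) (A i) (A k) (P {i, k} \<beta>)" "disc2_density \<epsilon> (1 / real l) (A j) (A k) (P {j, k} \<gamma>)"
    and K: "let K = K3 (triad A P i j k \<alpha> \<beta> \<gamma>) in T \<in> K \<and>
       real (card K) \<le> 2 * (1 / real l) ^ 3 * real (card (A i)) * real (card (A j)) * real (card (A k)) \<and>
       real (card (F \<inter> K)) / real (card K) \<in> {0..<\<mu>} \<union> {1 - \<mu><..1}"
    using good unfolding good_triple_def by (elim exE conjE)
  define G where "G = triad A P i j k \<alpha> \<beta> \<gamma>"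
  have K': "T \<in> K3 G" "real (card (K3 G)) \<le> 2 * (1 / real l) ^ 3 * real (card (A i)) * real (card (A j)) * real (card (A k))"
    "real (card (F \<inter> K3 G)) / real (card (K3 G)) \<in> {0..<\<mu>} \<union> {1 - \<mu><..1}"
    using K unfolding G_def Let_def by blast+
  have m: "i \<in> {1..t}" "j \<in> {1..t}" "k \<in> {1..t}" "i \<noteq> j" "i \<noteq> k" "j \<noteq> k" using ijk by auto
  have n3: "{i, j, k} \<in> nsets {1..t} 3" using m by (simp add: nsets_def)
  have d: "A i \<inter> A j = {}" "A i \<inter> A k = {}" "A j \<inter> A k = {}" using disj m unfolding disjoint_family_on_def by auto
  have E: "P {i, j} \<alpha> \<subseteq> K2 (A i) (A j)" "P {i, k} \<beta> \<subseteq> K2 (A i) (A k)" "P {j, k} \<gamma> \<subseteq> K2 (A j) (A k)"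
    using P m abg by blast+
  obtain x y z where "T = {x, y, z}" "{x, y} \<in> P {i, j} \<alpha>" "{x, z} \<in> P {i, k} \<beta>" "{y, z} \<in> P {j, k} \<gamma>"
    using K'(1) unfolding G_def triad_def K3_tripartite[OF d E] by blast
  then show ?t1 using n3 abg disc by blast
  have "disc23 \<epsilon>1 \<epsilon> (A i) (A j) (A k) (A i \<union> A j \<union> A k, F \<inter> K3 G) G"
    by (rule disc23_of_homogeneous[OF bspec[OF fin m(1)] bspec[OF fin m(2)] bspec[OF fin m(3)] d E G_def[unfolded triad_def] _ _ disc K'(2,3) \<mu>])
      (use l in auto)
  then show ?t2 using n3 abg K'(1) unfolding G_def Let_def by blast
  have "real (card (F \<inter> K3 G)) / real (card (K3 G)) \<in> {0..<\<epsilon>1} \<union> {1 - \<epsilon>1<..1}"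
    using K'(3) \<mu> by auto
  then show ?t3 using n3 abg K'(1) unfolding G_def Let_def by blast
qed

text \<open>The constant 12 in place of 6 absorbs the lower-order terms from \<open>n = 6\<close>
  on.\<close>

lemma choose_3_ge:
  assumes "6 \<le> n"
  shows "real n ^ 3 / 12 \<le> real (n choose 3)"
proof -
  have c: "real (n choose 3) = real n * (real n - 1) * (real n - 2) / 6"
    using assms by (simp add: binomial_gbinomial gbinomial_prod_rev numeral_3_eq_3 fact_reduce mult_ac)
  have n: "6 \<le> real n" using assms by simp
  then have "0 \<le> real n * (real n * (real n - 6) + 4)" by (intro mult_nonneg_nonneg add_nonneg_nonneg) auto
  then show ?thesis unfolding c by (simp add: power3_eq_cube algebra_simps)
qed

theorem disc23_homogeneous_if_VC2_bounded:
  fixes \<H> :: "'a hgraph set"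
  assumes fin: "\<And>H. H \<in> \<H> \<Longrightarrow> finite (fst H)" and VC: "\<And>H. H \<in> \<H> \<Longrightarrow> fst H \<noteq> {} \<Longrightarrow> \<not> VC2_shattered H k"
  shows "disc23_homogeneous \<H>"
  unfolding disc23_homogeneous_def
proof (intro allI impI, elim conjE)
  fix t0 l0 :: nat and \<epsilon>1 :: real and \<epsilon>2 :: "nat \<Rightarrow> real"
  assume "1 \<le> t0" "1 \<le> l0" and \<epsilon>1: "0 < \<epsilon>1" and \<epsilon>2: "\<forall>n. 0 < \<epsilon>2 n \<and> \<epsilon>2 n \<le> 1"
  \<comment> \<open>Exceptional triples are counted against \<open>card V ^ 3\<close>, homogeneity
    against \<open>card V choose 3\<close>; the factor 12 converts one into the other, and for this
    the 3-graph has at least 6 vertices.\<close>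
  define \<mu> where "\<mu> = \<epsilon>1 / 12"
  have \<mu>: "0 < \<mu>" "0 \<le> \<mu>" "\<mu> \<le> \<epsilon>1 / 2" using \<epsilon>1 by (auto simp: \<mu>_def)
  obtain T L N where TLN: "\<forall>V F. finite (V :: 'a set) \<and> \<not> VC2_shattered (V, F) k \<and> N \<le> card V \<longrightarrow>
    (\<exists>t l A \<psi>. t0 \<le> t \<and> 1 \<le> t \<and> t \<le> T \<and> l0 \<le> l \<and> 1 \<le> l \<and> l \<le> L \<and> equitable t A V \<and>
      (\<forall>i\<in>{1..t}. \<forall>j\<in>{1..t}. \<forall>b\<in>A i \<times> A j. \<psi> i j b \<in> {1..l}) \<and>
      real (card {T \<in> nsets V 3. \<not> good_triple t l A (edge_class A \<psi>) (\<epsilon>2 l) \<mu> F T}) \<le> \<mu> * real (card V) ^ 3)"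
    using ex_decomposition_good_triples[OF \<mu>(1) \<epsilon>2, of k t0 l0] by (elim exE)
  have "\<exists>t l A P. t0 \<le> t \<and> t \<le> T \<and> l0 \<le> l \<and> l \<le> L \<and> decomposition t l \<epsilon>1 (\<epsilon>2 l) (fst H) A P \<and>
      regular_decomp t l A P \<epsilon>1 (\<epsilon>2 l) H \<and> homogeneous_decomp t l A P \<epsilon>1 H"
    if H: "H \<in> \<H>" and N: "N + 6 \<le> card (fst H)" for H
  proof -
    obtain V F where VF: "H = (V, F)" by (cases H)
    have V: "finite V" "N \<le> card V" "6 \<le> card V" "V \<noteq> {}" using fin[OF H] N by (auto simp: VF)
    have nsh: "\<not> VC2_shattered (V, F) k" using VC[OF H] V by (simp add: VF)
    obtain t l A \<psi> where t: "t0 \<le> t" "1 \<le> t" "t \<le> T" and l: "l0 \<le> l" "1 \<le> l" "l \<le> L"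
      and eq: "equitable t A V" and \<psi>: "\<forall>i\<in>{1..t}. \<forall>j\<in>{1..t}. \<forall>b\<in>A i \<times> A j. \<psi> i j b \<in> {1..l}"
      and few: "real (card {T \<in> nsets V 3. \<not> good_triple t l A (edge_class A \<psi>) (\<epsilon>2 l) \<mu> F T}) \<le> \<mu> * real (card V) ^ 3"
      using mp[OF spec[OF spec[OF TLN, of V], of F], OF conjI[OF V(1) conjI[OF nsh V(2)]]] by (elim exE conjE)
    define P where "P = edge_class A \<psi>"
    let ?good = "good_triple t l A P (\<epsilon>2 l) \<mu> F"
    have disj: "disjoint_family_on A {1..t}" and un: "(\<Union>i\<in>{1..t}. A i) = V" using eq by (auto simp: equitable_def)
    have fA: "\<forall>i\<in>{1..t}. finite (A i)" using un V(1) by (metis UN_upper finite_subset)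
    have PK: "(\<Union>\<alpha>\<in>{1..l}. P {i, j} \<alpha>) = K2 (A i) (A j) \<and> disjoint_family_on (P {i, j}) {1..l}"
      if "i \<in> {1..t}" "j \<in> {1..t}" "i < j" for i j
    proof -
      have d: "A i \<inter> A j = {}" using disj that unfolding disjoint_family_on_def by auto
      have ec: "P {i, j} \<alpha> = {{x, y} | x y. x \<in> A i \<and> y \<in> A j \<and> \<psi> i j (x, y) = \<alpha>}" for \<alpha>
        unfolding P_def by (rule edge_class_pair[OF that(3)])
      have "(\<Union>\<alpha>\<in>{1..l}. P {i, j} \<alpha>) = K2 (A i) (A j)"
      proof
        show "(\<Union>\<alpha>\<in>{1..l}. P {i, j} \<alpha>) \<subseteq> K2 (A i) (A j)" unfolding ec K2_def using d by blast
        show "K2 (A i) (A j) \<subseteq> (\<Union>\<alpha>\<in>{1..l}. P {i, j} \<alpha>)"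
        proof
          fix e assume "e \<in> K2 (A i) (A j)"
          then obtain x y where e: "e = {x, y}" "x \<in> A i" "y \<in> A j" unfolding K2_def by blast
          then have "\<psi> i j (x, y) \<in> {1..l}" "e \<in> P {i, j} (\<psi> i j (x, y))" using \<psi> that unfolding ec by blast+
          then show "e \<in> (\<Union>\<alpha>\<in>{1..l}. P {i, j} \<alpha>)" by blast
        qed
      qed
      moreover have "disjoint_family_on (P {i, j}) {1..l}"
        unfolding disjoint_family_on_def ec using d by (auto simp: doubleton_eq_iff)
      ultimately show ?thesis by blast
    qed
    have PK': "\<forall>i\<in>{1..t}. \<forall>j\<in>{1..t}. i \<noteq> j \<longrightarrow>
      (\<Union>\<alpha>\<in>{1..l}. P {i, j} \<alpha>) = K2 (A i) (A j) \<and> disjoint_family_on (P {i, j}) {1..l}"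
    proof (intro ballI impI)
      fix i j assume ij: "i \<in> {1..t}" "j \<in> {1..t}" "i \<noteq> j"
      show "(\<Union>\<alpha>\<in>{1..l}. P {i, j} \<alpha>) = K2 (A i) (A j) \<and> disjoint_family_on (P {i, j}) {1..l}"
      proof (cases "i < j")
        case True
        then show ?thesis using PK ij by blast
      next
        case False
        then have "(\<Union>\<alpha>\<in>{1..l}. P {j, i} \<alpha>) = K2 (A j) (A i) \<and> disjoint_family_on (P {j, i}) {1..l}"
          using PK[of j i] ij by simp
        then show ?thesis by (simp only: K2_commute[of "A j"] insert_commute[of j])
      qed
    qed
    note gd = good_triple_decomposition[OF _ disj PK' fA l(2) \<mu>(2,3), where F=F and \<epsilon>="\<epsilon>2 l"]
    have finN: "finite (nsets V 3)" using V by (simp add: finite_imp_finite_nsets)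
    have bad_le: "real (card {T \<in> nsets V 3. \<not> Q T}) \<le> \<mu> * real (card V) ^ 3" if "\<And>T. ?good T \<Longrightarrow> Q T" for Q
    proof -
      have "card {T \<in> nsets V 3. \<not> Q T} \<le> card {T \<in> nsets V 3. \<not> ?good T}"
        using that finN by (intro card_mono) auto
      then show ?thesis using few unfolding P_def by linarith
    qed
    have \<mu>\<epsilon>: "\<mu> * real (card V) ^ 3 \<le> \<epsilon>1 * real (card V) ^ 3" using \<mu> \<epsilon>1 by (intro mult_right_mono) auto
    have eqs: "\<forall>i\<in>{1..t}. \<forall>j\<in>{1..t}. i \<le> j \<longrightarrow> card (A i) \<le> card (A j)" "card (A t) \<le> card (A 1) + 1"
    proof -
      show "\<forall>i\<in>{1..t}. \<forall>j\<in>{1..t}. i \<le> j \<longrightarrow> card (A i) \<le> card (A j)" using eq by (simp add: equitable_def)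
      have "card (A t) \<le> card V div t + 1" "card V div t \<le> card (A 1)" using eq t(2) unfolding equitable_def by auto
      then show "card (A t) \<le> card (A 1) + 1" by linarith
    qed
    have "decomposition t l \<epsilon>1 (\<epsilon>2 l) V A P"
      unfolding decomposition_def
      by (intro conjI un disj eqs PK' order_trans[OF bad_le[OF gd(1)] \<mu>\<epsilon>])
    moreover have "regular_decomp t l A P \<epsilon>1 (\<epsilon>2 l) (V, F)"
      unfolding regular_decomp_def fst_conv snd_conv by (rule order_trans[OF bad_le[OF gd(2)] \<mu>\<epsilon>])
    moreover have "homogeneous_decomp t l A P \<epsilon>1 (V, F)"
      unfolding homogeneous_decomp_def fst_conv snd_conv
    proof -
      let ?Q = "\<lambda>T. \<exists>i j k \<alpha> \<beta> \<gamma>. {i, j, k} \<in> nsets {1..t} 3 \<and> \<alpha> \<in> {1..l} \<and> \<beta> \<in> {1..l} \<and> \<gamma> \<in> {1..l} \<and>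
        (let G = triad A P i j k \<alpha> \<beta> \<gamma> in
          T \<in> K3 G \<and> real (card (F \<inter> K3 G)) / real (card (K3 G)) \<in> {0..<\<epsilon>1} \<union> {1 - \<epsilon>1<..1})"
      have "card S = card {T \<in> S. Q T} + card {T \<in> S. \<not> Q T}" if "finite S" for S and Q :: "'a set \<Rightarrow> bool"
      proof -
        have "S = {T \<in> S. Q T} \<union> {T \<in> S. \<not> Q T}" by blast
        then show ?thesis using card_Un_disjoint[of "{T \<in> S. Q T}" "{T \<in> S. \<not> Q T}"] that by fastforce
      qed
      from this[OF finN, of ?Q] have c: "real (card V choose 3) = real (card {T \<in> nsets V 3. ?Q T}) + real (card {T \<in> nsets V 3. \<not> ?Q T})"
        by (simp only: card_nsets of_nat_add)
      have "real (card {T \<in> nsets V 3. \<not> ?Q T}) \<le> \<mu> * real (card V) ^ 3" by (rule bad_le[OF gd(3)])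
      also have "\<dots> = \<epsilon>1 * (real (card V) ^ 3 / 12)" by (simp add: \<mu>_def)
      also have "\<dots> \<le> \<epsilon>1 * real (card V choose 3)" using choose_3_ge[OF V(3)] \<epsilon>1 by (intro mult_left_mono) auto
      finally show "(1 - \<epsilon>1) * real (card V choose 3) \<le> real (card {T \<in> nsets V 3. ?Q T})"
        using c by (simp add: left_diff_distrib)
    qed
    ultimately show ?thesis unfolding VF fst_conv using t l by blast
  qed
  then show "\<exists>T L N. \<forall>H\<in>\<H>. N \<le> card (fst H) \<longrightarrow>
           (\<exists>t l A P. t0 \<le> t \<and> t \<le> T \<and> l0 \<le> l \<and> l \<le> L \<and>
              decomposition t l \<epsilon>1 (\<epsilon>2 l) (fst H) A P \<and>
              regular_decomp t l A P \<epsilon>1 (\<epsilon>2 l) H \<and> homogeneous_decomp t l A P \<epsilon>1 H)"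
    by blast
qed

section \<open>Quasirandom 3-graphs in classes of unbounded dimension\<close>

text \<open>A fair independent choice for each of the \<open>n ^ 3\<close> triples. There are
  \<open>2 ^ (3 * n\<^sup>2)\<close> cylinders on the grid to control, while the deviation bound has
  the exponent \<open>\<delta>\<^sup>2 * n ^ 3 / 4\<close>, which is at least
  \<open>4 * n\<^sup>2\<close> from \<open>16 / \<delta>\<^sup>2\<close> on.\<close>

lemma ex_quasirandom_relation:
  fixes \<delta> :: real
  assumes \<delta>: "0 < \<delta>" "\<delta> \<le> 1"
  shows "\<exists>n0. \<forall>n\<ge>n0. \<exists>R :: nat \<times> nat \<times> nat \<Rightarrow> bool. \<forall>E1 E2 E3.
    \<bar>\<Sum>q\<in>{1..n} \<times> {1..n} \<times> {1..n}.
       of_bool (case q of (x, y, z) \<Rightarrow> (x, y) \<in> E1 \<and> (x, z) \<in> E2 \<and> (y, z) \<in> E3) * (if R q then 1 / 2 else - 1 / 2)\<bar>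
      \<le> \<delta> * real n ^ 3"
proof (rule exI[of _ "nat \<lceil>16 / \<delta>\<^sup>2\<rceil> + 1"], intro allI impI)
  fix n assume "nat \<lceil>16 / \<delta>\<^sup>2\<rceil> + 1 \<le> n"
  then have n: "16 / \<delta>\<^sup>2 \<le> real n" "1 \<le> n" by linarith+
  let ?I = "{1..n}"
  let ?X = "?I \<times> ?I \<times> ?I" and ?J = "Pow (?I \<times> ?I) \<times> Pow (?I \<times> ?I) \<times> Pow (?I \<times> ?I)"
  define c :: "(nat \<times> nat) set \<times> (nat \<times> nat) set \<times> (nat \<times> nat) set \<Rightarrow> nat \<times> nat \<times> nat \<Rightarrow> bool"
    where "c = (\<lambda>(E1, E2, E3) q. case q of (x, y, z) \<Rightarrow> (x, y) \<in> E1 \<and> (x, z) \<in> E2 \<and> (y, z) \<in> E3)"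
  define \<phi> where "\<phi> j q b = (of_bool (c j q) * (if b then 1 / 2 else - 1 / 2) :: real)" for j q b
  have cX: "real (card ?X) = real n ^ 3" by (simp add: card_cartesian_product power3_eq_cube mult.assoc)
  have "\<exists>R\<in>?X \<rightarrow>\<^sub>E (UNIV :: bool set). (\<forall>q\<in>?X. 0 < (1 / 2 :: real)) \<and> (\<forall>j\<in>?J. \<bar>\<Sum>q\<in>?X. \<phi> j q (R q)\<bar> \<le> \<delta> * real (card ?X))"
  proof (rule ex_choice_small_abs_deviation)
    show "\<bar>\<phi> j q b\<bar> \<le> 1" for j q b by (simp add: \<phi>_def of_bool_def)
    show "(\<Sum>b\<in>UNIV. 1 / 2 * \<phi> j q b) = 0" for j q by (simp add: UNIV_bool \<phi>_def)
    have "card ?J = 2 ^ (3 * (n * n))"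
      by (simp add: card_cartesian_product card_Pow power_mult_distrib power_add[symmetric])
    then have "2 * real (card ?J) = 2 ^ (3 * (n * n) + 1)" by simp
    also have "\<dots> \<le> 2 ^ (4 * (n * n))"
    proof (rule power_increasing)
      have "1 \<le> n * n" using n(2) by (simp add: Suc_le_eq)
      then show "3 * (n * n) + 1 \<le> 4 * (n * n)" by linarith
    qed simp
    also have "\<dots> < exp 1 ^ (4 * (n * n))"
      using exp_lower_Taylor_quadratic[of "1 :: real"] n(2) by (intro power_strict_mono) auto
    also have "\<dots> = exp (4 * (real n)\<^sup>2)" by (simp add: exp_of_nat_mult[symmetric] power2_eq_square)
    also have "\<dots> \<le> exp (\<delta>\<^sup>2 * real (card ?X) / 4)"
    proof -
      have "16 \<le> \<delta>\<^sup>2 * real n" using n(1) \<delta> by (simp add: divide_le_eq mult.commute)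
      then have "16 * (real n)\<^sup>2 \<le> \<delta>\<^sup>2 * real n * (real n)\<^sup>2" by (intro mult_right_mono) auto
      then show ?thesis unfolding cX by (simp add: power2_eq_square power3_eq_cube mult.assoc)
    qed
    finally show "2 * real (card ?J) < exp (\<delta>\<^sup>2 * real (card ?X) / 4)" .
  qed (use \<delta> in auto)
  then obtain R where R: "\<forall>j\<in>?J. \<bar>\<Sum>q\<in>?X. \<phi> j q (R q)\<bar> \<le> \<delta> * real (card ?X)" by (elim bexE conjE)
  have "\<bar>\<Sum>q\<in>?X. of_bool (case q of (x, y, z) \<Rightarrow> (x, y) \<in> E1 \<and> (x, z) \<in> E2 \<and> (y, z) \<in> E3) * (if R q then 1 / 2 else - 1 / 2)\<bar>
      \<le> \<delta> * real n ^ 3" for E1 E2 E3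
  proof -
    \<comment> \<open>Only the parts of the three sets inside the grid affect the sum, so the
      finitely many indices in \<open>?J\<close> cover arbitrary sets.\<close>
    define j where "j = (E1 \<inter> ?I \<times> ?I, E2 \<inter> ?I \<times> ?I, E3 \<inter> ?I \<times> ?I)"
    have jJ: "j \<in> ?J" by (auto simp: j_def)
    have "\<bar>\<Sum>q\<in>?X. \<phi> j q (R q)\<bar> \<le> \<delta> * real n ^ 3" using bspec[OF R jJ] unfolding cX .
    moreover have "(\<Sum>q\<in>?X. \<phi> j q (R q)) = (\<Sum>q\<in>?X. of_bool (case q of (x, y, z) \<Rightarrow> (x, y) \<in> E1 \<and> (x, z) \<in> E2 \<and> (y, z) \<in> E3) * (if R q then 1 / 2 else - 1 / 2))"
      by (rule sum.cong) (auto simp: \<phi>_def c_def j_def)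
    ultimately show ?thesis by simp
  qed
  then show "\<exists>R :: nat \<times> nat \<times> nat \<Rightarrow> bool. \<forall>E1 E2 E3.
    \<bar>\<Sum>q\<in>?X. of_bool (case q of (x, y, z) \<Rightarrow> (x, y) \<in> E1 \<and> (x, z) \<in> E2 \<and> (y, z) \<in> E3) * (if R q then 1 / 2 else - 1 / 2)\<bar>
      \<le> \<delta> * real n ^ 3" by (intro exI[of _ R] allI)
qed

text \<open>Beyond the indices up to \<open>n\<close> that realise \<open>R\<close>, the index \<open>n + 1\<close> makes the three families of
  vertices disjoint and the index \<open>n + 2\<close> makes the vertices \<open>a u\<close> distinct.\<close>

lemma shattered_embeds_tripartite:
  assumes sh: "VC2_shattered H m" and m: "n + 2 \<le> m" and g: "graph3 H"
  shows "\<exists>a b c. inj_on a {1..n} \<and> inj_on b {1..n} \<and> inj_on c {1..n} \<and>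
    a ` {1..n} \<subseteq> fst H \<and> b ` {1..n} \<subseteq> fst H \<and> c ` {1..n} \<subseteq> fst H \<and>
    a ` {1..n} \<inter> b ` {1..n} = {} \<and> a ` {1..n} \<inter> c ` {1..n} = {} \<and> b ` {1..n} \<inter> c ` {1..n} = {} \<and>
    (\<forall>u\<in>{1..n}. \<forall>i\<in>{1..n}. \<forall>j\<in>{1..n}. {a u, b i, c j} \<in> snd H \<longleftrightarrow> R (u, i, j))"
proof -
  obtain b c aS where bc: "\<And>i. i \<in> {1..m} \<Longrightarrow> b i \<in> fst H \<and> c i \<in> fst H"
    and aS: "\<And>S. S \<subseteq> {1..m} \<times> {1..m} \<Longrightarrow> aS S \<in> fst H"
    and e: "\<And>S i j. S \<subseteq> {1..m} \<times> {1..m} \<Longrightarrow> i \<in> {1..m} \<Longrightarrow> j \<in> {1..m} \<Longrightarrow> {aS S, b i, c j} \<in> snd H \<longleftrightarrow> (i, j) \<in> S"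
    using sh unfolding VC2_shattered_def by metis
  have dist: "x \<noteq> y \<and> x \<noteq> z \<and> y \<noteq> z" if "{x, y, z} \<in> snd H" for x y z
  proof -
    have "card {x, y, z} = 3" using that g unfolding graph3_def nsets_def by auto
    then show ?thesis by (auto simp: card_insert_if split: if_splits)
  qed
  define S where "S u = {(i, j). i \<in> {1..n} \<and> j \<in> {1..n} \<and> R (u, i, j)} \<union> {1..n} \<times> {n + 1} \<union> {n + 1} \<times> {1..n} \<union> {(n + 2, u)}" for u
  have S: "S u \<subseteq> {1..m} \<times> {1..m}" if "u \<in> {1..n}" for u using that m by (auto simp: S_def)
  have in_m: "i \<in> {1..m}" if "i \<in> {1..n}" for i using that m by auto
  have n12: "n + 1 \<in> {1..m}" "n + 2 \<in> {1..m}" using m by auto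
  define a where "a u = aS (S u)" for u
  have ae: "{a u, b i, c j} \<in> snd H \<longleftrightarrow> (i, j) \<in> S u" if "u \<in> {1..n}" "i \<in> {1..m}" "j \<in> {1..m}" for u i j
    unfolding a_def using e[OF S] that by blast
  have ia: "inj_on a {1..n}"
  proof (rule inj_onI)
    fix u u' assume u: "u \<in> {1..n}" "u' \<in> {1..n}" "a u = a u'"
    have "(n + 2, u) \<in> S u'"
      using ae[OF u(1) n12(2) in_m[OF u(1)]] ae[OF u(2) n12(2) in_m[OF u(1)]] u(3) by (simp add: S_def)
    then show "u = u'" by (auto simp: S_def)
  qed
  have ib: "inj_on b {1..n}"
  proof (rule inj_onI)
    fix i i' assume i: "i \<in> {1..n}" "i' \<in> {1..n}" "b i = b i'"
    have s: "{(i, 1)} \<subseteq> {1..m} \<times> {1..m}" "1 \<in> {1..m}" using i m by auto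
    show "i = i'" using e[OF s(1) in_m[OF i(1)] s(2)] e[OF s(1) in_m[OF i(2)] s(2)] i(3) by simp
  qed
  have ic: "inj_on c {1..n}"
  proof (rule inj_onI)
    fix i i' assume i: "i \<in> {1..n}" "i' \<in> {1..n}" "c i = c i'"
    have s: "{(1, i)} \<subseteq> {1..m} \<times> {1..m}" "1 \<in> {1..m}" using i m by auto
    show "i = i'" using e[OF s(1) s(2) in_m[OF i(1)]] e[OF s(1) s(2) in_m[OF i(2)]] i(3) by simp
  qed
  have im: "a ` {1..n} \<subseteq> fst H" "b ` {1..n} \<subseteq> fst H" "c ` {1..n} \<subseteq> fst H"
    unfolding a_def using aS[OF S] bc in_m by blast+
  have ab: "a u \<noteq> b i" if "u \<in> {1..n}" "i \<in> {1..n}" for u i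
    using dist[of "a u" "b i" "c (n + 1)"] ae[OF that(1) in_m[OF that(2)] n12(1)] that by (simp add: S_def)
  have ac: "a u \<noteq> c j" if "u \<in> {1..n}" "j \<in> {1..n}" for u j
    using dist[of "a u" "b (n + 1)" "c j"] ae[OF that(1) n12(1) in_m[OF that(2)]] that by (simp add: S_def)
  \<comment> \<open>The full pattern \<open>{1..m} \<times> {1..m}\<close> makes \<open>b i\<close>
    and \<open>c j\<close> vertices of a common edge, and an edge has three distinct
    vertices.\<close>
  have bc': "b i \<noteq> c j" if "i \<in> {1..n}" "j \<in> {1..n}" for i j
    using dist[of "aS ({1..m} \<times> {1..m})" "b i" "c j"] e[of "{1..m} \<times> {1..m}" i j] in_m that by blast
  have ed: "{a u, b i, c j} \<in> snd H \<longleftrightarrow> R (u, i, j)" if "u \<in> {1..n}" "i \<in> {1..n}" "j \<in> {1..n}" for u i j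
    using ae[OF that(1) in_m[OF that(2)] in_m[OF that(3)]] that by (auto simp: S_def)
  have "a ` {1..n} \<inter> b ` {1..n} = {}" "a ` {1..n} \<inter> c ` {1..n} = {}" "b ` {1..n} \<inter> c ` {1..n} = {}"
    using ab ac bc' by auto
  then show ?thesis by (intro exI[of _ a] exI[of _ b] exI[of _ c] conjI ballI ia ib ic im ed)
qed

section \<open>Transversal triples inside homogeneous triads\<close>

lemma K3_iff:
  assumes "p \<noteq> q" "p \<noteq> r" "q \<noteq> r"
  shows "{p, q, r} \<in> K3 G \<longleftrightarrow> {p, q} \<in> snd G \<and> {p, r} \<in> snd G \<and> {q, r} \<in> snd G"
proof
  assume "{p, q, r} \<in> K3 G"
  then obtain x y z where xyz: "{p, q, r} = {x, y, z}" "{x, y} \<in> snd G" "{x, z} \<in> snd G" "{y, z} \<in> snd G"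
    unfolding K3_def by blast
  have pair: "{s, t} \<in> snd G" if "s \<in> {x, y, z}" "t \<in> {x, y, z}" "s \<noteq> t" for s t
    using that xyz(2-4) by (auto simp: insert_commute)
  show "{p, q} \<in> snd G \<and> {p, r} \<in> snd G \<and> {q, r} \<in> snd G"
    using assms unfolding xyz(1)[symmetric] by (intro conjI pair) (auto simp flip: xyz(1))
next
  assume "{p, q} \<in> snd G \<and> {p, r} \<in> snd G \<and> {q, r} \<in> snd G"
  then show "{p, q, r} \<in> K3 G" unfolding K3_def using assms by blast
qed

text \<open>The index tuples are ordered, so a triad is counted once for each order of its parts.
  Its triangles are accordingly lifted to ordered triples of vertices; these lie in the disjoint
  sets \<open>Z \<tau>\<close>, and the bound is \<open>card V ^ 3\<close>.\<close>

lemma sum_card_K3_triads_le: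
  assumes fin: "finite V" and A: "(\<Union>i\<in>{1..t}. A i) = V" and disj: "disjoint_family_on A {1..t}"
    and P: "\<forall>i\<in>{1..t}. \<forall>j\<in>{1..t}. i \<noteq> j \<longrightarrow>
      (\<Union>\<alpha>\<in>{1..l}. P {i, j} \<alpha>) = K2 (A i) (A j) \<and> disjoint_family_on (P {i, j}) {1..l}"
  shows "(\<Sum>(i, j, k, \<alpha>, \<beta>, \<gamma>)\<in>{(i, j, k, \<alpha>, \<beta>, \<gamma>). i \<in> {1..t} \<and> j \<in> {1..t} \<and> k \<in> {1..t} \<and>
      i \<noteq> j \<and> i \<noteq> k \<and> j \<noteq> k \<and> \<alpha> \<in> {1..l} \<and> \<beta> \<in> {1..l} \<and> \<gamma> \<in> {1..l}}. card (K3 (triad A P i j k \<alpha> \<beta> \<gamma>)))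
    \<le> card V ^ 3" (is "sum _ ?I \<le> _")
proof -
  define Z where "Z = (\<lambda>(i, j, k, \<alpha>, \<beta>, \<gamma>). {(x, y, z) \<in> A i \<times> A j \<times> A k.
    {x, y} \<in> P {i, j} \<alpha> \<and> {x, z} \<in> P {i, k} \<beta> \<and> {y, z} \<in> P {j, k} \<gamma>})"
  have finI: "finite ?I"
    by (rule finite_subset[of _ "{1..t} \<times> {1..t} \<times> {1..t} \<times> {1..l} \<times> {1..l} \<times> {1..l}"]) auto
  have ZV: "Z \<tau> \<subseteq> V \<times> V \<times> V" if "\<tau> \<in> ?I" for \<tau> using that A unfolding Z_def by blast
  have finZ: "finite (Z \<tau>)" if "\<tau> \<in> ?I" for \<tau> using finite_subset[OF ZV[OF that]] fin by simp
  have le: "card (K3 (triad A P i j k \<alpha> \<beta> \<gamma>)) \<le> card (Z (i, j, k, \<alpha>, \<beta>, \<gamma>))" if \<tau>: "(i, j, k, \<alpha>, \<beta>, \<gamma>) \<in> ?I" for i j k \<alpha> \<beta> \<gamma>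
  proof -
    have m: "i \<in> {1..t}" "j \<in> {1..t}" "k \<in> {1..t}" "i \<noteq> j" "i \<noteq> k" "j \<noteq> k" "\<alpha> \<in> {1..l}" "\<beta> \<in> {1..l}" "\<gamma> \<in> {1..l}" using \<tau> by auto
    have d: "A i \<inter> A j = {}" "A i \<inter> A k = {}" "A j \<inter> A k = {}" using disj m unfolding disjoint_family_on_def by auto
    have E: "P {i, j} \<alpha> \<subseteq> K2 (A i) (A j)" "P {i, k} \<beta> \<subseteq> K2 (A i) (A k)" "P {j, k} \<gamma> \<subseteq> K2 (A j) (A k)"
      using P m by blast+
    have "K3 (triad A P i j k \<alpha> \<beta> \<gamma>) \<subseteq> (\<lambda>(x, y, z). {x, y, z}) ` Z (i, j, k, \<alpha>, \<beta>, \<gamma>)"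
    proof
      fix T assume "T \<in> K3 (triad A P i j k \<alpha> \<beta> \<gamma>)"
      then obtain x y z where "x \<in> A i" "y \<in> A j" "z \<in> A k" "T = {x, y, z}" "{x, y} \<in> P {i, j} \<alpha>" "{x, z} \<in> P {i, k} \<beta>" "{y, z} \<in> P {j, k} \<gamma>"
        unfolding triad_def K3_tripartite[OF d E] by blast
      then show "T \<in> (\<lambda>(x, y, z). {x, y, z}) ` Z (i, j, k, \<alpha>, \<beta>, \<gamma>)"
        unfolding Z_def by (intro rev_image_eqI[of "(x, y, z)"]) auto
    qed
    then have "card (K3 (triad A P i j k \<alpha> \<beta> \<gamma>)) \<le> card ((\<lambda>(x, y, z). {x, y, z}) ` Z (i, j, k, \<alpha>, \<beta>, \<gamma>))"
      using finZ[OF \<tau>] by (intro card_mono) auto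
    also have "\<dots> \<le> card (Z (i, j, k, \<alpha>, \<beta>, \<gamma>))" by (rule card_image_le[OF finZ[OF \<tau>]])
    finally show ?thesis .
  qed
  have disjZ: "Z \<tau> \<inter> Z \<tau>' = {}" if "\<tau> \<in> ?I" "\<tau>' \<in> ?I" "\<tau> \<noteq> \<tau>'" for \<tau> \<tau>'
  proof (rule ccontr)
    obtain i j k \<alpha> \<beta> \<gamma> where \<tau>: "\<tau> = (i, j, k, \<alpha>, \<beta>, \<gamma>)" by (cases \<tau>)
    obtain i' j' k' \<alpha>' \<beta>' \<gamma>' where \<tau>': "\<tau>' = (i', j', k', \<alpha>', \<beta>', \<gamma>')" by (cases \<tau>')
    have m: "i \<in> {1..t}" "j \<in> {1..t}" "k \<in> {1..t}" "i \<noteq> j" "i \<noteq> k" "j \<noteq> k" "\<alpha> \<in> {1..l}" "\<beta> \<in> {1..l}" "\<gamma> \<in> {1..l}"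
      using that(1) unfolding \<tau> by auto
    have m': "i' \<in> {1..t}" "j' \<in> {1..t}" "k' \<in> {1..t}" "\<alpha>' \<in> {1..l}" "\<beta>' \<in> {1..l}" "\<gamma>' \<in> {1..l}"
      using that(2) unfolding \<tau>' by auto
    assume "Z \<tau> \<inter> Z \<tau>' \<noteq> {}"
    then obtain x y z where 1: "(x, y, z) \<in> Z \<tau>" and 2: "(x, y, z) \<in> Z \<tau>'" by auto
    have "x \<in> A i" "x \<in> A i'" "y \<in> A j" "y \<in> A j'" "z \<in> A k" "z \<in> A k'" using 1 2 unfolding \<tau> \<tau>' Z_def by auto
    then have eq: "i' = i" "j' = j" "k' = k" using disj m m' unfolding disjoint_family_on_def by blast+
    have "{x, y} \<in> P {i, j} \<alpha>" "{x, y} \<in> P {i, j} \<alpha>'" "{x, z} \<in> P {i, k} \<beta>" "{x, z} \<in> P {i, k} \<beta>'"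
      "{y, z} \<in> P {j, k} \<gamma>" "{y, z} \<in> P {j, k} \<gamma>'" using 1 2 unfolding \<tau> \<tau>' eq Z_def by auto
    moreover have "disjoint_family_on (P {i, j}) {1..l}" "disjoint_family_on (P {i, k}) {1..l}" "disjoint_family_on (P {j, k}) {1..l}"
      using P m by blast+
    ultimately have "\<alpha> = \<alpha>'" "\<beta> = \<beta>'" "\<gamma> = \<gamma>'" using m m' unfolding disjoint_family_on_def by blast+
    then show False using that(3) eq unfolding \<tau> \<tau>' by simp
  qed
  have "(\<Sum>(i, j, k, \<alpha>, \<beta>, \<gamma>)\<in>?I. card (K3 (triad A P i j k \<alpha> \<beta> \<gamma>))) \<le> (\<Sum>\<tau>\<in>?I. card (Z \<tau>))"
    using le by (intro sum_mono) auto
  also have "\<dots> = card (\<Union>\<tau>\<in>?I. Z \<tau>)"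
    by (rule card_UN_disjoint[symmetric]) (intro finI ballI impI finZ disjZ; assumption)+
  also have "\<dots> \<le> card (V \<times> V \<times> V)" by (intro card_mono UN_least ZV) (use fin in simp_all)
  also have "\<dots> = card V ^ 3" by (simp add: card_cartesian_product power3_eq_cube)
  finally show ?thesis .
qed

lemma VC2_shattered_VC2:
  assumes "finite (fst H)" "VC2 H \<noteq> 0"
  shows "VC2_shattered H (VC2 H)"
proof -
  let ?K = "{k. VC2_shattered H k}"
  have fin: "finite ?K"
    by (rule finite_subset[of _ "{..card (fst H)}"]) (use VC2_shattered_le_card[OF assms(1)] in auto)
  have ne: "?K \<noteq> {}" using assms(2) unfolding VC2_def by (metis Sup_nat_empty)
  have "VC2 H = Max ?K" unfolding VC2_def by (rule cSup_eq_Max[OF fin ne])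
  then show ?thesis using Max_in[OF fin ne] by (simp only: mem_Collect_eq)
qed

lemma VC2_shattered_le_VC2:
  assumes "finite (fst H)" "VC2_shattered H k"
  shows "k \<le> VC2 H"
  unfolding VC2_def using assms(2) VC2_shattered_le_card[OF assms(1)]
  by (intro cSup_upper bdd_aboveI[of _ "card (fst H)"]) auto

text \<open>Homogeneity of \<open>K\<close> leaves room for at most \<open>\<mu> * card K\<close>
  edges or for at most that many non-edges, so one of the two halves of \<open>C\<close> is that
  small. Quasirandomness makes the halves differ by at most \<open>2 * D\<close>.\<close>

lemma card_quasirandom_le:
  fixes \<delta> \<mu> :: real
  assumes dev: "\<bar>\<Sum>q\<in>X. of_bool (q \<in> C) * (if R q then 1 / 2 else - 1 / 2)\<bar> \<le> D"
    and C: "C \<subseteq> X" and fin: "finite X" "finite K"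
    and e: "inj_on e C" "\<And>q. q \<in> C \<Longrightarrow> e q \<in> K" "\<And>q. q \<in> C \<Longrightarrow> e q \<in> F \<longleftrightarrow> R q"
    and hom: "real (card (F \<inter> K)) / real (card K) \<in> {0..<\<mu>} \<union> {1 - \<mu><..1}"
  shows "real (card C) \<le> 2 * \<mu> * real (card K) + 2 * D"
proof -
  have finC: "finite C" using C fin finite_subset by blast
  let ?C1 = "{q \<in> C. R q}" and ?C2 = "{q \<in> C. \<not> R q}"
  have "(\<Sum>q\<in>X. of_bool (q \<in> C) * (if R q then 1 / 2 else - 1 / 2 :: real))
      = (\<Sum>q\<in>X. if q \<in> C then (if R q then 1 / 2 else - 1 / 2) else 0)"
    by (rule sum.cong) auto
  also have "\<dots> = (\<Sum>q\<in>C. if R q then 1 / 2 else - 1 / 2)"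
    using fin(1) C by (simp add: sum.inter_restrict[symmetric] Int_absorb1)
  also have "\<dots> = (real (card ?C1) - real (card ?C2)) / 2"
    using finC by (simp add: sum.If_cases Int_def diff_divide_distrib)
  finally have "\<bar>(real (card ?C1) - real (card ?C2)) / 2\<bar> \<le> D" using dev by (simp only:)
  then have dev': "\<bar>real (card ?C1) - real (card ?C2)\<bar> \<le> 2 * D" by (simp add: mult.commute)
  have "card C = card (?C1 \<union> ?C2)" by (rule arg_cong[where f=card]) blast
  also have "\<dots> = card ?C1 + card ?C2" using finC by (intro card_Un_disjoint) auto
  finally have cC: "real (card C) = real (card ?C1) + real (card ?C2)" by simp
  have 1: "card ?C1 \<le> card (F \<inter> K)"
    using e fin by (intro card_inj_on_le[of e]) (auto intro: inj_on_subset)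
  have 2: "card ?C2 \<le> card (K - F)"
    using e fin by (intro card_inj_on_le[of e]) (auto intro: inj_on_subset)
  have cK: "real (card K) = real (card (F \<inter> K)) + real (card (K - F))"
    using fin card_Int_Diff[of K F] by (simp add: Int_commute)
  show ?thesis
  proof (cases "card K = 0")
    case True
    then have "K = {}" using fin by simp
    then have "C = {}" using e(2) by blast
    then show ?thesis using True dev' by simp
  next
    case False
    then have K: "real (card K) > 0" by simp
    from hom have "real (card (F \<inter> K)) < \<mu> * real (card K) \<or> (1 - \<mu>) * real (card K) < real (card (F \<inter> K))"
      using K by (auto simp: divide_less_eq less_divide_eq)
    then have "real (card ?C1) \<le> \<mu> * real (card K) \<or> real (card ?C2) \<le> \<mu> * real (card K)"
      using 1 2 cK by (auto simp: left_diff_distrib)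
    then show ?thesis using dev' cC by linarith
  qed
qed

text \<open>The constant 1/100 is fitted to \<open>3 * n\<close> vertices, that is, to at most
  \<open>27 * n ^ 3\<close> triples. Of the \<open>n ^ 3\<close> transversal triples, homogeneous
  triads contain at most the share 54/100 by homogeneity and 10/100 by random deviation, and at most
  27/100 lie outside such triads; the sum is below 1.\<close>

theorem VC2_bounded_if_disc23_homogeneous:
  fixes \<H> :: "'a hgraph set"
  assumes her: "hereditary \<H>" and hom: "disc23_homogeneous \<H>"
  shows "\<exists>k\<ge>1. \<forall>H\<in>\<H>. VC2 H \<le> k"
proof (rule ccontr)
  assume unbounded: "\<not> (\<exists>k\<ge>1. \<forall>H\<in>\<H>. VC2 H \<le> k)"
  have "\<exists>T L N. \<forall>H\<in>\<H>. N \<le> card (fst H) \<longrightarrow>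
           (\<exists>t l A P. 1 \<le> t \<and> t \<le> T \<and> 1 \<le> l \<and> l \<le> L \<and>
              decomposition t l (1 / 100) 1 (fst H) A P \<and>
              regular_decomp t l A P (1 / 100) 1 H \<and>
              homogeneous_decomp t l A P (1 / 100) H)"
    using hom[unfolded disc23_homogeneous_def, rule_format, of 1 1 "1 / 100" "\<lambda>_. 1"] by simp
  then obtain T L N where TLN: "\<forall>H\<in>\<H>. N \<le> card (fst H) \<longrightarrow>
           (\<exists>t l A P. 1 \<le> t \<and> t \<le> T \<and> 1 \<le> l \<and> l \<le> L \<and>
              decomposition t l (1 / 100) 1 (fst H) A P \<and>
              regular_decomp t l A P (1 / 100) 1 H \<and>
              homogeneous_decomp t l A P (1 / 100) H)" by (elim exE)
  define K where "K = real (T ^ 3 * L ^ 3)"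
  have K0: "0 \<le> K" by (simp add: K_def)
  \<comment> \<open>\<open>K\<close> bounds the number of index tuples of triads. Each contributes a
    deviation of at most \<open>2 * \<delta> * n ^ 3\<close>, in total at most
    \<open>n ^ 3 / 10\<close>.\<close>
  define \<delta> where "\<delta> = 1 / (20 * (K + 1))"
  have \<delta>: "0 < \<delta>" "\<delta> \<le> 1" "2 * \<delta> * K \<le> 1 / 10" using K0 by (auto simp: \<delta>_def field_simps)
  obtain n0 where n0: "\<forall>n\<ge>n0. \<exists>R :: nat \<times> nat \<times> nat \<Rightarrow> bool. \<forall>E1 E2 E3.
    \<bar>\<Sum>q\<in>{1..n} \<times> {1..n} \<times> {1..n}.
       of_bool (case q of (x, y, z) \<Rightarrow> (x, y) \<in> E1 \<and> (x, z) \<in> E2 \<and> (y, z) \<in> E3) * (if R q then 1 / 2 else - 1 / 2)\<bar>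
      \<le> \<delta> * real n ^ 3" using ex_quasirandom_relation[OF \<delta>(1,2)] by (elim exE)
  define n where "n = max n0 (max N 1)"
  have n: "n0 \<le> n" "N \<le> n" "1 \<le> n" by (auto simp: n_def)
  obtain R :: "nat \<times> nat \<times> nat \<Rightarrow> bool" where R: "\<forall>E1 E2 E3.
    \<bar>\<Sum>q\<in>{1..n} \<times> {1..n} \<times> {1..n}.
       of_bool (case q of (x, y, z) \<Rightarrow> (x, y) \<in> E1 \<and> (x, z) \<in> E2 \<and> (y, z) \<in> E3) * (if R q then 1 / 2 else - 1 / 2)\<bar>
      \<le> \<delta> * real n ^ 3" using mp[OF spec[OF n0, of n] n(1)] by (elim exE)
  obtain H where H: "H \<in> \<H>" "n + 2 < VC2 H" using unbounded by (metis le_add2 le_trans not_le one_le_numeral)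
  have finH: "finite (fst H)" and gH: "graph3 H" using her H(1) unfolding hereditary_def by blast+
  have sh: "VC2_shattered H (VC2 H)" using H(2) by (intro VC2_shattered_VC2[OF finH]) auto
  obtain a b c where
    inj: "inj_on a {1..n}" "inj_on b {1..n}" "inj_on c {1..n}"
    and sub: "a ` {1..n} \<subseteq> fst H" "b ` {1..n} \<subseteq> fst H" "c ` {1..n} \<subseteq> fst H"
    and dj: "a ` {1..n} \<inter> b ` {1..n} = {}" "a ` {1..n} \<inter> c ` {1..n} = {}" "b ` {1..n} \<inter> c ` {1..n} = {}"
    and edge: "\<forall>u\<in>{1..n}. \<forall>i\<in>{1..n}. \<forall>j\<in>{1..n}. {a u, b i, c j} \<in> snd H \<longleftrightarrow> R (u, i, j)"
    using shattered_embeds_tripartite[OF sh less_imp_le[OF H(2)] gH, of R] by (elim exE conjE)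
  \<comment> \<open>Passing to the induced 3-graph on the three classes makes the transversal
    triples a fixed fraction of all triples, so they cannot hide among the exceptional ones. This is
    where closure under induced sub-3-graphs enters.\<close>
  define U where "U = a ` {1..n} \<union> b ` {1..n} \<union> c ` {1..n}"
  define F where "F = {e \<in> snd H. e \<subseteq> U}"
  have "U \<subseteq> fst H" unfolding U_def using sub by (intro Un_least)
  moreover have "\<forall>H\<in>\<H>. \<forall>U\<subseteq>fst H. induced H U \<in> \<H>" using her unfolding hereditary_def by (elim conjE)
  ultimately have "induced H U \<in> \<H>" using H(1) by blast
  then have UF: "(U, F) \<in> \<H>" by (simp add: induced_def F_def)
  have cU: "card U = 3 * n"
  proof -
    have "card U = card (a ` {1..n} \<union> b ` {1..n}) + card (c ` {1..n})"
      unfolding U_def using dj by (intro card_Un_disjoint) auto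
    also have "card (a ` {1..n} \<union> b ` {1..n}) = card (a ` {1..n}) + card (b ` {1..n})"
      using dj by (intro card_Un_disjoint) auto
    finally show ?thesis using inj by (simp add: card_image)
  qed
  have finU: "finite U" by (simp add: U_def)
  have N: "N \<le> card (fst (U, F))" using n(2) cU by simp
  obtain t l A P where t: "1 \<le> t" "t \<le> T" and l: "1 \<le> l" "l \<le> L"
    and dec: "decomposition t l (1 / 100) 1 U A P" and homd: "homogeneous_decomp t l A P (1 / 100) (U, F)"
    using mp[OF bspec[OF TLN UF] N] unfolding fst_conv by (elim exE conjE)
  have A: "(\<Union>i\<in>{1..t}. A i) = U" "disjoint_family_on A {1..t}"
    and P: "\<forall>i\<in>{1..t}. \<forall>j\<in>{1..t}. i \<noteq> j \<longrightarrow>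
      (\<Union>\<alpha>\<in>{1..l}. P {i, j} \<alpha>) = K2 (A i) (A j) \<and> disjoint_family_on (P {i, j}) {1..l}"
    using dec unfolding decomposition_def by blast+
  let ?X = "{1..n} \<times> {1..n} \<times> {1..n}"
  define e where "e = (\<lambda>(u, i, j). {a u, b i, c j})"
  have e_ne: "a u \<noteq> b i \<and> a u \<noteq> c j \<and> b i \<noteq> c j" if "u \<in> {1..n}" "i \<in> {1..n}" "j \<in> {1..n}" for u i j
    using dj that by blast
  have e_inj: "inj_on e ?X"
  proof (rule inj_onI)
    fix q q' assume q: "q \<in> ?X" "q' \<in> ?X" "e q = e q'"
    obtain u i j where q1: "q = (u, i, j)" by (cases q)
    obtain u' i' j' where q2: "q' = (u', i', j')" by (cases q')
    have m: "u \<in> {1..n}" "i \<in> {1..n}" "j \<in> {1..n}" "u' \<in> {1..n}" "i' \<in> {1..n}" "j' \<in> {1..n}" using q by (auto simp: q1 q2)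
    have "a u \<in> {a u', b i', c j'}" "b i \<in> {a u', b i', c j'}" "c j \<in> {a u', b i', c j'}"
      using q(3) unfolding e_def q1 q2 by auto
    then have "a u = a u'" "b i = b i'" "c j = c j'"
      using e_ne[OF m(1,5,6)] e_ne[OF m(4,2,6)] e_ne[OF m(4,5,3)] by auto
    then have "u = u'" "i = i'" "j = j'"
      using inj_onD[OF inj(1) _ m(1,4)] inj_onD[OF inj(2) _ m(2,5)] inj_onD[OF inj(3) _ m(3,6)] by blast+
    then show "q = q'" by (simp add: q1 q2)
  qed
  have e_mem: "e q \<in> nsets U 3" if "q \<in> ?X" for q
  proof -
    obtain u i j where q: "q = (u, i, j)" by (cases q)
    have m: "u \<in> {1..n}" "i \<in> {1..n}" "j \<in> {1..n}" using that by (auto simp: q)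
    have "card {a u, b i, c j} = 3" using e_ne[OF m] by simp
    moreover have "{a u, b i, c j} \<subseteq> U" using m by (auto simp: U_def)
    ultimately show ?thesis by (simp add: nsets_def e_def q)
  qed
  have eF: "e q \<in> F \<longleftrightarrow> R q" if "q \<in> ?X" for q
    using that edge e_mem[OF that] by (auto simp: F_def e_def nsets_def)
  have PU: "\<Union> (P {i, j} \<alpha>) \<subseteq> U" if "i \<in> {1..t}" "j \<in> {1..t}" "i \<noteq> j" "\<alpha> \<in> {1..l}" for i j \<alpha>
  proof -
    have "P {i, j} \<alpha> \<subseteq> K2 (A i) (A j)" using P that by blast
    moreover have "A i \<subseteq> U" "A j \<subseteq> U" using A(1) that by auto
    ultimately show ?thesis unfolding K2_def by fastforce
  qed
  define I where "I = {(i, j, k, \<alpha>, \<beta>, \<gamma>). i \<in> {1..t} \<and> j \<in> {1..t} \<and> k \<in> {1..t} \<and>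
      i \<noteq> j \<and> i \<noteq> k \<and> j \<noteq> k \<and> \<alpha> \<in> {1..l} \<and> \<beta> \<in> {1..l} \<and> \<gamma> \<in> {1..l}}"
  define G where "G = (\<lambda>(i, j, k, \<alpha>, \<beta>, \<gamma>). triad A P i j k \<alpha> \<beta> \<gamma>)"
  have finI: "finite I" and cI: "real (card I) \<le> K"
  proof -
    have sub: "I \<subseteq> {1..t} \<times> {1..t} \<times> {1..t} \<times> {1..l} \<times> {1..l} \<times> {1..l}" by (auto simp: I_def)
    then show "finite I" by (rule finite_subset) simp
    have "card I \<le> card ({1..t} \<times> {1..t} \<times> {1..t} \<times> {1..l} \<times> {1..l} \<times> {1..l})" using sub by (intro card_mono) auto
    also have "\<dots> = t ^ 3 * l ^ 3" by (simp add: card_cartesian_product power3_eq_cube)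
    also have "\<dots> \<le> T ^ 3 * L ^ 3" using t l by (intro mult_le_mono power_mono) auto
    finally show "real (card I) \<le> K" unfolding K_def by (rule of_nat_mono)
  qed
  define J where "J = {\<tau> \<in> I. real (card (F \<inter> K3 (G \<tau>))) / real (card (K3 (G \<tau>))) \<in> {0..<1 / 100} \<union> {1 - 1 / 100<..1}}"
  have JI: "J \<subseteq> I" by (auto simp: J_def)
  have finJ: "finite J" using finI JI finite_subset by blast
  \<comment> \<open>Being a triangle of the triad is a condition on the three pairs of a transversal
    triple, so \<open>C \<tau>\<close> is a cylinder on the grid and the quasirandomness of
    \<open>R\<close> applies to it.\<close>
  define C where "C \<tau> = {q \<in> ?X. e q \<in> K3 (G \<tau>)}" for \<tau>
  have cC: "real (card (C \<tau>)) \<le> 2 * (1 / 100) * real (card (K3 (G \<tau>))) + 2 * (\<delta> * real n ^ 3)" if \<tau>J: "\<tau> \<in> J" for \<tau>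
  proof (rule card_quasirandom_le[where X="?X" and R=R and e=e and F=F])
    have "(q \<in> C \<tau>) = (case q of (x, y, z) \<Rightarrow> (x, y) \<in> {(x, y). {a x, b y} \<in> snd (G \<tau>)} \<and>
        (x, z) \<in> {(x, z). {a x, c z} \<in> snd (G \<tau>)} \<and> (y, z) \<in> {(y, z). {b y, c z} \<in> snd (G \<tau>)})" if "q \<in> ?X" for q
    proof -
      obtain u i j where q: "q = (u, i, j)" by (cases q)
      have m: "u \<in> {1..n}" "i \<in> {1..n}" "j \<in> {1..n}" using that by (auto simp: q)
      show ?thesis using K3_iff[of "a u" "b i" "c j" "G \<tau>"] e_ne[OF m] m by (simp add: q C_def e_def)
    qed
    then have "(\<Sum>q\<in>?X. of_bool (q \<in> C \<tau>) * (if R q then 1 / 2 else - 1 / 2 :: real))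
      = (\<Sum>q\<in>?X. of_bool (case q of (x, y, z) \<Rightarrow> (x, y) \<in> {(x, y). {a x, b y} \<in> snd (G \<tau>)} \<and>
        (x, z) \<in> {(x, z). {a x, c z} \<in> snd (G \<tau>)} \<and> (y, z) \<in> {(y, z). {b y, c z} \<in> snd (G \<tau>)}) * (if R q then 1 / 2 else - 1 / 2))"
      by (intro sum.cong[OF refl]) (simp only:)
    then show "\<bar>\<Sum>q\<in>?X. of_bool (q \<in> C \<tau>) * (if R q then 1 / 2 else - 1 / 2)\<bar> \<le> \<delta> * real n ^ 3"
      using R by (simp only:)
    show "C \<tau> \<subseteq> ?X" "\<And>q. q \<in> C \<tau> \<Longrightarrow> e q \<in> K3 (G \<tau>)" by (auto simp: C_def)
    show "inj_on e (C \<tau>)" by (rule inj_on_subset[OF e_inj]) (auto simp: C_def)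
    show "e q \<in> F \<longleftrightarrow> R q" if "q \<in> C \<tau>" for q using that by (intro eF) (auto simp: C_def)
    show "finite (K3 (G \<tau>))"
    proof (rule finite_K3)
      obtain i j k \<alpha> \<beta> \<gamma> where \<tau>: "\<tau> = (i, j, k, \<alpha>, \<beta>, \<gamma>)" by (cases \<tau>)
      have m: "i \<in> {1..t}" "j \<in> {1..t}" "k \<in> {1..t}" "i \<noteq> j" "i \<noteq> k" "j \<noteq> k" "\<alpha> \<in> {1..l}" "\<beta> \<in> {1..l}" "\<gamma> \<in> {1..l}"
        using \<tau>J JI unfolding I_def \<tau> by auto
      have "\<Union> (snd (G \<tau>)) \<subseteq> U"
        using PU[OF m(1,2,4,7)] PU[OF m(1,3,5,8)] PU[OF m(2,3,6,9)] unfolding \<tau> G_def triad_def by auto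
      then show "finite (\<Union> (snd (G \<tau>)))" using finU by (rule finite_subset)
    qed
    show "real (card (F \<inter> K3 (G \<tau>))) / real (card (K3 (G \<tau>))) \<in> {0..<1 / 100} \<union> {1 - 1 / 100<..1}"
      using \<tau>J by (simp only: J_def mem_Collect_eq)
  qed simp
  define Good where "Good = {T \<in> nsets U 3. \<exists>\<tau>\<in>J. T \<in> K3 (G \<tau>)}"
  have finN: "finite (nsets U 3)" using finU by (simp add: finite_imp_finite_nsets)
  have Good: "(1 - 1 / 100) * real (card U choose 3) \<le> real (card Good)"
  proof -
    have "{T \<in> nsets U 3. \<exists>i j k \<alpha> \<beta> \<gamma>.
        {i, j, k} \<in> nsets {1..t} 3 \<and> \<alpha> \<in> {1..l} \<and> \<beta> \<in> {1..l} \<and> \<gamma> \<in> {1..l} \<and>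
        (let G = triad A P i j k \<alpha> \<beta> \<gamma> in
          T \<in> K3 G \<and>
          real (card (F \<inter> K3 G)) / real (card (K3 G)) \<in> {0..<1 / 100} \<union> {1 - 1 / 100<..1})} \<subseteq> Good"
    proof (rule subsetI, elim CollectE conjE exE)
      fix T i j k \<alpha> \<beta> \<gamma>
      assume T: "T \<in> nsets U 3" and ijk: "{i, j, k} \<in> nsets {1..t} 3" and abg: "\<alpha> \<in> {1..l}" "\<beta> \<in> {1..l}" "\<gamma> \<in> {1..l}"
        and h: "let G = triad A P i j k \<alpha> \<beta> \<gamma> in
          T \<in> K3 G \<and> real (card (F \<inter> K3 G)) / real (card (K3 G)) \<in> {0..<1 / 100} \<union> {1 - 1 / 100<..1}"
      have "card {i, j, k} = 3" "{i, j, k} \<subseteq> {1..t}" using ijk by (auto simp: nsets_def)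
      then have "i \<in> {1..t} \<and> j \<in> {1..t} \<and> k \<in> {1..t} \<and> i \<noteq> j \<and> i \<noteq> k \<and> j \<noteq> k"
        by (auto simp: card_insert_if split: if_splits)
      then have "(i, j, k, \<alpha>, \<beta>, \<gamma>) \<in> I" using abg by (simp add: I_def)
      then have "(i, j, k, \<alpha>, \<beta>, \<gamma>) \<in> J" using h by (simp only: J_def mem_Collect_eq G_def prod.case Let_def)
      moreover have "T \<in> K3 (G (i, j, k, \<alpha>, \<beta>, \<gamma>))" using h by (simp only: G_def prod.case Let_def)
      ultimately show "T \<in> Good" using T unfolding Good_def by blast
    qed
    then have "card {T \<in> nsets U 3. \<exists>i j k \<alpha> \<beta> \<gamma>.
        {i, j, k} \<in> nsets {1..t} 3 \<and> \<alpha> \<in> {1..l} \<and> \<beta> \<in> {1..l} \<and> \<gamma> \<in> {1..l} \<and>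
        (let G = triad A P i j k \<alpha> \<beta> \<gamma> in
          T \<in> K3 G \<and>
          real (card (F \<inter> K3 G)) / real (card (K3 G)) \<in> {0..<1 / 100} \<union> {1 - 1 / 100<..1})} \<le> card Good"
      using finN by (intro card_mono) (auto simp: Good_def)
    then show ?thesis
      using homd unfolding homogeneous_decomp_def fst_conv snd_conv by linarith
  qed
  have cX: "real (card ?X) = real n ^ 3" by (simp add: card_cartesian_product power3_eq_cube mult.assoc)
  have "?X \<subseteq> (\<Union>\<tau>\<in>J. C \<tau>) \<union> {q \<in> ?X. e q \<notin> Good}"
  proof
    fix q assume q: "q \<in> ?X"
    show "q \<in> (\<Union>\<tau>\<in>J. C \<tau>) \<union> {q \<in> ?X. e q \<notin> Good}"
    proof (cases "e q \<in> Good")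
      case True
      then obtain \<tau> where "\<tau> \<in> J" "e q \<in> K3 (G \<tau>)" unfolding Good_def by blast
      then show ?thesis using q unfolding C_def by blast
    qed (use q in blast)
  qed
  then have "card ?X \<le> card ((\<Union>\<tau>\<in>J. C \<tau>) \<union> {q \<in> ?X. e q \<notin> Good})"
    using finJ by (intro card_mono) (auto simp: C_def)
  also have "\<dots> \<le> card (\<Union>\<tau>\<in>J. C \<tau>) + card {q \<in> ?X. e q \<notin> Good}" by (rule card_Un_le)
  also have "\<dots> \<le> (\<Sum>\<tau>\<in>J. card (C \<tau>)) + card {q \<in> ?X. e q \<notin> Good}"
    by (intro add_right_mono card_UN_le finJ)
  finally have main: "real n ^ 3 \<le> (\<Sum>\<tau>\<in>J. real (card (C \<tau>))) + real (card {q \<in> ?X. e q \<notin> Good})"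
    unfolding cX[symmetric] by (simp only: of_nat_le_iff flip: of_nat_sum of_nat_add)
  have n3: "0 < real n ^ 3" using n(3) by simp
  have bad: "real (card {q \<in> ?X. e q \<notin> Good}) \<le> 27 / 100 * real n ^ 3"
  proof -
    have "card {q \<in> ?X. e q \<notin> Good} \<le> card (nsets U 3 - Good)"
      using e_mem finN by (intro card_inj_on_le[of e]) (auto intro: inj_on_subset[OF e_inj])
    also have "\<dots> = card (nsets U 3) - card Good"
      using finN by (intro card_Diff_subset finite_subset[of Good "nsets U 3"]) (auto simp: Good_def)
    finally have "real (card {q \<in> ?X. e q \<notin> Good}) \<le> real (card U choose 3) - real (card Good)"
      using card_mono[OF finN, of Good] by (auto simp: Good_def)
    also have "\<dots> \<le> 1 / 100 * real (card U choose 3)"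
    proof -
      have "99 / 100 * real (card U choose 3) \<le> real (card Good)" using Good by simp
      then show ?thesis by linarith
    qed
    also have "\<dots> \<le> 1 / 100 * real (card U ^ 3)"
    proof -
      have "card U choose 3 \<le> card U ^ 3" using cU n(3) by (intro binomial_le_pow) simp
      then have "real (card U choose 3) \<le> real (card U ^ 3)" by (rule of_nat_mono)
      then show ?thesis by simp
    qed
    finally show ?thesis by (simp add: cU power_mult_distrib)
  qed
  have "(\<Sum>\<tau>\<in>J. real (card (C \<tau>))) \<le> (\<Sum>\<tau>\<in>J. 2 * (1 / 100) * real (card (K3 (G \<tau>))) + 2 * (\<delta> * real n ^ 3))"
    by (intro sum_mono cC)
  also have "\<dots> \<le> (\<Sum>\<tau>\<in>I. 2 * (1 / 100) * real (card (K3 (G \<tau>))) + 2 * (\<delta> * real n ^ 3))"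
    using finI JI \<delta> by (intro sum_mono2) auto
  also have "\<dots> = 2 / 100 * real (\<Sum>\<tau>\<in>I. card (K3 (G \<tau>))) + 2 * \<delta> * real (card I) * real n ^ 3"
    by (simp add: sum.distrib sum_distrib_left)
  also have "\<dots> \<le> 54 / 100 * real n ^ 3 + 1 / 10 * real n ^ 3"
  proof (rule add_mono)
    have "(\<Sum>\<tau>\<in>I. card (K3 (G \<tau>))) \<le> card U ^ 3"
      using sum_card_K3_triads_le[OF finU A P] unfolding I_def G_def by (simp add: case_prod_unfold)
    then have "real (\<Sum>\<tau>\<in>I. card (K3 (G \<tau>))) \<le> real (card U ^ 3)" by (rule of_nat_mono)
    also have "\<dots> = 27 * real n ^ 3" by (simp add: cU power_mult_distrib)
    finally have "real (\<Sum>\<tau>\<in>I. card (K3 (G \<tau>))) \<le> 27 * real n ^ 3" .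
    then show "2 / 100 * real (\<Sum>\<tau>\<in>I. card (K3 (G \<tau>))) \<le> 54 / 100 * real n ^ 3" by simp
    have "2 * \<delta> * real (card I) \<le> 2 * \<delta> * K" using cI \<delta>(1) by (intro mult_left_mono) auto
    then show "2 * \<delta> * real (card I) * real n ^ 3 \<le> 1 / 10 * real n ^ 3"
      using \<delta>(3) by (intro mult_right_mono) auto
  qed
  finally show False using main bad n3 by linarith
qed

theorem theorem2p26:
  fixes \<H> :: "'a hgraph set"
  assumes "hereditary \<H>"
  shows "disc23_homogeneous \<H> \<longleftrightarrow> (\<exists>k\<ge>1. \<forall>H\<in>\<H>. VC2 H \<le> k)"
proof
  show "\<exists>k\<ge>1. \<forall>H\<in>\<H>. VC2 H \<le> k" if "disc23_homogeneous \<H>"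
    using VC2_bounded_if_disc23_homogeneous[OF assms that] .
  assume "\<exists>k\<ge>1. \<forall>H\<in>\<H>. VC2 H \<le> k"
  then obtain k where k: "\<And>H. H \<in> \<H> \<Longrightarrow> VC2 H \<le> k" by blast
  have fin: "finite (fst H)" if "H \<in> \<H>" for H using assms that unfolding hereditary_def by blast
  show "disc23_homogeneous \<H>"
  proof (rule disc23_homogeneous_if_VC2_bounded[OF fin])
    show "\<not> VC2_shattered H (Suc k)" if "H \<in> \<H>" for H
      using VC2_shattered_le_VC2[OF fin[OF that], of "Suc k"] k[OF that] by auto
  qed
qed

end
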